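(* Let $K$ be an algebraically closed field of characteristic zero, let $a\ge1$ and $b\ge2$, and let $X=\sigma(\mathbb{P}^a\times\mathbb{P}^b)\subset\mathbb{P}^N$, $N=ab+a+b$, be the Segre variety. Let $q\in\mathrm{Sec}(X)$ be a closed point outside of $X$. Then $\Sigma_q(X)$ is a smooth quadric surface. Therefore $\mathrm{Sec}(X)=\mathrm{Tan}(X)$ and $\dim\mathrm{Tan}(X)=2(a+b)-1$. The secant stratification of $X$ is $$\mathbb{P}^N=SL_{-1}(X)\cup SL_2(X)\cup SL_{a+b}(X),$$ where $SL_2(X)=\mathrm{Sec}(X)\setminus X$ and $SL_{a+b}(X)=X$.
   Context: For a projective variety $X\subset\mathbb{P}^N$ of dimension $n$ and a closed point $q\in\mathbb{P}^N\setminus X$, let $\pi_q:X\to\mathbb{P}^{N-1}$ be the linear projection from $q$. The secant locus $\Sigma_q(X)$ is the set of all points of $X$ spanning secant lines through $q$, i.e. points $x\in X$ such that the line $\langle q,x\rangle$ meets $X$ in a scheme of length at least $2$ (tangent lines included); it carries the scheme structure of the intersection of $X$ with the cone with vertex $q$ over $\pi_q(\Sigma_q(X))$. For $-1\le s\le n$, $SL_s(X)$ is the set of closed points $q\in\mathbb{P}^N$ with $\dim\Sigma_q(X)=s$, with the conventions $\dim\Sigma_q(X)=-1$ if $\Sigma_q(X)=\emptyset$ and $\dim\Sigma_q(X)=n$ if $q\in X$ (here $n=a+b$). The decomposition $\mathbb{P}^N=\bigcup_{-1\le s\le n}SL_s(X)$ is the secant stratification of $X$; strata not listed are empty. $\mathrm{Tan}(X)=\bigcup_{x\in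 X}T_xX\subset\mathbb{P}^N$ is the union of embedded projective tangent spaces, and $\mathrm{Sec}(X)=\overline{\bigcup_{x_1\ne x_2\in X}\langle x_1,x_2\rangle}\subset\mathbb{P}^N$ is the secant variety. *)

theory Defs
  imports
    "HOL-Analysis.Analysis"
    "HOL-Library.Poly_Mapping"
    "HOL-Computational_Algebra.Polynomial"
begin

section \<open>Polynomials in finitely many variables\<close>

type_synonym ('k, 'i) mpoly = "('i \<Rightarrow>\<^sub>0 nat) \<Rightarrow>\<^sub>0 'k"

definition mconst :: "'k::zero \<Rightarrow> ('k, 'i) mpoly"
  where "mconst c = Poly_Mapping.single 0 c"

definition mvar :: "'i \<Rightarrow> ('k::comm_ring_1, 'i) mpoly"
  where "mvar i = Poly_Mapping.single (Poly_Mapping.single i 1) 1"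

text \<open>Substitution of \<open>\<sigma> i\<close> for the variable \<open>i\<close>, the coefficients being mapped by \<open>h\<close>.\<close>

definition msubst ::
    "('k::zero \<Rightarrow> 'r) \<Rightarrow> ('i::finite \<Rightarrow> 'r) \<Rightarrow> ('k, 'i) mpoly \<Rightarrow> 'r::comm_ring_1"
  where "msubst h \<sigma> p =
    (\<Sum>m\<in>Poly_Mapping.keys p.
       h (Poly_Mapping.lookup p m) * (\<Prod>i\<in>UNIV. \<sigma> i ^ Poly_Mapping.lookup m i))"

definition meval :: "('k::comm_ring_1, 'i::finite) mpoly \<Rightarrow> 'k ^ 'i \<Rightarrow> 'k"
  where "meval p v = msubst (\<lambda>c. c) (\<lambda>i. v $ i) p"

text \<open>The polynomial \<open>p \<circ> A\<close> in the coordinates of the source of the linear map \<open>A\<close>.\<close>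

definition mpullback ::
    "'k::comm_ring_1 ^ 'j::finite ^ 'i::finite \<Rightarrow> ('k, 'i) mpoly \<Rightarrow> ('k, 'j) mpoly"
  where "mpullback A p = msubst mconst (\<lambda>i. \<Sum>j\<in>UNIV. mconst (A $ i $ j) * mvar j) p"

definition mpderiv :: "'i \<Rightarrow> ('k::comm_ring_1, 'i) mpoly \<Rightarrow> ('k, 'i) mpoly"
  where "mpderiv i p =
    (\<Sum>m\<in>Poly_Mapping.keys p.
       Poly_Mapping.single (m - Poly_Mapping.single i 1)
         (of_nat (Poly_Mapping.lookup m i) * Poly_Mapping.lookup p m))"

text \<open>The space of forms of degree \<open>d\<close>; it contains \<open>0\<close>.\<close>

definition forms :: "nat \<Rightarrow> ('k::comm_ring_1, 'i::finite) mpoly set"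
  where "forms d =
    {p. \<forall>m\<in>Poly_Mapping.keys p. (\<Sum>i\<in>UNIV. Poly_Mapping.lookup m i) = d}"

global_interpretation mpoly: vector_space "\<lambda>(c::'k::field) (p::('k, 'i) mpoly). mconst c * p"
  by unfold_locales
    (simp_all add: mconst_def distrib_left distrib_right single_add mult.assoc[symmetric] mult_single)


section \<open>Projective space and its Zariski topology\<close>

text \<open>The points of the projective space over \<open>'k\<close> with homogeneous coordinates indexed by
  \<open>'i\<close> (so of dimension \<open>CARD('i) - 1\<close>) are the one-dimensional subspaces of \<open>'k ^ 'i\<close>.
  Over an algebraically closed field these are exactly the closed points.\<close>

typedef (overloaded) ('k, 'i) proj =
    "{L :: ('k::field ^ 'i::finite) set. \<exists>v. v \<noteq> 0 \<and> L = vec.span {v}}"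
  morphisms line_of proj_of
  by (auto intro!: exI[of _ "axis undefined 1"] simp: axis_eq_0_iff)

definition vanishes_at :: "('k::field, 'i::finite) mpoly \<Rightarrow> ('k, 'i) proj \<Rightarrow> bool"
  where "vanishes_at f P \<longleftrightarrow> (\<forall>v\<in>line_of P. v \<noteq> 0 \<longrightarrow> meval f v = 0)"

definition zero_locus :: "('k::field, 'i::finite) mpoly set \<Rightarrow> ('k, 'i) proj set"
  where "zero_locus F = {P. \<forall>f\<in>F. vanishes_at f P}"

definition zariski_closed :: "('k::field, 'i::finite) proj set \<Rightarrow> bool"
  where "zariski_closed Z \<longleftrightarrow> (\<exists>F. F \<subseteq> (\<Union>d. forms d) \<and> Z = zero_locus F)"

definition zariski :: "('k::field, 'i::finite) proj topology"
  where "zariski = topology (\<lambda>U. zariski_closed (- U))"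

text \<open>All polynomials vanishing on all representatives of the points of \<open>Z\<close>. For infinite
  \<open>'k\<close> this is the homogeneous ideal generated by the forms vanishing on \<open>Z\<close>.\<close>

definition vanishing_ideal :: "('k::field, 'i::finite) proj set \<Rightarrow> ('k, 'i) mpoly set"
  where "vanishing_ideal Z = {f. \<forall>P\<in>Z. vanishes_at f P}"

definition irreducible_in :: "'a topology \<Rightarrow> 'a set \<Rightarrow> bool"
  where "irreducible_in T S \<longleftrightarrow>
    S \<noteq> {} \<and> S \<subseteq> topspace T \<and>
    (\<forall>A B. closedin T A \<and> closedin T B \<and> S \<subseteq> A \<union> B \<longrightarrow> S \<subseteq> A \<or> S \<subseteq> B)"

text \<open>Krull dimension: the supremum of the lengths \<open>n\<close> of chains
  \<open>C 0 \<subset> \<dots> \<subset> C n\<close> of irreducible closed subsets. The empty space has dimension \<open>-1\<close>. The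
  supremum of a set of integers that is not bounded above is unspecified; this does not occur
  for subspaces of a projective space.\<close>

definition krull_dim :: "'a topology \<Rightarrow> int"
  where "krull_dim T = Sup (insert (-1) {int n | n. \<exists>C :: nat \<Rightarrow> 'a set.
      (\<forall>i\<le>n. closedin T (C i) \<and> irreducible_in T (C i)) \<and> (\<forall>i<n. C i \<subset> C (Suc i))})"

definition proj_dim :: "('k::field, 'i::finite) proj set \<Rightarrow> int"
  where "proj_dim Z = krull_dim (subtopology zariski Z)"


section \<open>Closed subschemes\<close>

text \<open>A closed subscheme of projective space is given by a homogeneous ideal, two such ideals
  defining the same subscheme iff they have the same saturation. The scheme-theoretic
  intersection corresponds to the sum of ideals.\<close>

definition saturation :: "('k::field, 'i::finite) mpoly set \<Rightarrow> ('k, 'i) mpoly set"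
  where "saturation I = {f. \<exists>k. \<forall>g\<in>forms k. f * g \<in> I}"

definition ideal_sum :: "('k::field, 'i) mpoly set \<Rightarrow> ('k, 'i) mpoly set \<Rightarrow> ('k, 'i) mpoly set"
  where "ideal_sum I J = {f + g | f g. f \<in> I \<and> g \<in> J}"

definition hilbert_function :: "('k::field, 'i::finite) mpoly set \<Rightarrow> nat \<Rightarrow> nat"
  where "hilbert_function I d =
    mpoly.dim (forms d :: ('k, 'i) mpoly set) - mpoly.dim (I \<inter> forms d)"

text \<open>The length of the subscheme defined by \<open>I\<close>: if the subscheme is finite then its Hilbert
  polynomial is constant, equal to the dimension of its algebra of functions; otherwise the
  Hilbert function tends to infinity.\<close>

definition scheme_length :: "('k::field, 'i::finite) mpoly set \<Rightarrow> enat"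
  where "scheme_length I =
    (if \<exists>n. \<forall>\<^sub>F d in sequentially. hilbert_function I d = n
     then enat (THE n. \<forall>\<^sub>F d in sequentially. hilbert_function I d = n)
     else \<infinity>)"

text \<open>The image of the surface \<open>Q = 0\<close> under a linear embedding \<open>A\<close> of projective 3-space,
  where \<open>Q\<close> is a quadratic form satisfying the Jacobian criterion. The saturated ideal of this
  image consists of the polynomials whose restriction to the 3-space is a multiple of \<open>Q\<close>.\<close>

definition smooth_quadric_surface :: "('k::field, 'i::finite) mpoly set \<Rightarrow> bool"
  where "smooth_quadric_surface I \<longleftrightarrow>
    (\<exists>(A :: 'k ^ 4 ^ 'i) (Q :: ('k, 4) mpoly).
        inj ((*v) A) \<and> Q \<in> forms 2 \<and>
        (\<forall>v. v \<noteq> 0 \<and> meval Q v = 0 \<longrightarrow> (\<exists>i. meval (mpderiv i Q) v \<noteq> 0)) \<and>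
        saturation I = {f. Q dvd mpullback A f})"


section \<open>Secant loci, secant and tangent varieties\<close>

definition proj_line :: "('k::field, 'i::finite) proj \<Rightarrow> ('k, 'i) proj \<Rightarrow> ('k, 'i) proj set"
  where "proj_line P Q = {R. line_of R \<subseteq> vec.span (line_of P \<union> line_of Q)}"

definition secant_variety :: "('k::field, 'i::finite) proj set \<Rightarrow> ('k, 'i) proj set"
  where "secant_variety X =
    zariski closure_of (\<Union>{proj_line x y | x y. x \<in> X \<and> y \<in> X \<and> x \<noteq> y})"

definition embedded_tangent_space ::
    "('k::field, 'i::finite) proj set \<Rightarrow> ('k, 'i) proj \<Rightarrow> ('k, 'i) proj set"
  where "embedded_tangent_space X x =
    {P. \<forall>f\<in>vanishing_ideal X. \<forall>u\<in>line_of x. \<forall>v\<in>line_of P.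
        f \<in> (\<Union>d. forms d) \<and> u \<noteq> 0 \<longrightarrow> (\<Sum>i\<in>UNIV. meval (mpderiv i f) u * v $ i) = 0}"

definition tangent_variety :: "('k::field, 'i::finite) proj set \<Rightarrow> ('k, 'i) proj set"
  where "tangent_variety X = (\<Union>x\<in>X. embedded_tangent_space X x)"

text \<open>Meaningful for \<open>q \<notin> X\<close>, as is \<open>secant_scheme_ideal\<close> below.\<close>

definition secant_locus ::
    "('k::field, 'i::finite) proj \<Rightarrow> ('k, 'i) proj set \<Rightarrow> ('k, 'i) proj set"
  where "secant_locus q X =
    {x \<in> X. scheme_length
       (ideal_sum (vanishing_ideal X) (vanishing_ideal (proj_line q x))) \<ge> 2}"

text \<open>The cone with vertex \<open>q\<close> over the image of \<open>S\<close> under the linear projection from \<open>q\<close>: that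
  projection maps a point \<open>x \<noteq> q\<close> to the line joining \<open>q\<close> and \<open>x\<close>.\<close>

definition cone_over_projection ::
    "('k::field, 'i::finite) proj \<Rightarrow> ('k, 'i) proj set \<Rightarrow> ('k, 'i) proj set"
  where "cone_over_projection q S = insert q (\<Union>x\<in>S. proj_line q x)"

text \<open>An ideal of the scheme structure on the secant locus, the cone being reduced.\<close>

definition secant_scheme_ideal ::
    "('k::field, 'i::finite) proj \<Rightarrow> ('k, 'i) proj set \<Rightarrow> ('k, 'i) mpoly set"
  where "secant_scheme_ideal q X =
    ideal_sum (vanishing_ideal X)
      (vanishing_ideal (cone_over_projection q (secant_locus q X)))"

definition secant_locus_dim :: "('k::field, 'i::finite) proj \<Rightarrow> ('k, 'i) proj set \<Rightarrow> int"
  where "secant_locus_dim q X = (if q \<in> X then proj_dim X else proj_dim (secant_locus q X))"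

definition SL :: "int \<Rightarrow> ('k::field, 'i::finite) proj set \<Rightarrow> ('k, 'i) proj set"
  where "SL s X = {q. secant_locus_dim q X = s}"


section \<open>The Segre variety\<close>

definition segre_map ::
    "('k::field, 'm::finite) proj \<Rightarrow> ('k, 'n::finite) proj \<Rightarrow> ('k, 'm \<times> 'n) proj"
  where "segre_map P Q =
    proj_of {\<chi> ij. x $ fst ij * y $ snd ij | x y. x \<in> line_of P \<and> y \<in> line_of Q}"

definition segre_variety :: "('k::field, 'm::finite \<times> 'n::finite) proj set"
  where "segre_variety = {segre_map P Q | P Q. True}"


section \<open>Well-definedness\<close>

lemma vec_span_singleton: "vec.span {v} = {c *s v | c. True}"
  by (auto simp: vec.span_singleton)

lemma line_of_segre_map:
  "line_of (segre_map P Q) =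
    {\<chi> ij. x $ fst ij * y $ snd ij | x y. x \<in> line_of P \<and> y \<in> line_of Q}"
    (is "_ = ?L")
proof -
  obtain v where v: "v \<noteq> 0" "line_of P = vec.span {v}" using line_of[of P] by auto
  obtain w where w: "w \<noteq> 0" "line_of Q = vec.span {w}" using line_of[of Q] by auto
  define u where "u = (\<chi> ij. v $ fst ij * w $ snd ij)"
  obtain i j where "v $ i \<noteq> 0" "w $ j \<noteq> 0"
    using v w by (auto simp: vec_eq_iff)
  then have "u $ (i, j) \<noteq> 0" by (simp add: u_def)
  then have "u \<noteq> 0" by (metis zero_index)
  moreover have "?L = vec.span {u}"
  proof -
    have *: "(\<chi> ij. (c *s v) $ fst ij * (d *s w) $ snd ij) = (c * d) *s u" for c d
      by (simp add: u_def vec_eq_iff)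
    have "?L = {\<chi> ij. (c *s v) $ fst ij * (d *s w) $ snd ij | c d. True}"
      unfolding v w vec_span_singleton by blast
    also have "\<dots> = {(c * d) *s u | c d. True}"
      by (simp only: *)
    also have "\<dots> = {c *s u | c. True}"
    proof -
      have "\<exists>c d. e *s u = (c * d) *s u" for e
        by (rule exI[of _ e], rule exI[of _ 1]) simp
      then show ?thesis by blast
    qed
    finally show ?thesis by (simp only: vec_span_singleton)
  qed
  ultimately show ?thesis
    unfolding segre_map_def by (subst proj_of_inverse) auto
qed

lemma msubst_superset:
  assumes "finite M" "Poly_Mapping.keys p \<subseteq> M" "h 0 = 0"
  shows "msubst h \<sigma> p =
    (\<Sum>m\<in>M. h (Poly_Mapping.lookup p m) * (\<Prod>i\<in>UNIV. \<sigma> i ^ Poly_Mapping.lookup m i))"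
  unfolding msubst_def using assms
  by (intro sum.mono_neutral_left) (auto simp: in_keys_iff)

lemma meval_add: "meval (p + q) v = meval p v + meval q v"
proof -
  define M where "M = Poly_Mapping.keys p \<union> Poly_Mapping.keys q"
  have "finite M" "Poly_Mapping.keys (p + q) \<subseteq> M"
    unfolding M_def using Poly_Mapping.keys_add[of p q] by auto
  moreover have "Poly_Mapping.keys p \<subseteq> M" "Poly_Mapping.keys q \<subseteq> M"
    by (auto simp: M_def)
  ultimately show ?thesis
    by (simp add: meval_def msubst_superset[of M] lookup_add distrib_right sum.distrib)
qed

lemma meval_zero: "meval 0 v = 0"
  by (simp add: meval_def msubst_def)

lemma meval_sum: "meval (sum f A) v = (\<Sum>a\<in>A. meval (f a) v)"
  by (induction A rule: infinite_finite_induct) (auto simp: meval_zero meval_add)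

lemma meval_single:
  "meval (Poly_Mapping.single m c) v = c * (\<Prod>i\<in>UNIV. v $ i ^ Poly_Mapping.lookup m i)"
  by (auto simp: meval_def msubst_def)

lemma mpoly_sum_single:
  "p = (\<Sum>m\<in>Poly_Mapping.keys p. Poly_Mapping.single m (Poly_Mapping.lookup p m))"
  by (rule poly_mapping_eqI)
    (auto simp: lookup_sum lookup_single when_def in_keys_iff)

lemma meval_mult: "meval (p * q) v = meval p v * meval q v"
proof -
  have "p * q =
    (\<Sum>m\<in>Poly_Mapping.keys p. Poly_Mapping.single m (Poly_Mapping.lookup p m)) *
    (\<Sum>n\<in>Poly_Mapping.keys q. Poly_Mapping.single n (Poly_Mapping.lookup q n))"
    by (simp flip: mpoly_sum_single)
  also have "meval \<dots> v = meval p v * meval q v"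
    by (simp add: sum_product mult_single meval_sum meval_single)
      (simp add: meval_def msubst_def sum_product lookup_add power_add prod.distrib algebra_simps)
  finally show ?thesis .
qed

lemma forms_mult:
  assumes "p \<in> forms d" "q \<in> forms e"
  shows "p * q \<in> forms (d + e)"
proof -
  have "(\<Sum>i\<in>UNIV. Poly_Mapping.lookup m i) = d + e" if m: "m \<in> Poly_Mapping.keys (p * q)" for m
  proof -
    obtain k l where "m = k + l" "k \<in> Poly_Mapping.keys p" "l \<in> Poly_Mapping.keys q"
      using m Poly_Mapping.keys_mult[of p q] by blast
    then show ?thesis
      using assms by (auto simp: forms_def lookup_add sum.distrib)
  qed
  then show ?thesis by (auto simp: forms_def)
qed

lemma vanishes_at_iff:
  assumes "f \<in> forms d" "v \<in> line_of P" "v \<noteq> 0"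
  shows "vanishes_at f P \<longleftrightarrow> meval f v = 0"
proof -
  have *: "meval f (c *s v) = c ^ d * meval f v" for c
  proof -
    have "meval f (c *s v) = (\<Sum>m\<in>Poly_Mapping.keys f. c ^ d *
        (Poly_Mapping.lookup f m * (\<Prod>i\<in>UNIV. v $ i ^ Poly_Mapping.lookup m i)))"
      unfolding meval_def msubst_def
    proof (intro sum.cong refl)
      fix m assume "m \<in> Poly_Mapping.keys f"
      then have "(\<Sum>i\<in>UNIV. Poly_Mapping.lookup m i) = d"
        using assms by (auto simp: forms_def)
      then have "(\<Prod>i\<in>UNIV. c ^ Poly_Mapping.lookup m i) = c ^ d"
        by (metis power_sum)
      then show "Poly_Mapping.lookup f m * (\<Prod>i\<in>UNIV. (c *s v) $ i ^ Poly_Mapping.lookup m i) =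
          c ^ d * (Poly_Mapping.lookup f m * (\<Prod>i\<in>UNIV. v $ i ^ Poly_Mapping.lookup m i))"
        by (simp add: power_mult_distrib prod.distrib algebra_simps)
    qed
    then show ?thesis by (simp add: meval_def msubst_def sum_distrib_left)
  qed
  obtain u where u: "u \<noteq> 0" "line_of P = vec.span {u}" using line_of[of P] by auto
  obtain c where c: "v = c *s u" using assms u by (auto simp: vec_span_singleton)
  with assms have "c \<noteq> 0" by auto
  then have "u = inverse c *s v" by (simp add: c)
  then have "\<exists>e. w = e *s v" if "w \<in> line_of P" for w
    using that u by (auto simp: vec_span_singleton)
  then show ?thesis
    using assms * unfolding vanishes_at_def by fastforce
qed

lemma vanishes_at_mult:
  assumes "f \<in> forms d" "g \<in> forms e"
  shows "vanishes_at (f * g) P \<longleftrightarrow> vanishes_at f P \<or> vanishes_at g P"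
proof -
  obtain u where u: "u \<noteq> 0" "line_of P = vec.span {u}" using line_of[of P] by auto
  then have "u \<in> line_of P" by (simp add: vec.span_base)
  then show ?thesis
    using vanishes_at_iff[OF assms(1)] vanishes_at_iff[OF assms(2)]
      vanishes_at_iff[OF forms_mult[OF assms]] u by (simp add: meval_mult)
qed

lemma istopology_zariski: "istopology (\<lambda>U :: ('k::field, 'i::finite) proj set. zariski_closed (- U))"
  unfolding istopology_def
proof (intro conjI allI impI)
  fix S T :: "('k, 'i) proj set"
  assume "zariski_closed (- S)" "zariski_closed (- T)"
  then obtain F G where F: "F \<subseteq> (\<Union>d. forms d)" "- S = zero_locus F"
    and G: "G \<subseteq> (\<Union>d. forms d)" "- T = zero_locus G"
    unfolding zariski_closed_def by blast
  let ?H = "{f * g | f g. f \<in> F \<and> g \<in> G}"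
  have H: "vanishes_at (f * g) P \<longleftrightarrow> vanishes_at f P \<or> vanishes_at g P"
    if "f \<in> F" "g \<in> G" for f g P
    using that F(1) G(1) vanishes_at_mult by blast
  have "- (S \<inter> T) = zero_locus F \<union> zero_locus G" using F G by blast
  also have "\<dots> = zero_locus ?H"
    unfolding zero_locus_def using H by blast
  finally have "- (S \<inter> T) = zero_locus ?H" .
  moreover have "?H \<subseteq> (\<Union>d. forms d)"
  proof
    fix h assume "h \<in> ?H"
    then obtain f g where fg: "h = f * g" "f \<in> F" "g \<in> G" by auto
    from fg(2) F(1) obtain d where "f \<in> forms d" by blast
    moreover from fg(3) G(1) obtain e where "g \<in> forms e" by blast
    ultimately have "h \<in> forms (d + e)" using fg(1) forms_mult by simp
    then show "h \<in> (\<Union>d. forms d)" by auto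
  qed
  ultimately show "zariski_closed (- (S \<inter> T))"
    unfolding zariski_closed_def by blast
next
  fix \<U> :: "('k, 'i) proj set set"
  assume "\<forall>U\<in>\<U>. zariski_closed (- U)"
  then obtain F where F: "\<And>U. U \<in> \<U> \<Longrightarrow> F U \<subseteq> (\<Union>d. forms d) \<and> - U = zero_locus (F U)"
    unfolding zariski_closed_def by metis
  have "- \<Union> \<U> = (\<Inter>U\<in>\<U>. zero_locus (F U))" using F by auto
  also have "\<dots> = zero_locus (\<Union>U\<in>\<U>. F U)" by (auto simp: zero_locus_def)
  finally have "- \<Union> \<U> = zero_locus (\<Union>U\<in>\<U>. F U)" .
  moreover have "(\<Union>U\<in>\<U>. F U) \<subseteq> (\<Union>d. forms d)" using F by blast
  ultimately show "zariski_closed (- \<Union> \<U>)"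
    unfolding zariski_closed_def by blast
qed

lemma openin_zariski: "openin zariski U \<longleftrightarrow> zariski_closed (- U)"
  unfolding zariski_def by (simp add: topology_inverse' istopology_zariski)

lemma topspace_zariski: "topspace zariski = UNIV"
proof -
  have "zariski_closed ({} :: ('a, 'b) proj set)"
    unfolding zariski_closed_def
  proof (intro exI conjI)
    show "{1} \<subseteq> (\<Union>d. forms d :: ('a, 'b) mpoly set)"
      by (auto simp: forms_def intro!: exI[of _ 0])
    have "\<not> vanishes_at 1 P" for P :: "('a, 'b) proj"
    proof -
      obtain u where "u \<noteq> 0" "line_of P = vec.span {u}" using line_of[of P] by auto
      moreover have "meval 1 u = 1" using meval_single[of 0 1 u] by simp
      ultimately show ?thesis by (metis vanishes_at_def vec.span_base singletonI zero_neq_one)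
    qed
    then show "{} = (zero_locus {1} :: ('a, 'b) proj set)"
      by (auto simp: zero_locus_def)
  qed
  then have "openin zariski (UNIV :: ('a, 'b) proj set)"
    by (simp add: openin_zariski)
  then show ?thesis by (meson openin_subset top.extremum_uniqueI)
qed

lemma closedin_zariski: "closedin zariski Z \<longleftrightarrow> zariski_closed Z"
  unfolding closedin_def topspace_zariski openin_zariski Compl_eq_Diff_UNIV
  by (simp add: double_diff)

end

theory Submission
  imports Defs
begin

text \<open>
  Points of the ambient space are \<open>(a + 1) \<times> (b + 1)\<close> matrices up to scalars, and the Segre
  variety \<open>X\<close> consists of the matrices \<open>u \<otimes> w\<close> of rank one. A sum of two of them has rank at most
  two, and the \<open>3 \<times> 3\<close> minors show that these matrices form a closed set, so that they are the
  secant variety (\<open>mem_secant_variety\<close>). The tangent space at \<open>u \<otimes> w\<close> consists of the matrices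
  \<open>u \<otimes> w' + u' \<otimes> w\<close>: they are the velocities of the curves \<open>(u + s u') \<otimes> (w + s w')\<close>, and the
  derivatives of the \<open>2 \<times> 2\<close> minors exclude everything else. Every \<open>u \<otimes> w + u' \<otimes> w'\<close> has this shape
  at the point \<open>u \<otimes> w'\<close>, hence the secant and tangent varieties agree.

  Let \<open>q\<close> lie outside \<open>X\<close> and \<open>x\<close> on \<open>X\<close>. On the line joining them each \<open>2 \<times> 2\<close> minor is divisible by
  the linear form vanishing at \<open>x\<close>; if the quotients have no common zero, the ideal contains all
  forms vanishing at \<open>x\<close> from degree two on and the length is one. A common zero is a second
  point of \<open>X\<close> or a tangency, and then two independent conditions on forms show that the length
  is at least two (\<open>mem_secant_locus_segre\<close>). Either way \<open>q\<close> has rank at most two, so there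
  are no such \<open>x\<close> for \<open>q\<close> of rank at least three.

  If \<open>q\<close> has rank two, with column space \<open>U\<close> and row space \<open>W\<close>, bases of \<open>U\<close> and \<open>W\<close> can be chosen
  for which \<open>q\<close> becomes the identity among the \<open>2 \<times> 2\<close> matrices \<open>U \<otimes> W\<close>. A decomposition of \<open>q\<close>
  determines \<open>U\<close> and \<open>W\<close>, so the secant locus lies in \<open>U \<otimes> W\<close>; it is the quadric of singular
  \<open>2 \<times> 2\<close> matrices, since the identity is a sum of a multiple of \<open>x\<close> and a matrix of rank one
  if \<open>x\<close> has nonzero trace, and is tangent at \<open>x\<close> otherwise. As \<open>2 \<times> 2\<close> matrices have eigenvalues,
  the cone over the secant locus is all of \<open>U \<otimes> W\<close>. The ideal of the scheme structure is then
  exactly the set of polynomials whose restriction to \<open>U \<otimes> W\<close> is divisible by the determinant: a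
  polynomial vanishing on the quadric is divisible by it (\<open>quadric_dvd_if_vanishes\<close>), and
  coordinates on \<open>U\<close> and \<open>W\<close> extended to the whole space lift the determinant into the ideal of
  \<open>X\<close> (\<open>saturation_secant_scheme_ideal\<close>).

  All dimensions follow from \<open>proj_dim_eqI\<close>. A strict chain of \<open>n + 1\<close> irreducible sets makes the
  Hilbert function grow at least like a polynomial of degree \<open>n\<close>, by multiplication with forms
  separating consecutive members. A dense multilinear parametrization by \<open>D\<close> parameters
  bounds it by \<open>(d + 1)\<^sup>D\<close>. So \<open>D\<close> bounds the lengths of chains, and the dimension is \<open>D\<close> as soon
  as one chain of length \<open>D\<close> is exhibited. For \<open>X\<close>, its secant variety and the quadric there are
  explicit charts with \<open>a + b\<close>, \<open>2 (a + b) - 1\<close> and \<open>2\<close> parameters and explicit chains of sets of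
  matrices with prescribed supports; these sets are irreducible because any two of their
  points are joined by a polynomial curve (\<open>prime_on_if_curves\<close>).
\<close>

section \<open>Polynomials in finitely many variables\<close>

text \<open>Evaluation, restriction to a curve and pullback along a polynomial map are all
  substitutions, differing only in the map applied to the coefficients.\<close>

locale coeff_hom =
  fixes h :: "'k::comm_ring_1 \<Rightarrow> 'r::comm_ring_1"
  assumes h_zero: "h 0 = 0" and h_one: "h 1 = 1"
    and h_add: "h (a + b) = h a + h b" and h_mult: "h (a * b) = h a * h b"
begin

lemma msubst_zero: "msubst h \<sigma> 0 = 0"
  by (simp add: msubst_def)

lemma msubst_add: "msubst h \<sigma> (p + q) = msubst h \<sigma> p + msubst h \<sigma> q"
proof -
  define M where "M = Poly_Mapping.keys p \<union> Poly_Mapping.keys q"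
  have "finite M" "Poly_Mapping.keys (p + q) \<subseteq> M"
    unfolding M_def using Poly_Mapping.keys_add[of p q] by auto
  moreover have "Poly_Mapping.keys p \<subseteq> M" "Poly_Mapping.keys q \<subseteq> M"
    by (auto simp: M_def)
  ultimately show ?thesis
    by (simp add: msubst_superset[of M] h_zero h_add lookup_add distrib_right sum.distrib)
qed

lemma msubst_sum: "msubst h \<sigma> (sum f A) = (\<Sum>a\<in>A. msubst h \<sigma> (f a))"
  by (induction A rule: infinite_finite_induct) (auto simp: msubst_zero msubst_add)

lemma msubst_single:
  "msubst h \<sigma> (Poly_Mapping.single m c) = h c * (\<Prod>i\<in>UNIV. \<sigma> i ^ Poly_Mapping.lookup m i)"
  by (auto simp: msubst_def h_zero)

lemma msubst_mult: "msubst h \<sigma> (p * q) = msubst h \<sigma> p * msubst h \<sigma> q"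
proof -
  have "p * q =
    (\<Sum>m\<in>Poly_Mapping.keys p. Poly_Mapping.single m (Poly_Mapping.lookup p m)) *
    (\<Sum>n\<in>Poly_Mapping.keys q. Poly_Mapping.single n (Poly_Mapping.lookup q n))"
    by (simp flip: mpoly_sum_single)
  also have "msubst h \<sigma> \<dots> = msubst h \<sigma> p * msubst h \<sigma> q"
    by (simp add: sum_product mult_single msubst_sum msubst_single)
      (simp add: msubst_def sum_product lookup_add power_add prod.distrib h_mult algebra_simps)
  finally show ?thesis .
qed

lemma msubst_mconst: "msubst h \<sigma> (mconst c) = h c"
  by (simp add: mconst_def msubst_single)

lemma msubst_one: "msubst h \<sigma> 1 = 1"
  using msubst_mconst[of \<sigma> 1] by (simp add: mconst_def h_one)

lemma msubst_uminus: "msubst h \<sigma> (- p) = - msubst h \<sigma> p"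
  using msubst_add[of \<sigma> p "- p"] by (simp add: msubst_zero eq_neg_iff_add_eq_0 add.commute)

lemma msubst_diff: "msubst h \<sigma> (p - q) = msubst h \<sigma> p - msubst h \<sigma> q"
  using msubst_add[of \<sigma> p "- q"] by (simp add: msubst_uminus)

lemma msubst_power: "msubst h \<sigma> (p ^ n) = msubst h \<sigma> p ^ n"
  by (induction n) (simp_all add: msubst_one msubst_mult)

lemma msubst_prod: "msubst h \<sigma> (prod f A) = (\<Prod>a\<in>A. msubst h \<sigma> (f a))"
  by (induction A rule: infinite_finite_induct) (auto simp: msubst_one msubst_mult)

lemma msubst_mvar: "msubst h \<sigma> (mvar i) = \<sigma> i"
proof -
  have "(\<Prod>j\<in>UNIV. \<sigma> j ^ Poly_Mapping.lookup (Poly_Mapping.single i 1) j) =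
      (\<Prod>j\<in>UNIV. if i = j then \<sigma> j else 1)"
    by (intro prod.cong refl) (auto simp: lookup_single when_def)
  then show ?thesis
    by (simp add: mvar_def msubst_single h_one)
qed

lemmas msubst_simps = msubst_zero msubst_add msubst_sum msubst_mult msubst_mconst
  msubst_one msubst_uminus msubst_diff msubst_power msubst_prod msubst_mvar

end

interpretation id_hom: coeff_hom "\<lambda>c::'k::comm_ring_1. c"
  by unfold_locales auto

interpretation poly_hom: coeff_hom "\<lambda>c::'k::comm_ring_1. [:c:]"
  by unfold_locales (auto simp: one_pCons)

interpretation mconst_hom: coeff_hom "mconst :: 'k \<Rightarrow> ('k::comm_ring_1, 'i::finite) mpoly"
  by unfold_locales (auto simp: mconst_def single_add mult_single)

lemmas meval_simps =
  id_hom.msubst_simps[where \<sigma> = "\<lambda>i. v $ i" for v, folded meval_def]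

text \<open>Restriction of \<open>f\<close> to the curve with components \<open>\<gamma>\<close>.\<close>

abbreviation along :: "('i::finite \<Rightarrow> 'k::comm_ring_1 poly) \<Rightarrow> ('k, 'i) mpoly \<Rightarrow> 'k poly"
  where "along \<equiv> msubst (\<lambda>c. [:c:])"

abbreviation compose ::
    "('i::finite \<Rightarrow> ('k::comm_ring_1, 'p::finite) mpoly) \<Rightarrow> ('k, 'i) mpoly \<Rightarrow> ('k, 'p) mpoly"
  where "compose \<equiv> msubst mconst"

lemma poly_along: "poly (along \<gamma> f) s = meval f (\<chi> i. poly (\<gamma> i) s)"
  by (simp add: msubst_def meval_def poly_sum poly_prod)

lemma meval_compose: "meval (compose \<Phi> f) t = meval f (\<chi> i. meval (\<Phi> i) t)"
  by (subst (1) msubst_def, subst (2) meval_def) (simp add: msubst_def meval_simps)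

lemma meval_mpullback: "meval (mpullback A f) v = meval f (A *v v)"
  by (simp add: mpullback_def meval_compose meval_simps matrix_vector_mult_def)

lemma mpullback_simps:
  "mpullback A (p * q) = mpullback A p * mpullback A q"
  "mpullback A (p - q) = mpullback A p - mpullback A q"
  "mpullback A (p + q) = mpullback A p + mpullback A q"
  by (simp_all add: mpullback_def mconst_hom.msubst_simps)

subsection \<open>Forms\<close>

lemma forms_zero [simp]: "0 \<in> forms d"
  by (simp add: forms_def)

lemma forms_add: "p \<in> forms d \<Longrightarrow> q \<in> forms d \<Longrightarrow> p + q \<in> forms d"
  unfolding forms_def using Poly_Mapping.keys_add[of p q] by blast

lemma forms_sum: "(\<And>a. a \<in> A \<Longrightarrow> f a \<in> forms d) \<Longrightarrow> sum f A \<in> forms d"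
  by (induction A rule: infinite_finite_induct) (auto simp: forms_add)

lemma forms_mconst: "mconst c \<in> forms 0"
  by (auto simp: forms_def mconst_def)

lemma forms_one: "1 \<in> forms 0"
  using forms_mconst[of 1] by (simp add: mconst_def)

lemma forms_scale: "p \<in> forms d \<Longrightarrow> mconst c * p \<in> forms d"
  using forms_mult[OF forms_mconst] by fastforce

lemma forms_uminus: "p \<in> forms d \<Longrightarrow> - p \<in> forms d"
  by (auto simp: forms_def)

lemma forms_diff: "p \<in> forms d \<Longrightarrow> q \<in> forms d \<Longrightarrow> p - q \<in> forms d"
  using forms_add[of p d "- q"] by (simp add: forms_uminus)

lemma forms_power: "p \<in> forms d \<Longrightarrow> p ^ n \<in> forms (d * n)"
  by (induction n) (auto simp: forms_one intro: forms_mult)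

lemma forms_mvar: "mvar i \<in> forms 1"
proof -
  have "(\<Sum>j\<in>UNIV. Poly_Mapping.lookup (Poly_Mapping.single i (1::nat)) j) =
      (\<Sum>j\<in>UNIV. if i = j then 1 else 0)"
    by (intro sum.cong refl) (auto simp: lookup_single when_def)
  then show ?thesis by (auto simp: forms_def mvar_def)
qed

definition linform :: "'k::comm_ring_1 ^ 'i::finite \<Rightarrow> ('k, 'i) mpoly"
  where "linform c = (\<Sum>i\<in>UNIV. mconst (c $ i) * mvar i)"

lemma forms_linform: "linform c \<in> forms 1"
  unfolding linform_def by (intro forms_sum forms_scale forms_mvar)

lemma meval_linform: "meval (linform c) v = (\<Sum>i\<in>UNIV. c $ i * v $ i)"
  by (simp add: linform_def meval_simps)

lemma meval_scale:
  assumes "f \<in> forms d"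
  shows "meval f (c *s v) = c ^ d * meval f v"
proof -
  have "meval f (c *s v) = (\<Sum>m\<in>Poly_Mapping.keys f. c ^ d *
      (Poly_Mapping.lookup f m * (\<Prod>i\<in>UNIV. v $ i ^ Poly_Mapping.lookup m i)))"
    unfolding meval_def msubst_def
  proof (intro sum.cong refl)
    fix m assume "m \<in> Poly_Mapping.keys f"
    then have "(\<Sum>i\<in>UNIV. Poly_Mapping.lookup m i) = d"
      using assms by (auto simp: forms_def)
    then have "(\<Prod>i\<in>UNIV. c ^ Poly_Mapping.lookup m i) = c ^ d"
      by (metis power_sum)
    then show "Poly_Mapping.lookup f m * (\<Prod>i\<in>UNIV. (c *s v) $ i ^ Poly_Mapping.lookup m i) =
        c ^ d * (Poly_Mapping.lookup f m * (\<Prod>i\<in>UNIV. v $ i ^ Poly_Mapping.lookup m i))"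
      by (simp add: power_mult_distrib prod.distrib algebra_simps)
  qed
  then show ?thesis by (simp add: meval_def msubst_def sum_distrib_left)
qed

lemma meval_forms_0:
  assumes "f \<in> forms 0"
  shows "meval f v = meval f w"
  using meval_scale[OF assms, of 0 v] meval_scale[OF assms, of 0 w] by simp

lemma linear_form_add:
  fixes f :: "('k::comm_ring_1, 'i::finite) mpoly"
  assumes "f \<in> forms 1"
  shows "meval f (v + w) = meval f v + meval f w"
proof -
  have "(\<Prod>i\<in>UNIV. (v + w) $ i ^ Poly_Mapping.lookup m i) =
      (\<Prod>i\<in>UNIV. v $ i ^ Poly_Mapping.lookup m i) + (\<Prod>i\<in>UNIV. w $ i ^ Poly_Mapping.lookup m i)"
    if "m \<in> Poly_Mapping.keys f" for m
  proof -
    have "(\<Sum>i\<in>UNIV. Poly_Mapping.lookup m i) = 1" using that assms by (auto simp: forms_def)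
    then obtain i where i: "Poly_Mapping.lookup m i = 1" "\<And>j. j \<noteq> i \<Longrightarrow> Poly_Mapping.lookup m j = 0"
      using sum_eq_Suc0_iff[of UNIV "Poly_Mapping.lookup m"] by fastforce
    have monomial: "(\<Prod>j\<in>UNIV. z $ j ^ Poly_Mapping.lookup m j) = z $ i" for z :: "'k ^ 'i"
      by (subst prod.remove[of UNIV i]) (auto simp: i)
    show ?thesis unfolding monomial by simp
  qed
  then show ?thesis by (simp add: meval_def msubst_def distrib_left sum.distrib)
qed

subsection \<open>Polynomial functions over an infinite field\<close>

lemma poly_eq_0_of_cofinite:
  fixes p :: "'k::field_char_0 poly"
  assumes "finite F" "\<And>s. s \<notin> F \<Longrightarrow> poly p s = 0"
  shows "p = 0"
proof (rule ccontr)
  assume "p \<noteq> 0"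
  then have "finite ({s. poly p s = 0} \<union> F)" using assms(1) by (simp add: poly_roots_finite)
  moreover have "{s. poly p s = 0} \<union> F = UNIV" using assms(2) by auto
  ultimately show False using infinite_UNIV_char_0[where 'a='k] by simp
qed

text \<open>By induction on the set of variables: for fixed values of the others, a relation is a
  univariate polynomial in the new variable, so that its coefficients vanish.\<close>

lemma monomial_functions_independent:
  fixes c :: "('i \<Rightarrow> nat) \<Rightarrow> 'k::field_char_0"
  assumes "finite J" "finite M" "\<And>m i. m \<in> M \<Longrightarrow> i \<notin> J \<Longrightarrow> m i = 0"
    and "\<And>x. (\<Sum>m\<in>M. c m * (\<Prod>i\<in>J. x i ^ m i)) = 0"
    and "m \<in> M"
  shows "c m = 0"
  using assms
proof (induction J arbitrary: M c m rule: finite_induct)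
  case empty
  have "l = m" if "l \<in> M" for l
    using empty.prems(2)[OF that] empty.prems(2)[OF empty.prems(4)] by (simp add: fun_eq_iff)
  then have "M = {m}" using empty.prems(4) by blast
  then show ?case using empty.prems(3)[of "\<lambda>_. 0"] by simp
next
  case (insert j J)
  define k where "k = m j"
  define M' where "M' = {l \<in> M. l j = k}"
  let ?r = "\<lambda>l. l(j := 0)"
  have inj: "inj_on ?r M'" by (auto simp: inj_on_def M'_def fun_eq_iff) (metis)
  have "(\<Sum>l\<in>?r ` M'. c (l(j := k)) * (\<Prod>i\<in>J. x i ^ l i)) = 0" for x
  proof -
    define P where "P = (\<Sum>l\<in>M. monom (c l * (\<Prod>i\<in>J. x i ^ l i)) (l j))"
    have "poly P s = 0" for s
    proof -
      have "(\<Prod>i\<in>J. (x(j := s)) i ^ l i) = (\<Prod>i\<in>J. x i ^ l i)" for l :: "'i \<Rightarrow> nat"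
        using insert.hyps by (intro prod.cong) auto
      then show ?thesis
        using insert.prems(3)[of "x(j := s)"] insert.hyps
        by (simp add: P_def poly_sum poly_monom algebra_simps)
    qed
    then have "P = 0" by (intro poly_eq_0_of_cofinite[of "{}"]) auto
    then have "0 = coeff P k" by simp
    also have "\<dots> = (\<Sum>l\<in>M. if l j = k then c l * (\<Prod>i\<in>J. x i ^ l i) else 0)"
      by (simp add: P_def coeff_sum)
    also have "\<dots> = (\<Sum>l\<in>M'. c l * (\<Prod>i\<in>J. x i ^ l i))"
      using insert.prems(1) by (simp add: M'_def sum.inter_filter)
    also have "\<dots> = (\<Sum>l\<in>M'. c ((?r l)(j := k)) * (\<Prod>i\<in>J. x i ^ (?r l) i))"
    proof (intro sum.cong refl)
      fix l assume "l \<in> M'"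
      then have "(?r l)(j := k) = l" by (auto simp: M'_def)
      moreover have "(\<Prod>i\<in>J. x i ^ (?r l) i) = (\<Prod>i\<in>J. x i ^ l i)"
        using insert.hyps by (intro prod.cong) auto
      ultimately show "c l * (\<Prod>i\<in>J. x i ^ l i) = c ((?r l)(j := k)) * (\<Prod>i\<in>J. x i ^ (?r l) i)"
        by simp
    qed
    finally show ?thesis using sum.reindex[OF inj, of "\<lambda>l. c (l(j := k)) * (\<Prod>i\<in>J. x i ^ l i)"]
      by simp
  qed
  moreover have "m \<in> M'" using insert.prems by (simp add: M'_def k_def)
  moreover have "finite (?r ` M')" using insert.prems(1) by (simp add: M'_def)
  moreover have "l i = 0" if "l \<in> ?r ` M'" "i \<notin> J" for l i
    using that insert.prems(2) by (auto simp: M'_def)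
  ultimately have "c ((?r m)(j := k)) = 0"
    using insert.IH[of "?r ` M'" "\<lambda>l. c (l(j := k))" "?r m"] by blast
  then show ?case by (simp add: k_def)
qed

lemma mpoly_eq_0I:
  fixes f :: "('k::field_char_0, 'i::finite) mpoly"
  assumes "\<And>v. meval f v = 0"
  shows "f = 0"
proof -
  let ?L = "Poly_Mapping.lookup :: ('i \<Rightarrow>\<^sub>0 nat) \<Rightarrow> _"
  have inj: "inj_on ?L (Poly_Mapping.keys f)" by (simp add: inj_on_def poly_mapping_eqI)
  have *: "Poly_Mapping.lookup f (Abs_poly_mapping (?L m)) = Poly_Mapping.lookup f m" for m
    by simp
  have "Poly_Mapping.lookup f m = 0" if "m \<in> Poly_Mapping.keys f" for m
  proof -
    have "Poly_Mapping.lookup f (Abs_poly_mapping (?L m)) = 0"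
    proof (rule monomial_functions_independent[where J = UNIV and M = "?L ` Poly_Mapping.keys f"
          and c = "\<lambda>l. Poly_Mapping.lookup f (Abs_poly_mapping l)"])
      fix x :: "'i \<Rightarrow> 'k"
      show "(\<Sum>l\<in>?L ` Poly_Mapping.keys f. Poly_Mapping.lookup f (Abs_poly_mapping l) *
          (\<Prod>i\<in>UNIV. x i ^ l i)) = 0"
        using assms[of "\<chi> i. x i"] by (simp add: sum.reindex[OF inj] meval_def msubst_def)
    qed (use that in auto)
    then show ?thesis by simp
  qed
  then show ?thesis by (metis in_keys_iff poly_mapping_eqI lookup_zero)
qed

subsection \<open>The chain rule\<close>

lemma coeff_1_mult: "coeff (p * q) 1 = coeff p 0 * coeff q 1 + coeff p 1 * coeff q 0"
  by (simp add: coeff_mult)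

lemma coeff_1_power:
  "coeff (p ^ n) 1 = of_nat n * coeff p 0 ^ (n - 1) * coeff (p :: 'k::comm_ring_1 poly) 1"
proof (induction n)
  case (Suc n)
  then show ?case
    by (cases n) (auto simp: coeff_1_mult coeff_mult_0 coeff_0_power algebra_simps simp del: One_nat_def)
qed simp

lemma coeff_0_prod: "coeff (prod f A) 0 = (\<Prod>i\<in>A. coeff (f i) 0)"
  by (induction A rule: infinite_finite_induct) (auto simp: coeff_mult_0)

lemma coeff_1_prod:
  assumes "finite A"
  shows "coeff (prod f A) 1 = (\<Sum>i\<in>A. coeff (f i :: 'k::comm_ring_1 poly) 1 * (\<Prod>j\<in>A - {i}. coeff (f j) 0))"
  using assms
proof (induction A rule: finite_induct)
  case (insert a A)
  have "(\<Prod>j\<in>insert a A - {i}. coeff (f j) 0) = coeff (f a) 0 * (\<Prod>j\<in>A - {i}. coeff (f j) 0)"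
    if "i \<in> A" for i
  proof -
    have "insert a A - {i} = insert a (A - {i})" using that insert by auto
    then show ?thesis using insert by simp
  qed
  then have "(\<Sum>i\<in>A. coeff (f i) 1 * (\<Prod>j\<in>insert a A - {i}. coeff (f j) 0)) =
     coeff (f a) 0 * (\<Sum>i\<in>A. coeff (f i) 1 * (\<Prod>j\<in>A - {i}. coeff (f j) 0))"
    by (simp add: sum_distrib_left algebra_simps)
  moreover have "insert a A - {a} = A" using insert by auto
  ultimately show ?case
    using insert by (simp add: coeff_1_mult coeff_0_prod del: One_nat_def)
qed simp

text \<open>Only the first-order part of the curve enters. On monomials this is the product rule for the
  coefficient of degree one.\<close>

lemma chain_rule:
  fixes f :: "('k::comm_ring_1, 'i::finite) mpoly"
  shows "(\<Sum>i\<in>UNIV. meval (mpderiv i f) (\<chi> i. coeff (\<gamma> i) 0) * coeff (\<gamma> i) 1) =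
    coeff (along \<gamma> f) 1"
proof -
  let ?x = "\<lambda>i. coeff (\<gamma> i) 0" and ?y = "\<lambda>i. coeff (\<gamma> i) 1"
  let ?l = "Poly_Mapping.lookup :: ('i \<Rightarrow>\<^sub>0 nat) \<Rightarrow> _"
  have monomial: "(\<Prod>j\<in>UNIV. ?x j ^ ?l (m - Poly_Mapping.single i 1) j) =
      ?x i ^ (?l m i - 1) * (\<Prod>j\<in>UNIV - {i}. ?x j ^ ?l m j)" for m i
  proof -
    have "(\<Prod>j\<in>UNIV. ?x j ^ ?l (m - Poly_Mapping.single i 1) j) =
       ?x i ^ ?l (m - Poly_Mapping.single i 1) i *
       (\<Prod>j\<in>UNIV - {i}. ?x j ^ ?l (m - Poly_Mapping.single i 1) j)"
      by (subst prod.remove[of UNIV i]) auto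
    moreover have "(\<Prod>j\<in>UNIV - {i}. ?x j ^ ?l (m - Poly_Mapping.single i 1) j) =
       (\<Prod>j\<in>UNIV - {i}. ?x j ^ ?l m j)"
      by (intro prod.cong refl) (auto simp: lookup_minus lookup_single when_def)
    ultimately show ?thesis by (simp add: lookup_minus)
  qed
  have "(\<Sum>i\<in>UNIV. meval (mpderiv i f) (\<chi> i. ?x i) * ?y i) =
    (\<Sum>i\<in>UNIV. \<Sum>m\<in>Poly_Mapping.keys f. of_nat (?l m i) * Poly_Mapping.lookup f m *
      (?x i ^ (?l m i - 1) * (\<Prod>j\<in>UNIV - {i}. ?x j ^ ?l m j)) * ?y i)"
    by (simp add: mpderiv_def meval_simps(3) meval_single monomial sum_distrib_right del: One_nat_def)
  also have "\<dots> = (\<Sum>m\<in>Poly_Mapping.keys f. Poly_Mapping.lookup f m *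
      (\<Sum>i\<in>UNIV. of_nat (?l m i) * ?x i ^ (?l m i - 1) * ?y i * (\<Prod>j\<in>UNIV - {i}. ?x j ^ ?l m j)))"
    by (subst sum.swap) (simp add: sum_distrib_left algebra_simps)
  also have "\<dots> = coeff (along \<gamma> f) 1"
    by (simp add: msubst_def coeff_sum coeff_1_prod coeff_1_power coeff_0_power del: One_nat_def)
  finally show ?thesis .
qed

section \<open>Points, lines and irreducible sets\<close>

text \<open>Points are handled through nonzero representing vectors. As every representative is allowed
  in \<open>vanishing_ideal_iff\<close>, it also covers polynomials that are not homogeneous.\<close>

definition pt :: "'k::field ^ 'i::finite \<Rightarrow> ('k, 'i) proj"
  where "pt v = proj_of (vec.span {v})"

lemma line_of_pt: "v \<noteq> 0 \<Longrightarrow> line_of (pt v) = vec.span {v}"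
  unfolding pt_def by (rule proj_of_inverse) blast

lemma pt_cases:
  obtains v where "v \<noteq> 0" "P = pt v"
proof -
  obtain v where "v \<noteq> 0" "line_of P = vec.span {v}" using line_of[of P] by auto
  then have "P = pt v" by (metis line_of_inverse pt_def)
  with \<open>v \<noteq> 0\<close> show ?thesis by (rule that)
qed

lemma mem_line_of_pt: "v \<noteq> 0 \<Longrightarrow> w \<in> line_of (pt v) \<longleftrightarrow> (\<exists>c. w = c *s v)"
  by (auto simp: line_of_pt vec_span_singleton)

lemma pt_scale:
  assumes "c \<noteq> 0"
  shows "pt (c *s v) = pt v"
proof -
  have "vec.span {c *s v} = vec.span {v}"
  proof
    show "vec.span {c *s v} \<subseteq> vec.span {v}"
      by (intro vec.span_minimal) (auto intro: vec.span_scale vec.span_base)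
    have "v = inverse c *s (c *s v)" using assms by simp
    then have "v \<in> vec.span {c *s v}"
      by (metis vec.span_base vec.span_scale singletonI)
    then show "vec.span {v} \<subseteq> vec.span {c *s v}"
      by (intro vec.span_minimal) auto
  qed
  then show ?thesis by (simp add: pt_def)
qed

lemma pt_eq_iff:
  assumes "v \<noteq> 0" "w \<noteq> 0"
  shows "pt v = pt w \<longleftrightarrow> (\<exists>c. w = c *s v)"
proof
  assume "pt v = pt w"
  moreover have "w \<in> line_of (pt w)" using assms by (simp add: line_of_pt vec.span_base)
  ultimately show "\<exists>c. w = c *s v" using assms mem_line_of_pt by metis
next
  assume "\<exists>c. w = c *s v"
  then obtain c where "w = c *s v" by blast
  moreover from this have "c \<noteq> 0" using assms by auto
  ultimately show "pt v = pt w" by (simp add: pt_scale)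
qed

lemma vanishes_at_pt_scaled:
  "v \<noteq> 0 \<Longrightarrow> vanishes_at f (pt v) \<longleftrightarrow> (\<forall>c. c \<noteq> 0 \<longrightarrow> meval f (c *s v) = 0)"
  by (auto simp: vanishes_at_def mem_line_of_pt)

lemma vanishes_at_pt: "f \<in> forms d \<Longrightarrow> v \<noteq> 0 \<Longrightarrow> vanishes_at f (pt v) \<longleftrightarrow> meval f v = 0"
  by (rule vanishes_at_iff) (auto simp: line_of_pt vec.span_base)

lemma vanishing_ideal_iff:
  fixes Z :: "('k::field, 'i::finite) proj set"
  shows "f \<in> vanishing_ideal Z \<longleftrightarrow> (\<forall>v. v \<noteq> 0 \<longrightarrow> pt v \<in> Z \<longrightarrow> meval f v = 0)"
proof
  assume f: "f \<in> vanishing_ideal Z"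
  show "\<forall>v. v \<noteq> 0 \<longrightarrow> pt v \<in> Z \<longrightarrow> meval f v = 0"
  proof (intro allI impI)
    fix v :: "'k ^ 'i" assume "v \<noteq> 0" "pt v \<in> Z"
    then have "\<forall>c. c \<noteq> 0 \<longrightarrow> meval f (c *s v) = 0"
      using f vanishes_at_pt_scaled[of v f] by (simp add: vanishing_ideal_def)
    from this[rule_format, of 1] show "meval f v = 0" by simp
  qed
next
  assume f: "\<forall>v. v \<noteq> 0 \<longrightarrow> pt v \<in> Z \<longrightarrow> meval f v = 0"
  have "vanishes_at f P" if P: "P \<in> Z" for P
  proof (cases P rule: pt_cases)
    case (1 v)
    then show ?thesis using f P by (simp add: vanishes_at_pt_scaled pt_scale)
  qed
  then show "f \<in> vanishing_ideal Z" by (simp add: vanishing_ideal_def)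
qed

lemma vanishing_ideal_mono: "S \<subseteq> T \<Longrightarrow> vanishing_ideal T \<subseteq> vanishing_ideal S"
  by (auto simp: vanishing_ideal_def)

lemma vanishing_ideal_ideal:
  shows "0 \<in> vanishing_ideal Z"
    and "f \<in> vanishing_ideal Z \<Longrightarrow> g \<in> vanishing_ideal Z \<Longrightarrow> f + g \<in> vanishing_ideal Z"
    and "f \<in> vanishing_ideal Z \<Longrightarrow> f * h \<in> vanishing_ideal Z"
    and "f \<in> vanishing_ideal Z \<Longrightarrow> h * f \<in> vanishing_ideal Z"
  by (simp_all add: vanishing_ideal_iff meval_simps)

lemma mem_proj_line:
  assumes "p \<noteq> 0" "q \<noteq> 0" "r \<noteq> 0"
  shows "pt r \<in> proj_line (pt p) (pt q) \<longleftrightarrow> (\<exists>a b. r = a *s p + b *s q)"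
proof -
  have "vec.span (vec.span {p} \<union> vec.span {q}) = vec.span {p, q}"
    using vec.span_Un[of "{p}" "{q}"] by (simp add: vec.span_Un vec.span_span insert_commute)
  then have "pt r \<in> proj_line (pt p) (pt q) \<longleftrightarrow> vec.span {r} \<subseteq> vec.span {p, q}"
    using assms by (simp add: proj_line_def line_of_pt)
  also have "\<dots> \<longleftrightarrow> r \<in> vec.span {p, q}"
    using vec.span_base[of r "{r}"] vec.span_minimal[of "{r}" "vec.span {p, q}"] by auto
  also have "\<dots> \<longleftrightarrow> (\<exists>a b. r = a *s p + b *s q)"
  proof
    assume "r \<in> vec.span {p, q}"
    then obtain a b where "r - a *s p = b *s q"
      by (auto simp: vec.span_insert vec_span_singleton)
    then have "r = a *s p + b *s q" by (simp add: algebra_simps)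
    then show "\<exists>a b. r = a *s p + b *s q" by blast
  next
    assume "\<exists>a b. r = a *s p + b *s q"
    then show "r \<in> vec.span {p, q}"
      by (auto intro: vec.span_add[OF vec.span_scale vec.span_scale] vec.span_base)
  qed
  finally show ?thesis .
qed

lemma mem_closure_zariski:
  "P \<in> zariski closure_of S \<longleftrightarrow> (\<forall>d. \<forall>f\<in>forms d. f \<in> vanishing_ideal S \<longrightarrow> vanishes_at f P)"
proof -
  let ?T = "zero_locus ((\<Union>d. forms d) \<inter> vanishing_ideal S)"
  have "zariski closure_of S = ?T"
  proof (rule closure_of_unique)
    show "S \<subseteq> ?T" by (auto simp: zero_locus_def vanishing_ideal_def)
    show "closedin zariski ?T"
      unfolding closedin_zariski zariski_closed_def by blast
    fix T assume T: "S \<subseteq> T" "closedin zariski T"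
    then obtain F where F: "F \<subseteq> (\<Union>d. forms d)" "T = zero_locus F"
      by (auto simp: closedin_zariski zariski_closed_def)
    then have "F \<subseteq> (\<Union>d. forms d) \<inter> vanishing_ideal S"
      using T by (auto simp: zero_locus_def vanishing_ideal_def)
    then show "?T \<subseteq> T" using F by (auto simp: zero_locus_def)
  qed
  then show ?thesis by (auto simp: zero_locus_def)
qed

text \<open>The homogeneous vanishing ideal of a nonempty set is prime iff the set is irreducible;
  primality does not see the ambient topology, in particular not whether the set is closed.\<close>

definition prime_on :: "('k::field, 'i::finite) proj set \<Rightarrow> bool"
  where "prime_on S \<longleftrightarrow> S \<noteq> {} \<and>
    (\<forall>d e. \<forall>f\<in>forms d. \<forall>g\<in>forms e. f * g \<in> vanishing_ideal S \<longrightarrow>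
      f \<in> vanishing_ideal S \<or> g \<in> vanishing_ideal S)"

lemma closedin_subtopology_zariski:
  "closedin (subtopology zariski Z) A \<longleftrightarrow> (\<exists>F. F \<subseteq> (\<Union>d. forms d) \<and> A = Z \<inter> zero_locus F)"
  by (auto simp: closedin_subtopology closedin_zariski zariski_closed_def)

lemma subset_zero_locus: "S \<subseteq> zero_locus F \<longleftrightarrow> F \<subseteq> vanishing_ideal S"
  by (auto simp: zero_locus_def vanishing_ideal_def)

lemma irreducible_in_zariski_iff:
  fixes Z :: "('k::field, 'i::finite) proj set"
  shows "irreducible_in (subtopology zariski Z) S \<longleftrightarrow> S \<subseteq> Z \<and> prime_on S"
proof
  assume S: "irreducible_in (subtopology zariski Z) S"
  then have SZ: "S \<subseteq> Z" "S \<noteq> {}" by (auto simp: irreducible_in_def topspace_zariski)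
  have "f \<in> vanishing_ideal S \<or> g \<in> vanishing_ideal S"
    if fg: "f \<in> forms d" "g \<in> forms e" "f * g \<in> vanishing_ideal S" for f g d e
  proof -
    have "S \<subseteq> zero_locus {f} \<union> zero_locus {g}"
      using fg by (auto simp: zero_locus_def vanishing_ideal_def vanishes_at_mult)
    then have "S \<subseteq> (Z \<inter> zero_locus {f}) \<union> (Z \<inter> zero_locus {g})" using SZ by blast
    moreover have "closedin (subtopology zariski Z) (Z \<inter> zero_locus {h})"
      if "h \<in> forms d" for h :: "('k, 'i) mpoly" and d
      unfolding closedin_subtopology_zariski using that by (intro exI[of _ "{h}"]) auto
    ultimately have "S \<subseteq> Z \<inter> zero_locus {f} \<or> S \<subseteq> Z \<inter> zero_locus {g}"
      using S[unfolded irreducible_in_def, THEN conjunct2, THEN conjunct2, rule_format,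
          of "Z \<inter> zero_locus {f}" "Z \<inter> zero_locus {g}"] fg(1,2)
      by simp
    then show ?thesis by (auto simp: subset_zero_locus)
  qed
  with SZ show "S \<subseteq> Z \<and> prime_on S" by (auto simp: prime_on_def)
next
  assume S: "S \<subseteq> Z \<and> prime_on S"
  show "irreducible_in (subtopology zariski Z) S"
    unfolding irreducible_in_def
  proof (intro conjI allI impI)
    show "S \<noteq> {}" "S \<subseteq> topspace (subtopology zariski Z)"
      using S by (auto simp: prime_on_def topspace_zariski)
    fix A B
    assume "closedin (subtopology zariski Z) A \<and> closedin (subtopology zariski Z) B \<and> S \<subseteq> A \<union> B"
    then obtain F G where F: "F \<subseteq> (\<Union>d. forms d)" "A = Z \<inter> zero_locus F"
      and G: "G \<subseteq> (\<Union>d. forms d)" "B = Z \<inter> zero_locus G" and AB: "S \<subseteq> A \<union> B"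
      unfolding closedin_subtopology_zariski by blast
    show "S \<subseteq> A \<or> S \<subseteq> B"
    proof (rule ccontr)
      assume "\<not> (S \<subseteq> A \<or> S \<subseteq> B)"
      then have "\<not> F \<subseteq> vanishing_ideal S" "\<not> G \<subseteq> vanishing_ideal S"
        using F(2) G(2) S by (simp_all flip: subset_zero_locus)
      then obtain f g where fg: "f \<in> F" "f \<notin> vanishing_ideal S" "g \<in> G" "g \<notin> vanishing_ideal S"
        by blast
      obtain d e where de: "f \<in> forms d" "g \<in> forms e" using fg F(1) G(1) by blast
      have "f * g \<in> vanishing_ideal S"
        unfolding vanishing_ideal_def
      proof clarify
        fix P assume "P \<in> S"
        then have "vanishes_at f P \<or> vanishes_at g P"
          using AB F G fg by (auto simp: zero_locus_def)
        then show "vanishes_at (f * g) P" using vanishes_at_mult de by blast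
      qed
      then show False
        using S[THEN conjunct2, unfolded prime_on_def, THEN conjunct2, rule_format, OF de] fg by simp
    qed
  qed
qed

lemma prime_onD:
  "prime_on S \<Longrightarrow> f \<in> forms d \<Longrightarrow> g \<in> forms e \<Longrightarrow> f * g \<in> vanishing_ideal S \<Longrightarrow>
    f \<in> vanishing_ideal S \<or> g \<in> vanishing_ideal S"
  by (auto simp: prime_on_def)

text \<open>If two polynomials do not vanish identically on \<open>S\<close>, join a point where the first is
  nonzero to one where the second is by a polynomial curve in \<open>S\<close>. Along the curve both become
  nonzero univariate polynomials, which have a common nonzero value as the field is infinite.
  The factor \<open>\<gamma> i\<close> keeps the curve off the origin, which is not a point.\<close>

lemma prime_on_if_curves:
  fixes S :: "('k::field_char_0, 'i::finite) proj set"
  assumes "S \<noteq> {}"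
    and curve: "\<And>v w. v \<noteq> 0 \<Longrightarrow> pt v \<in> S \<Longrightarrow> w \<noteq> 0 \<Longrightarrow> pt w \<in> S \<Longrightarrow>
      \<exists>\<gamma> :: 'i \<Rightarrow> 'k poly. (\<forall>i. poly (\<gamma> i) 0 = v $ i \<and> poly (\<gamma> i) 1 = w $ i) \<and>
        (\<forall>s. (\<chi> i. poly (\<gamma> i) s) \<noteq> 0 \<longrightarrow> pt (\<chi> i. poly (\<gamma> i) s) \<in> S)"
  shows "prime_on S"
proof -
  have "f \<in> vanishing_ideal S \<or> g \<in> vanishing_ideal S"
    if fg: "f * g \<in> vanishing_ideal S" for f g
  proof (rule ccontr)
    assume "\<not> (f \<in> vanishing_ideal S \<or> g \<in> vanishing_ideal S)"
    then obtain v w where v: "v \<noteq> 0" "pt v \<in> S" "meval f v \<noteq> 0"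
      and w: "w \<noteq> 0" "pt w \<in> S" "meval g w \<noteq> 0"
      by (auto simp: vanishing_ideal_iff)
    obtain \<gamma> :: "'i \<Rightarrow> 'k poly" where \<gamma>: "\<And>i. poly (\<gamma> i) 0 = v $ i" "\<And>i. poly (\<gamma> i) 1 = w $ i"
        "\<And>s. (\<chi> i. poly (\<gamma> i) s) \<noteq> 0 \<Longrightarrow> pt (\<chi> i. poly (\<gamma> i) s) \<in> S"
      using curve[OF v(1,2) w(1,2)] by blast
    obtain i where i: "v $ i \<noteq> 0" using v(1) by (auto simp: vec_eq_iff)
    have "(\<chi> i. poly (\<gamma> i) 0) = v" "(\<chi> i. poly (\<gamma> i) 1) = w"
      by (simp_all add: vec_eq_iff \<gamma>)
    then have "poly (along \<gamma> f) 0 \<noteq> 0" "poly (along \<gamma> g) 1 \<noteq> 0"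
      using v w by (simp_all add: poly_along)
    moreover have "poly (\<gamma> i) 0 \<noteq> 0" using i \<gamma> by simp
    ultimately have "along \<gamma> f * along \<gamma> g * \<gamma> i \<noteq> 0" by auto
    then obtain s where "poly (along \<gamma> f * along \<gamma> g * \<gamma> i) s \<noteq> 0"
      using poly_eq_0_of_cofinite[of "{}" "along \<gamma> f * along \<gamma> g * \<gamma> i"] by auto
    then have s: "meval (f * g) (\<chi> i. poly (\<gamma> i) s) \<noteq> 0" "poly (\<gamma> i) s \<noteq> 0"
      by (simp_all add: poly_along meval_simps)
    then have "(\<chi> i. poly (\<gamma> i) s) \<noteq> 0" by (auto simp: vec_eq_iff)
    then show False using fg s \<gamma>(3) by (auto simp: vanishing_ideal_iff)
  qed
  then show ?thesis using assms(1) by (auto simp: prime_on_def)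
qed

section \<open>Dimension by counting forms\<close>

lemma ex_form_separating_closed_sets:
  assumes "closedin (subtopology zariski Z) A" "B \<subseteq> Z" "\<not> B \<subseteq> A"
  obtains d f where "f \<in> forms d" "f \<in> vanishing_ideal A" "f \<notin> vanishing_ideal B"
proof -
  obtain F where F: "F \<subseteq> (\<Union>d. forms d)" "A = Z \<inter> zero_locus F"
    using assms(1) unfolding closedin_subtopology_zariski by (elim exE conjE)
  then have "\<not> B \<subseteq> zero_locus F" using assms(2,3) by blast
  then have "\<not> F \<subseteq> vanishing_ideal B" by (simp add: subset_zero_locus)
  then obtain f where f: "f \<in> F" "f \<notin> vanishing_ideal B" by blast
  moreover have "f \<in> vanishing_ideal A"
    using F f by (auto simp: zero_locus_def vanishing_ideal_def)
  moreover obtain d where "f \<in> forms d" using F f by blast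
  ultimately show ?thesis using that by blast
qed

text \<open>A lower bound \<open>N\<close> for the value of the Hilbert function of \<open>S\<close> at \<open>d\<close>, stated by explicit
  forms because only linear independence on \<open>S\<close> is transported along a chain.\<close>

definition hilbert_ge :: "('k::field, 'i::finite) proj set \<Rightarrow> nat \<Rightarrow> nat \<Rightarrow> bool"
  where "hilbert_ge S d N \<longleftrightarrow> (\<exists>F. (\<forall>j<N. F j \<in> forms d) \<and>
    (\<forall>c. (\<Sum>j<N. mconst (c j) * F j) \<in> vanishing_ideal S \<longrightarrow> (\<forall>j<N. c j = 0)))"

lemma hilbert_ge_mono: "hilbert_ge S d N \<Longrightarrow> S \<subseteq> T \<Longrightarrow> hilbert_ge T d N"
  unfolding hilbert_ge_def using vanishing_ideal_mono[of S T] by blast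

lemma nonempty_pt:
  assumes "S \<noteq> {}"
  obtains v where "v \<noteq> 0" "pt v \<in> S"
proof -
  obtain P where "P \<in> S" using assms by blast
  then show ?thesis using that by (cases P rule: pt_cases) blast
qed

lemma hilbert_ge_1:
  assumes "S \<noteq> {}"
  shows "hilbert_ge S d 1"
proof -
  obtain v where v: "v \<noteq> 0" "pt v \<in> S" using nonempty_pt[OF assms] .
  then obtain i where i: "v $ i \<noteq> 0" by (auto simp: vec_eq_iff)
  show ?thesis
    unfolding hilbert_ge_def
  proof (intro exI[of _ "\<lambda>_. mvar i ^ d"] conjI allI impI)
    show "mvar i ^ d \<in> forms d" using forms_power[OF forms_mvar, of i d] by simp
    fix c :: "nat \<Rightarrow> 'a" and j
    assume "(\<Sum>j<1. mconst (c j) * mvar i ^ d) \<in> vanishing_ideal S" and j: "j < (1::nat)"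
    then have "c 0 * (v $ i) ^ d = 0" using v by (auto simp: vanishing_ideal_iff meval_simps)
    then show "c j = 0" using i j by simp
  qed
qed

lemma sum_lessThan_add: "(\<Sum>k<N + M. g k) = (\<Sum>k<N. g k) + (\<Sum>k<(M::nat). g (N + k) :: 'a::comm_monoid_add)"
  by (induction M) (simp_all add: add.assoc)

text \<open>If \<open>f\<close> vanishes on \<open>S\<close> but not on the irreducible set \<open>T \<supseteq> S\<close>, then forms that are
  independent on \<open>S\<close> stay independent on \<open>T\<close> modulo the multiples of \<open>f\<close>, while multiplication
  by \<open>f\<close> is injective on the functions on \<open>T\<close>.\<close>

lemma hilbert_ge_step:
  assumes "prime_on T" "S \<subseteq> T" and f: "f \<in> forms e" "f \<in> vanishing_ideal S" "f \<notin> vanishing_ideal T"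
    and "hilbert_ge S (d + e) N" "hilbert_ge T d M"
  shows "hilbert_ge T (d + e) (N + M)"
proof -
  obtain F where F: "\<And>j. j < N \<Longrightarrow> F j \<in> forms (d + e)"
    "\<And>c. (\<Sum>j<N. mconst (c j) * F j) \<in> vanishing_ideal S \<Longrightarrow> (\<forall>j<N. c j = 0)"
    using assms(6) unfolding hilbert_ge_def by blast
  obtain G where G: "\<And>j. j < M \<Longrightarrow> G j \<in> forms d"
    "\<And>c. (\<Sum>j<M. mconst (c j) * G j) \<in> vanishing_ideal T \<Longrightarrow> (\<forall>j<M. c j = 0)"
    using assms(7) unfolding hilbert_ge_def by blast
  define H where "H k = (if k < N then F k else f * G (k - N))" for k
  have "H k \<in> forms (d + e)" if "k < N + M" for k
    using that F(1) forms_mult[OF f(1) G(1)] by (auto simp: H_def add.commute)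
  moreover have "\<forall>k<N + M. c k = 0"
    if c: "(\<Sum>k<N + M. mconst (c k) * H k) \<in> vanishing_ideal T" for c
  proof -
    define g where "g = (\<Sum>k<M. mconst (c (N + k)) * G k)"
    define g' where "g' = (\<Sum>k<N. mconst (c k) * F k)"
    have "(\<Sum>k<N + M. mconst (c k) * H k) = g' + f * g"
      by (simp add: sum_lessThan_add H_def g_def g'_def sum_distrib_left mult.left_commute)
    with c have cT: "g' + f * g \<in> vanishing_ideal T" by simp
    then have "g' + f * g \<in> vanishing_ideal S" using vanishing_ideal_mono[OF assms(2)] by blast
    with f(2) have "g' \<in> vanishing_ideal S" by (simp add: vanishing_ideal_iff meval_simps)
    then have cN: "\<forall>k<N. c k = 0" using F(2)[of c] by (simp add: g'_def)
    then have "g' = 0" by (simp add: g'_def mconst_def)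
    with cT have "f * g \<in> vanishing_ideal T" by simp
    moreover have "g \<in> forms d" unfolding g_def using G(1) by (intro forms_sum forms_scale) auto
    ultimately have "g \<in> vanishing_ideal T" using prime_onD[OF assms(1) f(1)] f(3) by blast
    then have "\<forall>k<M. c (N + k) = 0" unfolding g_def by (rule G(2))
    show ?thesis
    proof (intro allI impI)
      fix k assume "k < N + M"
      then show "c k = 0"
        using cN \<open>\<forall>k<M. c (N + k) = 0\<close>[rule_format, of "k - N"] by (cases "k < N") auto
    qed
  qed
  ultimately show ?thesis unfolding hilbert_ge_def by blast
qed

text \<open>With all separating forms of the same degree \<open>e\<close> the step is Pascal's rule, so that a
  chain of length \<open>n\<close> makes the Hilbert function grow like a polynomial of degree \<open>n\<close>.\<close>

lemma hilbert_ge_binomial: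
  assumes "\<And>i. i \<le> n \<Longrightarrow> prime_on (C i)" "\<And>i. i < n \<Longrightarrow> C i \<subseteq> C (Suc i)"
    and "\<And>i. i < n \<Longrightarrow> f i \<in> forms e \<inter> vanishing_ideal (C i) - vanishing_ideal (C (Suc i))"
  shows "hilbert_ge (C n) (e * D) ((D + n) choose n)"
  using assms
proof (induction n arbitrary: D)
  case 0
  then show ?case using hilbert_ge_1[of "C 0"] by (simp add: prime_on_def)
next
  case (Suc n)
  note IH = Suc.IH and prems = Suc.prems
  have prime: "prime_on (C (Suc n))" by (rule prems(1)) simp
  show ?case
  proof (induction D)
    case 0
    then show ?case using hilbert_ge_1[of "C (Suc n)"] prime by (simp add: prime_on_def)
  next
    case (Suc D)
    have "hilbert_ge (C n) (e * Suc D) ((Suc D + n) choose n)"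
      using prems by (intro IH[of "Suc D"]) auto
    then have "hilbert_ge (C n) (e * D + e) ((Suc D + n) choose n)" by (simp add: add.commute)
    moreover have "C n \<subseteq> C (Suc n)" using prems(2) by simp
    moreover have "f n \<in> forms e \<inter> vanishing_ideal (C n) - vanishing_ideal (C (Suc n))"
      by (rule prems(3)) simp
    ultimately have "hilbert_ge (C (Suc n)) (e * D + e) (((Suc D + n) choose n) + ((D + Suc n) choose Suc n))"
      using hilbert_ge_step[OF prime, of "C n" "f n" e] Suc.IH by simp
    then show ?case by (simp add: add.commute)
  qed
qed

subsection \<open>Counting monomials in a parametrization\<close>

text \<open>Bounding each exponent separately, rather than the total degree, makes it enough to count
  boxes of side \<open>d + 1\<close>. Boxes add when polynomials are multiplied, so a form of degree \<open>d\<close> in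
  multilinear polynomials involves only the monomials of \<open>box P d\<close>.\<close>

definition box :: "'p set \<Rightarrow> nat \<Rightarrow> ('p \<Rightarrow>\<^sub>0 nat) set"
  where "box P d = {m. \<forall>i. Poly_Mapping.lookup m i \<le> (if i \<in> P then d else 0)}"

lemma card_box:
  fixes P :: "'p::finite set"
  shows "finite (box P d)" "card (box P d) \<le> (d + 1) ^ card P"
proof -
  let ?g = "\<lambda>m :: 'p \<Rightarrow>\<^sub>0 nat. restrict (Poly_Mapping.lookup m) P"
  have inj: "inj_on ?g (box P d)"
  proof (rule inj_onI, rule poly_mapping_eqI)
    fix m n :: "'p \<Rightarrow>\<^sub>0 nat" and i
    assume mn: "m \<in> box P d" "n \<in> box P d" "?g m = ?g n"
    show "Poly_Mapping.lookup m i = Poly_Mapping.lookup n i"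
    proof (cases "i \<in> P")
      case True
      then show ?thesis using fun_cong[OF mn(3), of i] by simp
    next
      case False
      then have "Poly_Mapping.lookup m i \<le> 0" "Poly_Mapping.lookup n i \<le> 0"
        using mn(1,2)[unfolded box_def mem_Collect_eq, rule_format, of i] by auto
      then show ?thesis by simp
    qed
  qed
  have sub: "?g ` box P d \<subseteq> (\<Pi>\<^sub>E i\<in>P. {..d})"
  proof (clarify)
    fix m assume m: "m \<in> box P d"
    show "?g m \<in> (\<Pi>\<^sub>E i\<in>P. {..d})"
    proof (rule PiE_I)
      fix i assume "i \<in> P"
      then show "?g m i \<in> {..d}"
        using m[unfolded box_def mem_Collect_eq, rule_format, of i] by simp
    qed simp
  qed
  have fin: "finite (\<Pi>\<^sub>E i\<in>P. {..d})" by (intro finite_PiE) auto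
  have "card (\<Pi>\<^sub>E i\<in>P. {..d}) = (d + 1) ^ card P" by (simp add: card_PiE)
  then show "card (box P d) \<le> (d + 1) ^ card P" using card_inj_on_le[OF inj sub fin] by simp
  show "finite (box P d)" using finite_imageD[OF finite_subset[OF sub fin] inj] .
qed

lemma box_add: "m \<in> box P d \<Longrightarrow> n \<in> box P e \<Longrightarrow> m + n \<in> box P (d + e)"
  unfolding box_def
proof (intro CollectI allI, unfold mem_Collect_eq)
  fix i
  assume "\<forall>i. Poly_Mapping.lookup m i \<le> (if i \<in> P then d else 0)"
    "\<forall>i. Poly_Mapping.lookup n i \<le> (if i \<in> P then e else 0)"
  from this[THEN spec, of i]
  show "Poly_Mapping.lookup (m + n) i \<le> (if i \<in> P then d + e else 0)"
    by (auto simp: lookup_add split: if_splits)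
qed

lemma keys_mult_box:
  "Poly_Mapping.keys p \<subseteq> box P d \<Longrightarrow> Poly_Mapping.keys q \<subseteq> box P e \<Longrightarrow>
    Poly_Mapping.keys (p * q) \<subseteq> box P (d + e)"
  using Poly_Mapping.keys_mult[of p q] box_add by blast

lemma keys_mconst_box: "Poly_Mapping.keys (mconst c) \<subseteq> box P d"
  by (auto simp: mconst_def box_def)

lemma keys_one_box: "Poly_Mapping.keys (1 :: ('k::comm_ring_1, 'p) mpoly) \<subseteq> box P d"
  by (auto simp: box_def)

lemma keys_mvar_box: "i \<in> P \<Longrightarrow> Poly_Mapping.keys (mvar i) \<subseteq> box P 1"
  by (auto simp: mvar_def box_def lookup_single when_def)

lemma keys_add_box:
  "Poly_Mapping.keys p \<subseteq> box P d \<Longrightarrow> Poly_Mapping.keys q \<subseteq> box P d \<Longrightarrow>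
    Poly_Mapping.keys (p + q) \<subseteq> box P d"
  using Poly_Mapping.keys_add[of p q] by blast

lemma keys_sum_box:
  "(\<And>a. a \<in> A \<Longrightarrow> Poly_Mapping.keys (f a) \<subseteq> box P d) \<Longrightarrow> Poly_Mapping.keys (sum f A) \<subseteq> box P d"
  by (induction A rule: infinite_finite_induct) (simp_all add: keys_add_box)

lemma keys_power_box:
  fixes p :: "('k::comm_ring_1, 'p) mpoly"
  shows "Poly_Mapping.keys p \<subseteq> box P 1 \<Longrightarrow> Poly_Mapping.keys (p ^ n) \<subseteq> box P n"
proof (induction n)
  case (Suc n)
  then show ?case using keys_mult_box[of p P 1 "p ^ n" n] by simp
qed (use keys_one_box[of P 0] in simp)

lemma keys_prod_box:
  fixes f :: "'a \<Rightarrow> ('k::comm_ring_1, 'p) mpoly"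
  assumes "finite A" "\<And>a. a \<in> A \<Longrightarrow> Poly_Mapping.keys (f a) \<subseteq> box P (d a)"
  shows "Poly_Mapping.keys (prod f A) \<subseteq> box P (sum d A)"
  using assms
proof (induction A rule: finite_induct)
  case (insert a A)
  then show ?case using keys_mult_box[of "f a" P "d a" "prod f A" "sum d A"] by simp
qed (use keys_one_box[of P 0] in simp)

lemma keys_compose_box:
  assumes "f \<in> forms d" "\<And>i. Poly_Mapping.keys (\<Phi> i) \<subseteq> box P 1"
  shows "Poly_Mapping.keys (compose \<Phi> f) \<subseteq> box P d"
  unfolding msubst_def
proof (rule keys_sum_box)
  fix m assume "m \<in> Poly_Mapping.keys f"
  then have d: "(\<Sum>i\<in>UNIV. Poly_Mapping.lookup m i) = d" using assms(1) by (auto simp: forms_def)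
  have "Poly_Mapping.keys (\<Prod>i\<in>UNIV. \<Phi> i ^ Poly_Mapping.lookup m i) \<subseteq> box P d"
    unfolding d[symmetric] using assms(2) by (intro keys_prod_box keys_power_box) auto
  then show "Poly_Mapping.keys (mconst (Poly_Mapping.lookup f m) *
      (\<Prod>i\<in>UNIV. \<Phi> i ^ Poly_Mapping.lookup m i)) \<subseteq> box P d"
    using keys_mult_box[OF keys_mconst_box[of _ P 0], of _ d] by simp
qed

lemma mem_span_monomials:
  assumes "Poly_Mapping.keys p \<subseteq> M"
  shows "p \<in> mpoly.span ((\<lambda>m. Poly_Mapping.single m (1::'k::field)) ` M)"
proof -
  have "(\<Sum>m\<in>Poly_Mapping.keys p. mconst (Poly_Mapping.lookup p m) * Poly_Mapping.single m 1)
      \<in> mpoly.span ((\<lambda>m. Poly_Mapping.single m (1::'k)) ` M)"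
    using assms by (intro mpoly.span_sum mpoly.span_scale mpoly.span_base) auto
  moreover have "(\<Sum>m\<in>Poly_Mapping.keys p. mconst (Poly_Mapping.lookup p m) * Poly_Mapping.single m 1) = p"
    by (subst (3) mpoly_sum_single) (simp add: mconst_def mult_single)
  ultimately show ?thesis by simp
qed

text \<open>Functions on \<open>Z\<close> embed into polynomials in the parameters, and forms of degree \<open>d\<close> pull
  back to combinations of the monomials in \<open>box P d\<close>.\<close>

lemma hilbert_le_of_parametrization:
  fixes Z :: "('k::field, 'i::finite) proj set" and \<Phi> :: "'i \<Rightarrow> ('k, 'p::finite) mpoly"
  assumes \<Phi>: "\<And>i. Poly_Mapping.keys (\<Phi> i) \<subseteq> box P 1"
    and dense: "\<And>d f. f \<in> forms d \<Longrightarrow> (\<And>t. meval f (\<chi> i. meval (\<Phi> i) t) = 0) \<Longrightarrow> f \<in> vanishing_ideal Z"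
    and "hilbert_ge Z d N"
  shows "N \<le> (d + 1) ^ card P"
proof -
  obtain F where F: "\<And>j. j < N \<Longrightarrow> F j \<in> forms d"
    "\<And>c. (\<Sum>j<N. mconst (c j) * F j) \<in> vanishing_ideal Z \<Longrightarrow> (\<forall>j<N. c j = 0)"
    using assms(3) unfolding hilbert_ge_def by blast
  define G where "G j = compose \<Phi> (F j)" for j
  have rel: "\<forall>j<N. c j = 0" if "(\<Sum>j<N. mconst (c j) * G j) = 0" for c
  proof (rule F(2), rule dense)
    show "(\<Sum>j<N. mconst (c j) * F j) \<in> forms d" using F(1) by (intro forms_sum forms_scale) auto
    fix t
    have "compose \<Phi> (\<Sum>j<N. mconst (c j) * F j) = 0"
      using that by (simp add: mconst_hom.msubst_simps G_def)
    then show "meval (\<Sum>j<N. mconst (c j) * F j) (\<chi> i. meval (\<Phi> i) t) = 0"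
      using meval_compose[of \<Phi> "\<Sum>j<N. mconst (c j) * F j" t] by (simp add: meval_zero)
  qed
  have inj: "inj_on G {..<N}"
  proof (rule inj_onI, rule ccontr)
    fix j k assume jk: "j \<in> {..<N}" "k \<in> {..<N}" "G j = G k" "j \<noteq> k"
    define c where "c l = (if l = j then 1 else if l = k then - 1 else (0::'k))" for l
    have "mconst (c l) * G l = (if l = j then G j else 0) - (if l = k then G k else 0)" for l
    proof -
      have "mconst (- 1 :: 'k) * p = - p" "mconst 1 * p = p" "mconst 0 * p = 0" for p :: "('k, 'p) mpoly"
        using mpoly.scale_minus_left[of 1 p] mpoly.scale_one[of p] mpoly.scale_zero_left[of p]
        by simp_all
      then show ?thesis using jk(4) by (auto simp: c_def)
    qed
    then have "(\<Sum>l<N. mconst (c l) * G l) = 0"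
      using jk by (simp add: sum_subtractf)
    then have "c j = 0" using rel jk(1) by simp
    then show False by (simp add: c_def)
  qed
  have ind: "mpoly.independent (G ` {..<N})"
  proof
    assume "mpoly.dependent (G ` {..<N})"
    then obtain u where u: "\<exists>v\<in>G ` {..<N}. u v \<noteq> 0" "(\<Sum>v\<in>G ` {..<N}. mconst (u v) * v) = 0"
      unfolding mpoly.dependent_finite[OF finite_imageI[OF finite_lessThan]] by (elim exE conjE)
    then have "(\<Sum>j<N. mconst (u (G j)) * G j) = 0" by (simp add: sum.reindex[OF inj])
    then show False using rel[of "\<lambda>j. u (G j)"] u(1) by auto
  qed
  have sub: "G ` {..<N} \<subseteq> mpoly.span ((\<lambda>m. Poly_Mapping.single m (1::'k)) ` box P d)"
  proof
    fix g assume "g \<in> G ` {..<N}"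
    then obtain j where "j < N" "g = compose \<Phi> (F j)" by (auto simp: G_def)
    then show "g \<in> mpoly.span ((\<lambda>m. Poly_Mapping.single m (1::'k)) ` box P d)"
      using mem_span_monomials[OF keys_compose_box[OF F(1) \<Phi>]] by simp
  qed
  have "card (G ` {..<N}) \<le> card ((\<lambda>m. Poly_Mapping.single m (1::'k)) ` box P d)"
    using mpoly.independent_span_bound[OF finite_imageI[OF card_box(1)] ind sub] by simp
  also have "\<dots> \<le> card (box P d)" by (intro card_image_le card_box)
  also have "\<dots> \<le> (d + 1) ^ card P" by (rule card_box)
  finally show ?thesis by (simp add: card_image inj)
qed

text \<open>The left-hand side grows like \<open>k\<^sup>n\<close>, the right-hand side like \<open>k\<^sup>D\<close>. With
  \<open>(m / n)\<^sup>n \<le> m choose n\<close> at \<open>m = n (t + 1)\<close> this becomes a comparison of powers of \<open>t + 1\<close>.\<close>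

lemma growth_exponent_le:
  fixes n D e :: nat
  assumes "\<And>k. ((k + n) choose n) \<le> (e * k + 1) ^ D"
  shows "n \<le> D"
proof (rule ccontr)
  assume "\<not> n \<le> D"
  then have n: "D + 1 \<le> n" "n > 0" by auto
  define L where "L = e * n + 1"
  define t where "t = L ^ D"
  have "real (t + 1) ^ n = (real (n * (t + 1)) / real n) ^ n"
    using n by (simp only: of_nat_mult) simp
  also have "\<dots> \<le> real ((n * (t + 1)) choose n)"
    using binomial_ge_n_over_k_pow_k[of n "n * (t + 1)", where 'a = real] by simp
  also have "(n * (t + 1)) choose n \<le> (e * (n * t) + 1) ^ D"
    using assms[of "n * t"] by (simp add: algebra_simps)
  finally have "(t + 1) ^ n \<le> (e * (n * t) + 1) ^ D"
    by (metis of_nat_le_iff of_nat_power of_nat_mono order_trans)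
  also have "\<dots> \<le> (L * (t + 1)) ^ D" by (intro power_mono) (auto simp: L_def algebra_simps)
  finally have "(t + 1) ^ n \<le> t * (t + 1) ^ D" by (simp only: power_mult_distrib t_def)
  moreover have "(t + 1) ^ D * (t + 1) \<le> (t + 1) ^ n"
    using power_increasing[OF n(1), of "t + 1"] by (simp add: mult.commute)
  ultimately have "(t + 1) ^ D * (t + 1) \<le> (t + 1) ^ D * t"
    by (metis mult.commute order_trans)
  moreover have "(t + 1) ^ D > 0" by simp
  ultimately have "t + 1 \<le> t" using nat_mult_le_cancel1 by blast
  then show False by simp
qed

subsection \<open>Computation of the dimension\<close>

lemma mem_vanishing_ideal_power:
  "k > 0 \<Longrightarrow> f ^ k \<in> vanishing_ideal Z \<longleftrightarrow> f \<in> vanishing_ideal Z"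
  by (simp add: vanishing_ideal_iff meval_simps)

lemma chain_length_le:
  fixes Z :: "('k::field, 'i::finite) proj set" and \<Phi> :: "'i \<Rightarrow> ('k, 'p::finite) mpoly"
  assumes \<Phi>: "\<And>i. Poly_Mapping.keys (\<Phi> i) \<subseteq> box P 1"
    and dense: "\<And>d f. f \<in> forms d \<Longrightarrow> (\<And>t. meval f (\<chi> i. meval (\<Phi> i) t) = 0) \<Longrightarrow> f \<in> vanishing_ideal Z"
    and C: "\<And>i. i \<le> n \<Longrightarrow> closedin (subtopology zariski Z) (C i) \<and>
        irreducible_in (subtopology zariski Z) (C i)"
      "\<And>i. i < n \<Longrightarrow> C i \<subset> C (Suc i)"
  shows "n \<le> card P"
proof -
  have prime: "prime_on (C i)" and CZ: "C i \<subseteq> Z" if "i \<le> n" for i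
    using C(1)[OF that] by (simp_all add: irreducible_in_zariski_iff)
  have "\<exists>d f. f \<in> forms d \<inter> vanishing_ideal (C i) - vanishing_ideal (C (Suc i))" if "i < n" for i
    using ex_form_separating_closed_sets[of Z "C i" "C (Suc i)"] C(1)[of i] CZ[of "Suc i"] C(2)[OF that] that
    by (metis DiffI IntI less_imp_le_nat Suc_leI psubset_imp_subset psubsetE)
  then obtain d f where f: "\<And>i. i < n \<Longrightarrow>
      f i \<in> forms (d i) \<inter> vanishing_ideal (C i) - vanishing_ideal (C (Suc i))"
    by metis
  have d: "d i > 0" if "i < n" for i
  proof (rule ccontr)
    assume "\<not> d i > 0"
    then have "f i \<in> forms 0" using f[OF that] by simp
    moreover obtain v where "v \<noteq> 0" "pt v \<in> C i"
      using prime[of i] \<open>i < n\<close> nonempty_pt[of "C i"] less_imp_le[of i n] unfolding prime_on_def by metis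
    ultimately have "meval (f i) w = 0" for w
      using f[OF that] meval_forms_0[of "f i" v w] by (simp add: vanishing_ideal_iff)
    then show False using f[OF that] by (simp add: vanishing_ideal_iff)
  qed
  \<comment> \<open>Powers of the separating forms have a common degree.\<close>
  define e where "e = (\<Prod>i<n. d i)"
  have e: "e > 0" using d by (simp add: e_def)
  have "f i ^ (e div d i) \<in> forms e \<inter> vanishing_ideal (C i) - vanishing_ideal (C (Suc i))" if "i < n" for i
  proof -
    have "d i dvd e" unfolding e_def using that by (intro dvd_prodI) auto
    then have "d i * (e div d i) = e" "e div d i > 0" using e d[OF that] by (auto elim: dvdE)
    then show ?thesis
      using f[OF that] forms_power[of "f i" "d i" "e div d i"] by (simp add: mem_vanishing_ideal_power)
  qed
  then have "hilbert_ge (C n) (e * k) ((k + n) choose n)" for k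
    using prime C(2) by (intro hilbert_ge_binomial) auto
  then have "hilbert_ge Z (e * k) ((k + n) choose n)" for k
    using hilbert_ge_mono CZ by blast
  with \<Phi> dense have "((k + n) choose n) \<le> (e * k + 1) ^ card P" for k
    by (rule hilbert_le_of_parametrization[where \<Phi> = \<Phi> and Z = Z])
  then show ?thesis by (rule growth_exponent_le)
qed

lemma vanishing_ideal_closure:
  "f \<in> forms d \<Longrightarrow> f \<in> vanishing_ideal (zariski closure_of S) \<longleftrightarrow> f \<in> vanishing_ideal S"
proof
  assume "f \<in> vanishing_ideal (zariski closure_of S)"
  moreover have "S \<subseteq> zariski closure_of S"
    by (rule closure_of_subset) (simp add: topspace_zariski)
  ultimately show "f \<in> vanishing_ideal S" using vanishing_ideal_mono by blast
next
  assume "f \<in> forms d" "f \<in> vanishing_ideal S"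
  then show "f \<in> vanishing_ideal (zariski closure_of S)"
    by (auto simp: vanishing_ideal_def[of "zariski closure_of S"] mem_closure_zariski)
qed

text \<open>A dense parametrization by \<open>card P\<close> parameters bounds the dimension from above, a strict
  chain of \<open>card P + 1\<close> irreducible sets from below. The sets of the chain need not be closed:
  the forms that separate them also separate their closures.\<close>

theorem proj_dim_eqI:
  fixes Z :: "('k::field, 'i::finite) proj set" and \<Phi> :: "'i \<Rightarrow> ('k, 'p::finite) mpoly"
  assumes \<Phi>: "\<And>i. Poly_Mapping.keys (\<Phi> i) \<subseteq> box P 1"
    and dense: "\<And>d f. f \<in> forms d \<Longrightarrow> (\<And>t. meval f (\<chi> i. meval (\<Phi> i) t) = 0) \<Longrightarrow> f \<in> vanishing_ideal Z"
    and S: "\<And>i. i \<le> card P \<Longrightarrow> prime_on (S i)" "\<And>i. i < card P \<Longrightarrow> S i \<subseteq> S (Suc i)" "S (card P) \<subseteq> Z"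
    and sep: "\<And>i. i < card P \<Longrightarrow>
      \<exists>d. \<exists>f\<in>forms d. f \<in> vanishing_ideal (S i) \<and> f \<notin> vanishing_ideal (S (Suc i))"
  shows "proj_dim Z = int (card P)"
proof -
  define C where "C i = Z \<inter> zariski closure_of (S i)" for i
  have SZ: "S i \<subseteq> Z" if "i \<le> card P" for i
    using that by (induction rule: inc_induct) (use S in auto)
  have SC: "S i \<subseteq> C i" if "i \<le> card P" for i
    using SZ[OF that] closure_of_subset[of "S i" zariski] by (auto simp: C_def topspace_zariski)
  have ideal: "f \<in> vanishing_ideal (C i) \<longleftrightarrow> f \<in> vanishing_ideal (S i)"
    if "i \<le> card P" "f \<in> forms d" for i f d
    using vanishing_ideal_closure[OF that(2), of "S i"] vanishing_ideal_mono[OF SC[OF that(1)]]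
      vanishing_ideal_mono[of "C i" "zariski closure_of (S i)"] by (auto simp: C_def)
  have "prime_on (C i)" if "i \<le> card P" for i
    unfolding prime_on_def
  proof (intro conjI allI ballI impI)
    show "C i \<noteq> {}" using SC[OF that] S(1)[OF that] by (auto simp: prime_on_def)
    fix d e f g
    assume fg: "f \<in> forms d" "g \<in> forms e" "f * g \<in> vanishing_ideal (C i)"
    then have "f * g \<in> vanishing_ideal (S i)" using ideal[OF that forms_mult] by blast
    then show "f \<in> vanishing_ideal (C i) \<or> g \<in> vanishing_ideal (C i)"
      using prime_onD[OF S(1)[OF that] fg(1,2)] ideal[OF that fg(1)] ideal[OF that fg(2)] by blast
  qed
  then have "irreducible_in (subtopology zariski Z) (C i)" if "i \<le> card P" for i
    using that by (simp add: irreducible_in_zariski_iff C_def)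
  moreover have "closedin (subtopology zariski Z) (C i)" for i
    unfolding C_def closedin_subtopology by (metis Int_commute closedin_closure_of)
  moreover have "C i \<subset> C (Suc i)" if i: "i < card P" for i
  proof -
    obtain d f where f: "f \<in> forms d" "f \<in> vanishing_ideal (S i)" "f \<notin> vanishing_ideal (S (Suc i))"
      using sep[OF i] by blast
    have "C i \<noteq> C (Suc i)"
      using f ideal[of i f d] ideal[of "Suc i" f d] i by auto
    moreover have "C i \<subseteq> C (Suc i)"
      using closure_of_mono[OF S(2)[OF i], of zariski] by (auto simp: C_def)
    ultimately show ?thesis by blast
  qed
  moreover define chain where "chain n \<longleftrightarrow> (\<exists>C. (\<forall>i\<le>n. closedin (subtopology zariski Z) (C i) \<and>
      irreducible_in (subtopology zariski Z) (C i)) \<and> (\<forall>i<n. C i \<subset> C (Suc i)))" for n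
  ultimately have "chain (card P)" 
    unfolding chain_def by (intro exI[of _ C]) simp
  moreover have "n \<le> card P" if ch: "chain n" for n
  proof -
    obtain C where C: "\<And>i. i \<le> n \<Longrightarrow> closedin (subtopology zariski Z) (C i) \<and>
        irreducible_in (subtopology zariski Z) (C i)" "\<And>i. i < n \<Longrightarrow> C i \<subset> C (Suc i)"
      using ch unfolding chain_def by metis
    show ?thesis
      using \<Phi> dense C by (rule chain_length_le[where \<Phi> = \<Phi> and C = C and Z = Z])
  qed
  ultimately have "Sup (insert (- 1) {int n | n. chain n}) = int (card P)"
    by (intro cSup_eq_maximum) auto
  then show ?thesis
    unfolding proj_dim_def krull_dim_def chain_def .
qed

lemma proj_dim_empty: "proj_dim ({} :: ('a::field, 'b::finite) proj set) = - 1"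
proof -
  have "\<not> irreducible_in (subtopology zariski {}) S" for S :: "('a, 'b) proj set"
    by (auto simp: irreducible_in_def)
  then have "{int n | n. \<exists>C :: nat \<Rightarrow> ('a, 'b) proj set.
      (\<forall>i\<le>n. closedin (subtopology zariski {}) (C i) \<and> irreducible_in (subtopology zariski {}) (C i)) \<and>
      (\<forall>i<n. C i \<subset> C (Suc i))} = {}"
    by blast
  then show ?thesis by (simp only: proj_dim_def krull_dim_def) simp
qed

section \<open>The Segre variety, its secant variety and its tangent variety\<close>

definition tensor :: "'k::field ^ 'm::finite \<Rightarrow> 'k ^ 'n::finite \<Rightarrow> 'k ^ ('m \<times> 'n)"
  where "tensor u w = (\<chi> ij. u $ fst ij * w $ snd ij)"

lemma tensor_nth [simp]: "tensor u w $ ij = u $ fst ij * w $ snd ij"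
  by (simp add: tensor_def)

lemma matrix_eqI: "(\<And>i j. v $ (i, j) = w $ (i, j)) \<Longrightarrow> v = w"
  by (auto simp: vec_eq_iff)

lemma tensor_linear:
  "tensor (u + u') w = tensor u w + tensor u' w" "tensor u (w + w') = tensor u w + tensor u w'"
  "tensor (u - u') w = tensor u w - tensor u' w" "tensor u (w - w') = tensor u w - tensor u w'"
  "tensor (c *s u) w = c *s tensor u w" "tensor u (c *s w) = c *s tensor u w"
  "tensor 0 w = 0" "tensor u 0 = 0"
  by (simp_all add: vec_eq_iff algebra_simps)

lemma tensor_eq_0_iff: "tensor u w = 0 \<longleftrightarrow> u = 0 \<or> w = 0"
  by (auto simp: vec_eq_iff)

lemma pt_unique:
  assumes "v \<noteq> 0" "v \<in> line_of P"
  shows "P = pt v"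
proof (cases P rule: pt_cases)
  case (1 w)
  then obtain c where "v = c *s w" using assms mem_line_of_pt[of w v] by auto
  moreover from this have "c \<noteq> 0" using assms by auto
  ultimately show ?thesis using 1 by (simp add: pt_scale)
qed

lemma mem_segre_variety:
  assumes "v \<noteq> 0"
  shows "pt v \<in> segre_variety \<longleftrightarrow> (\<exists>u w. v = tensor u w)"
proof
  assume "pt v \<in> segre_variety"
  then obtain P Q where PQ: "pt v = segre_map P Q" by (auto simp: segre_variety_def)
  have "v \<in> line_of (pt v)" using assms by (simp add: line_of_pt vec.span_base)
  then show "\<exists>u w. v = tensor u w"
    unfolding PQ line_of_segre_map tensor_def by blast
next
  assume "\<exists>u w. v = tensor u w"
  then obtain u w where v: "v = tensor u w" by blast
  then have "u \<noteq> 0" "w \<noteq> 0" using assms by (auto simp: tensor_eq_0_iff)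
  then have "u \<in> line_of (pt u)" "w \<in> line_of (pt w)" by (simp_all add: line_of_pt vec.span_base)
  then have "v \<in> line_of (segre_map (pt u) (pt w))"
    unfolding line_of_segre_map v tensor_def by blast
  then have "segre_map (pt u) (pt w) = pt v" by (rule pt_unique[OF assms])
  then show "pt v \<in> segre_variety" unfolding segre_variety_def by (auto intro: sym)
qed

subsection \<open>Matrices of rank at most one and two\<close>

definition minor2 :: "'m \<Rightarrow> 'm \<Rightarrow> 'n \<Rightarrow> 'n \<Rightarrow> ('k::comm_ring_1, 'm \<times> 'n) mpoly"
  where "minor2 i k j l = mvar (i, j) * mvar (k, l) - mvar (i, l) * mvar (k, j)"

definition minor3 :: "'m \<Rightarrow> 'm \<Rightarrow> 'm \<Rightarrow> 'n \<Rightarrow> 'n \<Rightarrow> 'n \<Rightarrow> ('k::comm_ring_1, 'm \<times> 'n) mpoly"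
  where "minor3 p i k q j l =
    mvar (p, q) * minor2 i k j l - mvar (p, j) * minor2 i k q l + mvar (p, l) * minor2 i k q j"

lemma meval_minor2:
  "meval (minor2 i k j l) v = v $ (i, j) * v $ (k, l) - v $ (i, l) * v $ (k, j)"
  by (simp add: minor2_def meval_simps)

lemma meval_minor3:
  "meval (minor3 p i k q j l) v = v $ (p, q) * meval (minor2 i k j l) v
    - v $ (p, j) * meval (minor2 i k q l) v + v $ (p, l) * meval (minor2 i k q j) v"
  by (simp add: minor3_def meval_simps)

lemma forms_minor2: "minor2 i k j l \<in> forms 2"
  unfolding minor2_def one_add_one[symmetric] by (intro forms_diff forms_mult forms_mvar)

lemma forms_minor3: "minor3 p i k q j l \<in> forms 3"
proof -
  have "mvar x * minor2 i k j' l' \<in> forms 3" for x j' l'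
    using forms_mult[OF forms_mvar[of x] forms_minor2[of i k j' l']] by (simp add: eval_nat_numeral)
  then show ?thesis unfolding minor3_def by (intro forms_add forms_diff)
qed

lemma eq_tensor_iff:
  "(\<exists>u w. v = tensor u w) \<longleftrightarrow> (\<forall>i k j l. meval (minor2 i k j l) v = 0)"
proof
  assume minors: "\<forall>i k j l. meval (minor2 i k j l) v = 0"
  show "\<exists>u w. v = tensor u w"
  proof (cases "v = 0")
    case True
    then have "v = tensor 0 0" by (simp add: tensor_linear)
    then show ?thesis by blast
  next
    case False
    then obtain a where "v $ a \<noteq> 0" unfolding vec_eq_iff zero_index by blast
    then obtain i j where ij: "v $ (i, j) \<noteq> 0" by (cases a) auto
    have "v $ (p, q) = v $ (p, j) / v $ (i, j) * v $ (i, q)" for p q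
    proof -
      have "v $ (p, q) * v $ (i, j) = v $ (p, j) * v $ (i, q)"
        using minors[rule_format, of i p j q] by (simp add: meval_minor2 mult.commute)
      then show ?thesis
        unfolding times_divide_eq_left by (simp only: nonzero_eq_divide_eq[OF ij])
    qed
    from this[THEN trans] have "v = tensor (\<chi> p. v $ (p, j) / v $ (i, j)) (\<chi> q. v $ (i, q))"
      by (rule matrix_eqI) simp
    then show ?thesis by blast
  qed
qed (auto simp: meval_minor2 mult_ac)

definition rank_le_2 :: "'k::field ^ ('m::finite \<times> 'n::finite) \<Rightarrow> bool"
  where "rank_le_2 v \<longleftrightarrow> (\<exists>u w u' w'. v = tensor u w + tensor u' w')"

text \<open>Cramer's rule: if a \<open>2 \<times> 2\<close> minor is nonzero and the \<open>3 \<times> 3\<close> minors containing it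
  vanish, then every row is a combination of the two rows of the minor.\<close>

lemma rows_of_minor2:
  assumes "meval (minor2 i k j l) v \<noteq> 0" "\<And>p q. meval (minor3 p i k q j l) v = 0"
  shows "v = tensor (\<chi> p. (v $ (p, j) * v $ (k, l) - v $ (p, l) * v $ (k, j)) / meval (minor2 i k j l) v)
        (\<chi> q. v $ (i, q)) +
      tensor (\<chi> p. (v $ (p, l) * v $ (i, j) - v $ (p, j) * v $ (i, l)) / meval (minor2 i k j l) v)
        (\<chi> q. v $ (k, q))"
proof -
  have "v $ (p, q) * meval (minor2 i k j l) v =
      (v $ (p, j) * v $ (k, l) - v $ (p, l) * v $ (k, j)) * v $ (i, q) +
      (v $ (p, l) * v $ (i, j) - v $ (p, j) * v $ (i, l)) * v $ (k, q)" for p q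
    using assms(2)[of p q] by (simp add: meval_minor3 meval_minor2 algebra_simps)
  then have "v $ (p, q) =
      ((v $ (p, j) * v $ (k, l) - v $ (p, l) * v $ (k, j)) * v $ (i, q) +
      (v $ (p, l) * v $ (i, j) - v $ (p, j) * v $ (i, l)) * v $ (k, q)) / meval (minor2 i k j l) v" for p q
    by (simp only: eq_divide_eq assms(1)) simp
  from this[THEN trans] show ?thesis
    by (rule matrix_eqI) (simp add: add_divide_distrib)
qed

lemma rank_le_2_iff: "rank_le_2 v \<longleftrightarrow> (\<forall>p i k q j l. meval (minor3 p i k q j l) v = 0)"
proof
  assume "rank_le_2 v"
  then show "\<forall>p i k q j l. meval (minor3 p i k q j l) v = 0"
    unfolding rank_le_2_def by (clarsimp simp: meval_minor3 meval_minor2) (simp add: algebra_simps)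
next
  assume minors: "\<forall>p i k q j l. meval (minor3 p i k q j l) v = 0"
  show "rank_le_2 v"
  proof (cases "\<forall>i k j l. meval (minor2 i k j l) v = 0")
    case True
    then obtain u w where "v = tensor u w" using eq_tensor_iff[of v] by auto
    then have "v = tensor u w + tensor 0 w" by (simp add: tensor_linear)
    then show ?thesis unfolding rank_le_2_def by blast
  next
    case False
    then obtain i k j l where "meval (minor2 i k j l) v \<noteq> 0" by blast
    then show ?thesis
      unfolding rank_le_2_def using rows_of_minor2[OF _ minors[rule_format]] by metis
  qed
qed

lemma minor2_in_ideal: "minor2 i k j l \<in> vanishing_ideal segre_variety"
  unfolding vanishing_ideal_iff by (auto simp: mem_segre_variety eq_tensor_iff)

subsection \<open>The secant variety\<close>

lemma ex_vec_not_proportional: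
  assumes "CARD('n::finite) \<ge> 2"
  shows "\<exists>w' :: 'k::field ^ 'n. \<forall>c. w' \<noteq> c *s w \<and> w' \<noteq> 0"
proof -
  obtain i j :: 'n where ij: "i \<noteq> j"
    using assms by (metis card_2_iff' card_le_Suc0_iff_eq finite numeral_2_eq_2 not_less_eq_eq UNIV_I)
  have ne: "axis i (1::'k) \<noteq> 0" "axis j (1::'k) \<noteq> 0" by (simp_all add: axis_eq_0_iff)
  have "\<not> (axis i 1 = c *s w \<and> axis j 1 = d *s w)" for c d
  proof
    assume "axis i 1 = c *s w \<and> axis j 1 = d *s w"
    then have "c * w $ i = 1" "c * w $ j = 0" "d * w $ j = 1"
      using ij by (auto simp: vec_eq_iff axis_def split: if_splits)
    then show False by auto
  qed
  then show ?thesis using ne by (metis (full_types))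
qed

text \<open>The union of the secant lines is already closed, being cut out by the \<open>3 \<times> 3\<close> minors. A
  point of the Segre variety itself lies on a secant line because there is a second point.\<close>

lemma mem_secant_variety:
  fixes v :: "'k::field ^ ('m::finite \<times> 'n::finite)"
  assumes "CARD('n) \<ge> 2" "v \<noteq> 0"
  shows "pt v \<in> secant_variety segre_variety \<longleftrightarrow> rank_le_2 v"
proof -
  let ?X = "segre_variety :: ('k, 'm \<times> 'n) proj set"
  let ?U = "\<Union>{proj_line x y | x y. x \<in> ?X \<and> y \<in> ?X \<and> x \<noteq> y}"
  have U: "P \<in> ?U \<longleftrightarrow> (\<exists>x y. x \<in> ?X \<and> y \<in> ?X \<and> x \<noteq> y \<and> P \<in> proj_line x y)" for P
    by auto
  have line: "pt v \<in> ?U" if "v \<noteq> 0" "x \<noteq> 0" "y \<noteq> 0" "v = a *s x + b *s y" "pt x \<noteq> pt y"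
      "pt x \<in> ?X" "pt y \<in> ?X" for v x y a b
  proof -
    have "pt v \<in> proj_line (pt x) (pt y)"
      unfolding mem_proj_line[OF that(2,3,1)] using that(4) by blast
    then show ?thesis unfolding U using that(5-7) by (intro exI conjI)
  qed
  have segre: "pt v \<in> ?U" if v: "v \<noteq> 0" "v = tensor u w" for v u w
  proof -
    have "u \<noteq> 0" "w \<noteq> 0" using v by (auto simp: tensor_eq_0_iff)
    obtain w' where w': "\<And>c. w' \<noteq> c *s w" "w' \<noteq> 0"
      using ex_vec_not_proportional[OF assms(1), of w] by blast
    have y: "tensor u w' \<noteq> 0" using \<open>u \<noteq> 0\<close> w' by (simp add: tensor_eq_0_iff)
    have "pt v \<noteq> pt (tensor u w')"
    proof
      assume "pt v = pt (tensor u w')"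
      then obtain c where c: "tensor u w' = c *s v" using pt_eq_iff[OF v(1) y] by blast
      obtain i where "u $ i \<noteq> 0" using \<open>u \<noteq> 0\<close> by (auto simp: vec_eq_iff)
      moreover have "u $ i * w' $ j = u $ i * (c * w $ j)" for j
      proof -
        have "tensor u w' $ (i, j) = (c *s tensor u w) $ (i, j)" by (simp only: c v(2))
        then show ?thesis by (simp add: mult.left_commute)
      qed
      ultimately have "w' = c *s w" by (simp add: vec_eq_iff)
      then show False using w' by blast
    qed
    moreover have "pt v \<in> ?X" "pt (tensor u w') \<in> ?X"
      using v y by (auto simp: mem_segre_variety)
    ultimately show ?thesis
      by (intro line[OF v(1) v(1) y, of 1 0]) simp_all
  qed
  have rank2: "pt v \<in> ?U" if v: "v \<noteq> 0" "rank_le_2 v" for v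
  proof -
    obtain u w u' w' where uw: "v = tensor u w + tensor u' w'"
      using v(2) unfolding rank_le_2_def by blast
    show ?thesis
    proof (cases "tensor u w = 0 \<or> tensor u' w' = 0")
      case True
      then have "v = tensor u w \<or> v = tensor u' w'" using uw by auto
      then show ?thesis by (elim disjE) (erule segre[OF v(1)])+
    next
      case False
      then have ne: "tensor u w \<noteq> 0" "tensor u' w' \<noteq> 0" by auto
      show ?thesis
      proof (cases "pt (tensor u w) = pt (tensor u' w')")
        case True
        then obtain c where "tensor u' w' = c *s tensor u w" using pt_eq_iff[OF ne] by auto
        then have "v = tensor u w + c *s tensor u w" using uw by simp
        also have "\<dots> = tensor ((1 + c) *s u) w" by (simp add: vec_eq_iff algebra_simps)
        finally have "v = tensor ((1 + c) *s u) w" .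
        then show ?thesis by (rule segre[OF v(1)])
      next
        case False
        moreover have "pt (tensor u w) \<in> ?X" "pt (tensor u' w') \<in> ?X"
          using ne by (auto simp: mem_segre_variety)
        ultimately show ?thesis 
          by (intro line[OF v(1) ne, of 1 1]) (simp_all add: uw)
      qed
    qed
  qed
  have sub: "?U \<subseteq> secant_variety ?X"
    unfolding secant_variety_def by (rule closure_of_subset) (simp add: topspace_zariski)
  have "rank_le_2 v" if v: "v \<noteq> 0" "pt v \<in> secant_variety ?X" for v
  proof -
    have ideal: "minor3 p i k q j l \<in> vanishing_ideal ?U" for p i k q j l
      unfolding vanishing_ideal_iff
    proof (intro allI impI)
      fix r :: "'k ^ ('m \<times> 'n)" assume r: "r \<noteq> 0" "pt r \<in> ?U"
      then obtain P Q where PQ: "pt r \<in> proj_line P Q" "P \<in> ?X" "Q \<in> ?X"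
        unfolding U by (elim exE conjE)
      obtain x where x: "x \<noteq> 0" "P = pt x" by (rule pt_cases)
      obtain y where y: "y \<noteq> 0" "Q = pt y" by (rule pt_cases)
      obtain a b where "r = a *s x + b *s y"
        using PQ(1) mem_proj_line[OF x(1) y(1) r(1)] x(2) y(2) by auto
      moreover obtain u w where "x = tensor u w" using PQ(2) mem_segre_variety[OF x(1)] x(2) by auto
      moreover obtain u' w' where "y = tensor u' w'" using PQ(3) mem_segre_variety[OF y(1)] y(2) by auto
      ultimately have "r = tensor (a *s u) w + tensor (b *s u') w'" by (simp add: tensor_linear)
      then have "rank_le_2 r" unfolding rank_le_2_def by blast
      then show "meval (minor3 p i k q j l) r = 0" by (simp add: rank_le_2_iff)
    qed
    have "vanishes_at (minor3 p i k q j l) (pt v)" for p i k q j l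
      using v(2)[unfolded secant_variety_def mem_closure_zariski, rule_format, OF forms_minor3 ideal] .
    then show ?thesis
      using vanishes_at_pt[OF forms_minor3 v(1)] by (simp add: rank_le_2_iff)
  qed
  then show ?thesis using rank2[OF assms(2)] subsetD[OF sub] assms(2) by auto
qed

subsection \<open>Tangent spaces\<close>

text \<open>A polynomial in the vanishing ideal is only known to vanish at nonzero vectors, that is, at
  all but finitely many points of the curve.\<close>

lemma along_eq_0:
  fixes \<gamma> :: "'i::finite \<Rightarrow> 'k::field_char_0 poly"
  assumes "f \<in> vanishing_ideal S" "\<gamma> i \<noteq> 0"
    and "\<And>s. (\<chi> i. poly (\<gamma> i) s) \<noteq> 0 \<Longrightarrow> pt (\<chi> i. poly (\<gamma> i) s) \<in> S"
  shows "along \<gamma> f = 0"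
proof (rule poly_eq_0_of_cofinite)
  show "finite {s. poly (\<gamma> i) s = 0}" using assms(2) by (rule poly_roots_finite)
  fix s assume "s \<notin> {s. poly (\<gamma> i) s = 0}"
  then have "(\<chi> i. poly (\<gamma> i) s) \<noteq> 0" by (auto simp: vec_eq_iff)
  then show "poly (along \<gamma> f) s = 0"
    using assms(1,3) by (simp add: poly_along vanishing_ideal_iff)
qed

text \<open>The curve \<open>(u + s u') \<otimes> (w + s w')\<close> in the variety has the given velocity at \<open>s = 0\<close>.\<close>

lemma derivative_along_segre:
  fixes u u' :: "'k::field_char_0 ^ 'm::finite" and w w' :: "'k ^ 'n::finite"
  assumes "f \<in> vanishing_ideal segre_variety" "tensor u w \<noteq> 0"
  shows "(\<Sum>i\<in>UNIV. meval (mpderiv i f) (tensor u w) * (tensor u w' + tensor u' w) $ i) = 0"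
proof -
  define \<gamma> where "\<gamma> ij = [:u $ fst ij, u' $ fst ij:] * [:w $ snd ij, w' $ snd ij:]"
    for ij :: "'m \<times> 'n"
  have \<gamma>0: "(\<chi> i. coeff (\<gamma> i) 0) = tensor u w"
    by (simp add: \<gamma>_def vec_eq_iff coeff_mult_0)
  have \<gamma>1: "coeff (\<gamma> i) 1 = (tensor u w' + tensor u' w) $ i" for i
    by (simp add: \<gamma>_def coeff_1_mult del: One_nat_def mult_pCons_left mult_pCons_right) simp
  obtain i where "tensor u w $ i \<noteq> 0" using assms(2) unfolding vec_eq_iff zero_index by blast
  moreover have "coeff (\<gamma> i) 0 = (\<chi> i. coeff (\<gamma> i) 0) $ i" by simp
  ultimately have "coeff (\<gamma> i) 0 \<noteq> 0" using \<gamma>0 by metis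
  then have "\<gamma> i \<noteq> 0" by auto
  moreover have "(\<chi> i. poly (\<gamma> i) s) = tensor (u + s *s u') (w + s *s w')" for s
    by (simp add: \<gamma>_def vec_eq_iff algebra_simps)
  ultimately have "along \<gamma> f = 0"
    using assms(1) by (intro along_eq_0) (auto simp: mem_segre_variety intro!: exI)
  then show ?thesis using chain_rule[of f \<gamma>] by (simp only: \<gamma>0 \<gamma>1) simp
qed

text \<open>The polarizations of the \<open>2 \<times> 2\<close> minors at a point of the variety cut out its tangent
  space: where \<open>u\<close> and \<open>w\<close> are nonzero they determine \<open>v\<close> from one row and one column.\<close>

lemma tangent_if_polar_minors:
  fixes v :: "'k::field ^ ('m::finite \<times> 'n::finite)"
  assumes x: "tensor u w \<noteq> 0"
    and eq: "\<And>i k j l. tensor u w $ (i, j) * v $ (k, l) + v $ (i, j) * tensor u w $ (k, l) =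
      tensor u w $ (i, l) * v $ (k, j) + v $ (i, l) * tensor u w $ (k, j)"
  shows "\<exists>u' w'. v = tensor u w' + tensor u' w"
proof -
  obtain i j where ij: "u $ i \<noteq> 0" "w $ j \<noteq> 0"
    using x by (auto simp: tensor_eq_0_iff vec_eq_iff)
  have *: "v $ (k, l) = u $ k * ((v $ (i, l) - v $ (i, j) * w $ l / w $ j) / u $ i) +
      v $ (k, j) / w $ j * w $ l" for k l
    using ij eq[of i j k l] by (simp add: field_simps)
  have "v = tensor u (\<chi> l. (v $ (i, l) - v $ (i, j) * w $ l / w $ j) / u $ i) +
      tensor (\<chi> k. v $ (k, j) / w $ j) w"
    by (rule matrix_eqI, rule trans[OF *]) simp
  then show ?thesis by blast
qed

lemma mem_embedded_tangent_space:
  fixes v :: "'k::field_char_0 ^ ('m::finite \<times> 'n::finite)"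
  assumes x: "tensor u w \<noteq> 0" and v: "v \<noteq> 0"
  shows "pt v \<in> embedded_tangent_space segre_variety (pt (tensor u w)) \<longleftrightarrow>
    (\<exists>u' w'. v = tensor u w' + tensor u' w)"
proof
  assume tangent: "pt v \<in> embedded_tangent_space segre_variety (pt (tensor u w))"
  let ?x = "tensor u w"
  have mem: "?x \<in> line_of (pt ?x)" "v \<in> line_of (pt v)"
    using x v by (simp_all add: line_of_pt vec.span_base)
  have eq: "?x $ (i, j) * v $ (k, l) + v $ (i, j) * ?x $ (k, l) =
      ?x $ (i, l) * v $ (k, j) + v $ (i, l) * ?x $ (k, j)" for i j k l
  proof -
    define \<gamma> where "\<gamma> a = [:?x $ a, v $ a:]" for a
    let ?f = "minor2 i k j l :: ('k, 'm \<times> 'n) mpoly"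
    have "(\<Sum>a\<in>UNIV. meval (mpderiv a ?f) ?x * v $ a) = 0"
      using tangent mem x minor2_in_ideal[of i k j l] forms_minor2[of i k j l]
      unfolding embedded_tangent_space_def by blast
    moreover have "(\<chi> a. coeff (\<gamma> a) 0) = ?x" by (simp add: \<gamma>_def vec_eq_iff)
    moreover have "coeff (\<gamma> a) 1 = v $ a" for a by (simp add: \<gamma>_def)
    ultimately have "coeff (along \<gamma> ?f) 1 = 0"
      using chain_rule[of ?f \<gamma>] by (simp del: One_nat_def)
    then show ?thesis
      by (simp add: minor2_def poly_hom.msubst_simps \<gamma>_def algebra_simps)
  qed
  then show "\<exists>u' w'. v = tensor u w' + tensor u' w" by (rule tangent_if_polar_minors[OF x])
next
  assume "\<exists>u' w'. v = tensor u w' + tensor u' w"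
  then obtain u' w' where v': "v = tensor u w' + tensor u' w" by blast
  show "pt v \<in> embedded_tangent_space segre_variety (pt (tensor u w))"
    unfolding embedded_tangent_space_def
  proof (intro CollectI ballI impI)
    fix f :: "('k, 'm \<times> 'n) mpoly" and y z
    assume f: "f \<in> vanishing_ideal segre_variety" and y: "y \<in> line_of (pt (tensor u w))"
      and z: "z \<in> line_of (pt v)" and "f \<in> (\<Union>d. forms d) \<and> y \<noteq> 0"
    then have y0: "y \<noteq> 0" by blast
    obtain a where a: "y = tensor (a *s u) w"
      using y mem_line_of_pt[OF x] by (auto simp: tensor_linear)
    then have a0: "a \<noteq> 0" using y0 by (auto simp: tensor_linear)
    obtain b where b: "z = b *s v" using z mem_line_of_pt[OF v] by blast
    have z': "z = tensor (a *s u) ((b / a) *s w') + tensor (b *s u') w"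
      using a0 by (simp add: b v' tensor_linear vector_add_ldistrib)
    show "(\<Sum>i\<in>UNIV. meval (mpderiv i f) y * z $ i) = 0"
      unfolding a z' by (rule derivative_along_segre[OF f y0[unfolded a]])
  qed
qed

text \<open>A sum \<open>u \<otimes> w + u' \<otimes> w'\<close>, which lies on a secant line, is also a tangent vector, at the
  third point \<open>u \<otimes> w'\<close>. For this reason the two varieties coincide.\<close>

lemma mem_tangent_variety:
  fixes v :: "'k::field_char_0 ^ ('m::finite \<times> 'n::finite)"
  assumes "v \<noteq> 0"
  shows "pt v \<in> tangent_variety segre_variety \<longleftrightarrow> rank_le_2 v"
proof
  assume "pt v \<in> tangent_variety segre_variety"
  then obtain P where P: "P \<in> segre_variety" "pt v \<in> embedded_tangent_space segre_variety P"
    by (auto simp: tangent_variety_def)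
  obtain x where x: "x \<noteq> 0" "P = pt x" by (rule pt_cases)
  then obtain u w where uw: "x = tensor u w" using P(1) mem_segre_variety[OF x(1)] by auto
  then obtain u' w' where "v = tensor u w' + tensor u' w"
    using mem_embedded_tangent_space[OF x(1)[unfolded uw] assms] x P(2) by auto
  then show "rank_le_2 v" unfolding rank_le_2_def by blast
next
  assume "rank_le_2 v"
  then obtain u w u' w' where v: "v = tensor u w + tensor u' w'"
    unfolding rank_le_2_def by blast
  have tangent: "pt v \<in> tangent_variety segre_variety"
    if "tensor a b \<noteq> 0" "v = tensor a b' + tensor a' b" for a b a' b'
    unfolding tangent_variety_def
  proof
    show "pt (tensor a b) \<in> segre_variety" using mem_segre_variety[OF that(1)] by blast
    show "pt v \<in> embedded_tangent_space segre_variety (pt (tensor a b))"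
      unfolding mem_embedded_tangent_space[OF that(1) assms] using that(2) by blast
  qed
  show "pt v \<in> tangent_variety segre_variety"
  proof (cases "tensor u w' = 0")
    case True
    then consider "u = 0" | "w' = 0" by (auto simp: tensor_eq_0_iff)
    then show ?thesis
    proof cases
      case 1
      with v assms show ?thesis
        by (intro tangent[of u' w' w' 0]) (auto simp: tensor_linear)
    next
      case 2
      with v assms show ?thesis
        by (intro tangent[of u w w 0]) (auto simp: tensor_linear)
    qed
  next
    case False
    then show ?thesis using v by (rule tangent)
  qed
qed

section \<open>The length of the intersection with a line\<close>

subsection \<open>Codimension in the space of forms\<close>

lemma subspace_forms: "mpoly.subspace (forms d)"
  by (auto simp: mpoly.subspace_def forms_add forms_scale)

lemma forms_subset_span:
  obtains T :: "('k::field, 'i::finite) mpoly set" where "finite T" "forms d \<subseteq> mpoly.span T"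
proof
  let ?T = "(\<lambda>m. Poly_Mapping.single m (1::'k)) ` box (UNIV :: 'i set) d"
  show "finite ?T" by (intro finite_imageI card_box)
  show "forms d \<subseteq> mpoly.span ?T"
  proof
    fix p :: "('k, 'i) mpoly" assume p: "p \<in> forms d"
    have "Poly_Mapping.lookup m i \<le> d" if "m \<in> Poly_Mapping.keys p" for m i
      using p that member_le_sum[of i UNIV "Poly_Mapping.lookup m"] by (auto simp: forms_def)
    then have "Poly_Mapping.keys p \<subseteq> box UNIV d" by (auto simp: box_def)
    then show "p \<in> mpoly.span ?T" by (rule mem_span_monomials)
  qed
qed

lemma finite_independent_forms:
  fixes B :: "('k::field, 'i::finite) mpoly set"
  assumes "mpoly.independent B" "B \<subseteq> forms d"
  shows "finite B" "card B \<le> mpoly.dim (forms d :: ('k, 'i) mpoly set)"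
proof -
  obtain T :: "('k, 'i) mpoly set" where T: "finite T" "forms d \<subseteq> mpoly.span T"
    by (rule forms_subset_span)
  obtain C :: "('k, 'i) mpoly set" where C: "C \<subseteq> forms d" "mpoly.independent C"
      "forms d \<subseteq> mpoly.span C" "card C = mpoly.dim (forms d :: ('k, 'i) mpoly set)"
    using mpoly.basis_exists by blast
  have "finite C" using mpoly.independent_span_bound[OF T(1) C(2)] C(1) T(2) by auto
  then show "finite B" "card B \<le> mpoly.dim (forms d :: ('k, 'i) mpoly set)"
    using mpoly.independent_span_bound[of C B] assms C by auto
qed

lemma basis_of_forms:
  fixes V :: "('k::field, 'i::finite) mpoly set"
  assumes "V \<subseteq> forms d" "mpoly.subspace V"
  obtains B where "mpoly.independent B" "finite B" "mpoly.span B = V" "card B = mpoly.dim V"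
proof -
  obtain B where B: "B \<subseteq> V" "mpoly.independent B" "V \<subseteq> mpoly.span B" "card B = mpoly.dim V"
    using mpoly.basis_exists by blast
  moreover have "finite B" using finite_independent_forms[OF B(2)] B(1) assms(1) by blast
  moreover have "mpoly.span B = V" using B mpoly.span_minimal[OF B(1) assms(2)] by blast
  ultimately show ?thesis using that by blast
qed

text \<open>Codimensions of a subspace of forms are read off from forms that are independent modulo it
  or that span a complement. The space of forms has finite dimension, without which the
  difference of dimensions in \<open>hilbert_function\<close> would say nothing.\<close>

lemma dim_forms_ge_1:
  fixes V :: "('k::field, 'i::finite) mpoly set"
  assumes V: "V \<subseteq> forms d" "mpoly.subspace V" and g: "g \<in> forms d" "g \<notin> V"
  shows "mpoly.dim V + 1 \<le> mpoly.dim (forms d :: ('k, 'i) mpoly set)"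
proof -
  obtain B where B: "mpoly.independent B" "finite B" "mpoly.span B = V" "card B = mpoly.dim V"
    using basis_of_forms[OF V] .
  have BV: "B \<subseteq> V" using B(3) mpoly.span_superset by blast
  have "mpoly.independent (insert g B)" using B g by (intro mpoly.independent_insertI) auto
  moreover have "insert g B \<subseteq> forms d" using g V BV by auto
  moreover have "g \<notin> B" using g BV by blast
  ultimately show ?thesis using finite_independent_forms(2)[of "insert g B" d] B by simp
qed

lemma dim_forms_ge_2:
  fixes V :: "('k::field, 'i::finite) mpoly set"
  assumes V: "V \<subseteq> forms d" "mpoly.subspace V" and g: "g \<in> forms d" "g' \<in> forms d"
    and ind: "\<And>a b. mconst a * g + mconst b * g' \<in> V \<Longrightarrow> a = 0 \<and> b = 0"
  shows "mpoly.dim V + 2 \<le> mpoly.dim (forms d :: ('k, 'i) mpoly set)"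
proof -
  obtain B where B: "mpoly.independent B" "finite B" "mpoly.span B = V" "card B = mpoly.dim V"
    using basis_of_forms[OF V] .
  have BV: "B \<subseteq> V" using B(3) mpoly.span_superset by blast
  have 0: "mconst 0 * p = 0" "mconst 1 * p = p" for p :: "('k, 'i) mpoly"
    using mpoly.scale_zero_left[of p] mpoly.scale_one[of p] by simp_all
  have g1: "g \<notin> V"
  proof
    assume "g \<in> V"
    then show False using ind[of 1 0] by (simp add: 0)
  qed
  have g2: "g' \<notin> mpoly.span (insert g B)"
  proof
    assume "g' \<in> mpoly.span (insert g B)"
    then obtain k where "g' - mconst k * g \<in> V"
      using B(3) by (auto simp: mpoly.span_insert)
    moreover have "mconst (- k) * g = - (mconst k * g)" using mpoly.scale_minus_left[of k g] by simp
    ultimately have "mconst (- k) * g + mconst 1 * g' \<in> V" by (simp add: 0)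
    then show False using ind by fastforce
  qed
  have "mpoly.independent (insert g B)" using B g1 by (intro mpoly.independent_insertI) auto
  then have "mpoly.independent (insert g' (insert g B))" by (rule mpoly.independent_insertI[OF g2])
  moreover have "insert g' (insert g B) \<subseteq> forms d" using g V BV by auto
  moreover have "g \<notin> B" "g' \<notin> insert g B" using g1 g2 BV mpoly.span_superset by blast+
  ultimately show ?thesis using finite_independent_forms(2)[of "insert g' (insert g B)" d] B by simp
qed

lemma dim_forms_le_1:
  fixes V :: "('k::field, 'i::finite) mpoly set"
  assumes V: "V \<subseteq> forms d" "mpoly.subspace V"
    and g: "\<And>f. f \<in> forms d \<Longrightarrow> \<exists>a. f - mconst a * g \<in> V"
  shows "mpoly.dim (forms d :: ('k, 'i) mpoly set) \<le> mpoly.dim V + 1"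
proof -
  obtain B where B: "mpoly.independent B" "finite B" "mpoly.span B = V" "card B = mpoly.dim V"
    using basis_of_forms[OF V] .
  obtain C :: "('k, 'i) mpoly set" where C: "mpoly.independent C" "mpoly.span C = forms d"
      "card C = mpoly.dim (forms d :: ('k, 'i) mpoly set)"
    using basis_of_forms[OF order_refl subspace_forms[of d]] .
  have "C \<subseteq> mpoly.span (insert g B)"
  proof
    fix f assume "f \<in> C"
    then have "f \<in> forms d" using C(2) mpoly.span_base by blast
    then show "f \<in> mpoly.span (insert g B)" using g B(3) by (auto simp: mpoly.span_insert)
  qed
  then have "card C \<le> card (insert g B)"
    using mpoly.independent_span_bound[of "insert g B" C] B C by simp
  also have "\<dots> \<le> card B + 1" using card_insert_le_m1[of "card B + 1" B g] by simp
  finally show ?thesis using B C by simp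
qed

lemma scheme_length_eq:
  assumes "\<And>d. d \<ge> d0 \<Longrightarrow> hilbert_function I d = n"
  shows "scheme_length I = enat n"
proof -
  have ev: "\<forall>\<^sub>F d in sequentially. hilbert_function I d = n"
    using assms by (auto simp: eventually_sequentially)
  have "m = n" if "\<forall>\<^sub>F d in sequentially. hilbert_function I d = m" for m
    using eventually_happens'[OF sequentially_bot eventually_conj[OF ev that]] by auto
  then have "(THE n. \<forall>\<^sub>F d in sequentially. hilbert_function I d = n) = n"
    using ev by (rule the_equality[rotated])
  then show ?thesis using ev by (auto simp: scheme_length_def)
qed

lemma scheme_length_ge:
  assumes "\<And>d. d \<ge> d0 \<Longrightarrow> hilbert_function I d \<ge> n"
  shows "scheme_length I \<ge> enat n"
proof (cases "\<exists>m. \<forall>\<^sub>F d in sequentially. hilbert_function I d = m")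
  case True
  then obtain m where m: "\<forall>\<^sub>F d in sequentially. hilbert_function I d = m" by blast
  then obtain d1 where d1: "\<And>d. d \<ge> d1 \<Longrightarrow> hilbert_function I d = m"
    by (auto simp: eventually_sequentially)
  then have "scheme_length I = enat m" by (rule scheme_length_eq)
  moreover have "m \<ge> n" using assms[of "max d0 d1"] d1[of "max d0 d1"] by simp
  ultimately show ?thesis by simp
qed (simp add: scheme_length_def)

subsection \<open>Linear forms on a line\<close>

lemma along_linform:
  fixes x q c :: "'k::comm_ring_1 ^ 'i::finite"
  shows
  "along (\<lambda>i. [:x $ i, q $ i:]) (linform c) = [:meval (linform c) x, meval (linform c) q:]"
proof -
  have *: "(\<Sum>i\<in>A. [:f i, g i:]) = [:\<Sum>i\<in>A. f i, \<Sum>i\<in>A. g i:]" for f g :: "'i \<Rightarrow> 'k" and A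
    by (induction A rule: infinite_finite_induct) simp_all
  show ?thesis
    by (simp add: linform_def poly_hom.msubst_simps meval_simps * mult.commute)
qed

lemma ex_dual_linforms:
  fixes x q :: "'k::field ^ 'i::finite"
  assumes "x \<noteq> 0" "\<And>c. q \<noteq> c *s x"
  obtains k l where "meval (linform k) q = 1" "meval (linform k) x = 0"
    "meval (linform l) q = 0" "meval (linform l) x = 1"
proof -
  obtain j where j: "x $ j \<noteq> 0" using assms(1) by (auto simp: vec_eq_iff)
  have "q \<noteq> (q $ j / x $ j) *s x" by (rule assms)
  then obtain i where i: "q $ i \<noteq> q $ j / x $ j * x $ i" by (auto simp: vec_eq_iff)
  define D where "D = q $ i * x $ j - q $ j * x $ i"
  have D: "D \<noteq> 0" using i j by (auto simp: D_def field_simps)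
  have lin: "meval (linform (\<chi> a. (if a = i then b else 0) + (if a = j then c else 0))) v =
      b * v $ i + c * v $ j" for b c and v :: "'k ^ 'i"
    by (simp add: meval_linform distrib_right sum.distrib if_distrib[of "\<lambda>z. z * _"] cong: if_cong)
  have det: "(q $ i * x $ j - q $ j * x $ i) / D = 1" using D by (simp add: D_def)
  have "x $ j / D * q $ i + - x $ i / D * q $ j = 1" "- q $ j / D * x $ i + q $ i / D * x $ j = 1"
    using det by (simp_all add: diff_divide_distrib mult.commute)
  moreover have "x $ j / D * x $ i + - x $ i / D * x $ j = 0" "- q $ j / D * q $ i + q $ i / D * q $ j = 0"
    by simp_all
  ultimately show ?thesis
    by (intro that[of "\<chi> a. (if a = i then x $ j / D else 0) + (if a = j then - x $ i / D else 0)"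
        "\<chi> a. (if a = i then - q $ j / D else 0) + (if a = j then q $ i / D else 0)"])
      (simp_all only: lin)
qed

subsection \<open>Lines through a point of the Segre variety\<close>

abbreviation line_section_ideal ::
    "('k::field, 'i::finite) proj set \<Rightarrow> 'k ^ 'i \<Rightarrow> 'k ^ 'i \<Rightarrow> ('k, 'i) mpoly set"
  where "line_section_ideal S q x \<equiv>
    ideal_sum (vanishing_ideal S) (vanishing_ideal (proj_line (pt q) (pt x)))"

lemma ideal_sum_ideal:
  fixes S T :: "('k::field, 'i::finite) proj set"
  defines "I \<equiv> ideal_sum (vanishing_ideal S) (vanishing_ideal T)"
  shows "f \<in> vanishing_ideal S \<Longrightarrow> f \<in> I" "f \<in> vanishing_ideal T \<Longrightarrow> f \<in> I"
    "f \<in> I \<Longrightarrow> g \<in> I \<Longrightarrow> f + g \<in> I" "f \<in> I \<Longrightarrow> h * f \<in> I" "0 \<in> I"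
proof -
  note mem = I_def ideal_sum_def mem_Collect_eq
  show "f \<in> I" if "f \<in> vanishing_ideal S" for f
    unfolding mem using that vanishing_ideal_ideal(1)[of T] by (intro exI[of _ f] exI[of _ 0]) simp
  show "f \<in> I" if "f \<in> vanishing_ideal T" for f
    unfolding mem using that vanishing_ideal_ideal(1)[of S] by (intro exI[of _ 0] exI[of _ f]) simp
  show "f + g \<in> I" if fg: "f \<in> I" "g \<in> I"
  proof -
    obtain f1 f2 g1 g2 where "f = f1 + f2" "g = g1 + g2" "f1 \<in> vanishing_ideal S"
      "f2 \<in> vanishing_ideal T" "g1 \<in> vanishing_ideal S" "g2 \<in> vanishing_ideal T"
      using fg unfolding mem by metis
    then show ?thesis unfolding mem
      by (intro exI[of _ "f1 + g1"] exI[of _ "f2 + g2"]) (simp add: vanishing_ideal_ideal)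
  qed
  show "h * f \<in> I" if f: "f \<in> I"
  proof -
    obtain f1 f2 where "f = f1 + f2" "f1 \<in> vanishing_ideal S" "f2 \<in> vanishing_ideal T"
      using f unfolding mem by metis
    then show ?thesis unfolding mem
      by (intro exI[of _ "h * f1"] exI[of _ "h * f2"]) (simp add: vanishing_ideal_ideal distrib_left)
  qed
  show "0 \<in> I" unfolding mem
    by (intro exI[of _ 0]) (simp add: vanishing_ideal_ideal(1))
qed

lemma subspace_ideal_sum:
  fixes S T :: "('k::field, 'i::finite) proj set"
  shows "mpoly.subspace (ideal_sum (vanishing_ideal S) (vanishing_ideal T) \<inter> forms d)"
  unfolding mpoly.subspace_def
  by (auto intro: ideal_sum_ideal forms_add forms_scale)

lemma ideal_sum_vanishes:
  assumes "f \<in> ideal_sum (vanishing_ideal S) (vanishing_ideal T)" "y \<noteq> 0" "pt y \<in> S" "pt y \<in> T"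
  shows "meval f y = 0"
  using assms by (auto simp: ideal_sum_def vanishing_ideal_iff meval_simps)

text \<open>Two distinct points of the line impose two conditions on forms.\<close>

lemma length_ge_2_if_two_points:
  fixes S T :: "('k::field, 'i::finite) proj set"
  assumes x: "x \<noteq> 0" "pt x \<in> S" "pt x \<in> T" and y: "y \<noteq> 0" "pt y \<in> S" "pt y \<in> T"
    and ne: "\<And>c. y \<noteq> c *s x"
  shows "scheme_length (ideal_sum (vanishing_ideal S) (vanishing_ideal T)) \<ge> 2"
proof -
  let ?I = "ideal_sum (vanishing_ideal S) (vanishing_ideal T)"
  obtain k l where kl: "meval (linform k) y = 1" "meval (linform k) x = 0"
    "meval (linform l) y = 0" "meval (linform l) x = 1"
    using ex_dual_linforms[OF x(1) ne] by metis
  have "hilbert_function ?I d \<ge> 2" if d: "d \<ge> 1" for d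
  proof -
    have "mpoly.dim (?I \<inter> forms d) + 2 \<le> mpoly.dim (forms d :: ('k, 'i) mpoly set)"
    proof (rule dim_forms_ge_2[OF _ subspace_ideal_sum])
      show "linform k ^ d \<in> forms d" "linform l ^ d \<in> forms d"
        using forms_power[OF forms_linform, of _ d] by simp_all
      fix a b assume "mconst a * linform k ^ d + mconst b * linform l ^ d \<in> ?I \<inter> forms d"
      then have f: "mconst a * linform k ^ d + mconst b * linform l ^ d \<in> ?I" by blast
      show "a = 0 \<and> b = 0"
        using ideal_sum_vanishes[OF f x] ideal_sum_vanishes[OF f y] kl d
        by (simp add: meval_simps power_0_left)
    qed blast
    then show ?thesis by (simp add: hilbert_function_def)
  qed
  then show ?thesis using scheme_length_ge[of 1 2 ?I] by (simp add: numeral_eq_enat)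
qed

text \<open>So do a point and a tangent direction: the value and the derivative in direction \<open>q\<close>.\<close>

lemma length_ge_2_if_tangent:
  fixes q :: "'k::field_char_0 ^ ('m::finite \<times> 'n::finite)"
  assumes x: "tensor u w \<noteq> 0" and q: "q \<noteq> 0" "\<And>c. q \<noteq> c *s tensor u w"
    and tangent: "q = tensor u w' + tensor u' w"
  shows "scheme_length (line_section_ideal segre_variety q (tensor u w)) \<ge> 2"
proof -
  let ?x = "tensor u w"
  let ?L = "proj_line (pt q) (pt ?x)"
  let ?I = "ideal_sum (vanishing_ideal segre_variety) (vanishing_ideal ?L)"
  define \<gamma> where "\<gamma> i = [:?x $ i, q $ i:]" for i
  obtain k l where kl: "meval (linform k) q = 1" "meval (linform k) ?x = 0"
    "meval (linform l) q = 0" "meval (linform l) ?x = 1"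
    using ex_dual_linforms[OF x q(2)] by metis
  have xX: "pt ?x \<in> segre_variety" using mem_segre_variety[OF x] by blast
  have xL: "pt ?x \<in> ?L"
    unfolding mem_proj_line[OF q(1) x x] by (intro exI[of _ 0] exI[of _ 1]) simp
  have deriv: "coeff (along \<gamma> f) 1 = 0" if "f \<in> ?I" for f
  proof -
    obtain g h where gh: "f = g + h" "g \<in> vanishing_ideal segre_variety" "h \<in> vanishing_ideal ?L"
      using \<open>f \<in> ?I\<close> unfolding ideal_sum_def by blast
    have "(\<chi> i. coeff (\<gamma> i) 0) = ?x" "\<And>i. coeff (\<gamma> i) 1 = q $ i"
      by (simp_all add: \<gamma>_def vec_eq_iff)
    then have "coeff (along \<gamma> g) 1 = 0"
      using chain_rule[of g \<gamma>] derivative_along_segre[OF gh(2) x, of w' u'] tangent by simp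
    moreover obtain i where "\<gamma> i \<noteq> 0"
      using q(1) by (auto simp: \<gamma>_def vec_eq_iff)
    moreover have "(\<chi> i. poly (\<gamma> i) s) = s *s q + 1 *s ?x" for s
      by (simp add: \<gamma>_def vec_eq_iff)
    then have "along \<gamma> h = 0"
      using along_eq_0[where \<gamma> = \<gamma>, OF gh(3) \<open>\<gamma> i \<noteq> 0\<close>] mem_proj_line[OF q(1) x] by metis
    ultimately show ?thesis by (simp add: gh(1) poly_hom.msubst_simps)
  qed
  have coeff0: "coeff (along \<gamma> f) 0 = meval f ?x" for f
  proof -
    have "(\<chi> i. poly (\<gamma> i) 0) = ?x" by (simp add: \<gamma>_def vec_eq_iff)
    then show ?thesis using poly_along[of \<gamma> f 0] by (simp only: poly_0_coeff_0)
  qed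
  have \<gamma>k: "along \<gamma> (linform k) = [:0, 1:]"
    using along_linform[of ?x q k] unfolding \<gamma>_def kl .
  have "hilbert_function ?I d \<ge> 2" if d: "d \<ge> 1" for d
  proof -
    have "mpoly.dim (?I \<inter> forms d) + 2 \<le> mpoly.dim (forms d :: ('k, 'm \<times> 'n) mpoly set)"
    proof (rule dim_forms_ge_2[OF _ subspace_ideal_sum])
      show "linform l ^ d \<in> forms d" "linform k * linform l ^ (d - 1) \<in> forms d"
        using forms_power[OF forms_linform, of l d]
          forms_mult[OF forms_linform forms_power[OF forms_linform, of l "d - 1"], of k] d by simp_all
      fix a b
      let ?f = "mconst a * linform l ^ d + mconst b * (linform k * linform l ^ (d - 1))"
      assume "?f \<in> ?I \<inter> forms d"
      then have f: "?f \<in> ?I" by blast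
      have "a = 0"
        using ideal_sum_vanishes[OF f x xX xL] kl by (simp add: meval_simps)
      moreover from this have "coeff ([:b:] * (along \<gamma> (linform k) * along \<gamma> (linform l ^ (d - 1)))) 1 = 0"
        using deriv[OF f] by (simp add: poly_hom.msubst_simps)
      then have "b * coeff (along \<gamma> (linform k) * along \<gamma> (linform l ^ (d - 1))) 1 = 0"
        by simp
      then have "b = 0"
        unfolding coeff_1_mult coeff0 \<gamma>k by (simp add: kl meval_simps)
      ultimately show "a = 0 \<and> b = 0" by blast
    qed blast
    then show ?thesis by (simp add: hilbert_function_def)
  qed
  then show ?thesis using scheme_length_ge[of 1 2 ?I] by (simp add: numeral_eq_enat)
qed

text \<open>Let \<open>\<kappa>\<close> and \<open>\<mu>\<close> be the coordinates on the line with \<open>\<mu>\<close> nonzero at \<open>x\<close>. If the ideal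
  contains \<open>\<kappa>\<^sup>2\<close> and \<open>\<kappa>\<mu>\<close>, then modulo the ideal only \<open>\<mu>\<^sup>d\<close> is left in degree \<open>d \<ge> 2\<close>. The
  proof multiplies by one variable at a time.\<close>

lemma forms_reduce_on_line:
  fixes q x :: "'k::field ^ 'i::finite"
  assumes q: "q \<noteq> 0" and x: "x \<noteq> 0"
    and kl: "meval \<kappa> q = 1" "meval \<kappa> x = 0" "meval \<mu> q = 0" "meval \<mu> x = 1"
      "\<kappa> \<in> forms 1" "\<mu> \<in> forms 1"
    and I: "\<kappa> * \<kappa> \<in> line_section_ideal S q x" "\<kappa> * \<mu> \<in> line_section_ideal S q x"
    and f: "f \<in> forms (Suc d)"
  shows "\<exists>a b. f - (mconst a * \<mu> ^ Suc d + mconst b * (\<kappa> * \<mu> ^ d)) \<in> line_section_ideal S q x"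
proof -
  let ?I = "line_section_ideal S q x"
  define R where "R d f \<longleftrightarrow> (\<exists>a b. f - (mconst a * \<mu> ^ Suc d + mconst b * (\<kappa> * \<mu> ^ d)) \<in> ?I)" for d f
  note ideal = ideal_sum_ideal[where S = S and T = "proj_line (pt q) (pt x)"]
  have mconst_add: "mconst (a + b) = (mconst a + mconst b :: ('k, 'i) mpoly)" for a b
    by (rule mconst_hom.h_add)
  have mconst_mult: "mconst (a * b) = (mconst a * mconst b :: ('k, 'i) mpoly)" for a b
    by (rule mconst_hom.h_mult)
  have R_add: "R d (f + g)" if fg: "R d f" "R d g" for d f g
  proof -
    obtain a b a' b' where
      "f - (mconst a * \<mu> ^ Suc d + mconst b * (\<kappa> * \<mu> ^ d)) \<in> ?I"
      "g - (mconst a' * \<mu> ^ Suc d + mconst b' * (\<kappa> * \<mu> ^ d)) \<in> ?I"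
      using fg unfolding R_def by blast
    from ideal(3)[OF this]
    have "(f + g) - (mconst (a + a') * \<mu> ^ Suc d + mconst (b + b') * (\<kappa> * \<mu> ^ d)) \<in> ?I"
      by (simp add: mconst_add algebra_simps)
    then show ?thesis unfolding R_def by (intro exI)
  qed
  have R_scale: "R d (mconst c * f)" if f: "R d f" for d c f
  proof -
    obtain a b where "f - (mconst a * \<mu> ^ Suc d + mconst b * (\<kappa> * \<mu> ^ d)) \<in> ?I"
      using f unfolding R_def by blast
    from ideal(4)[OF this, of "mconst c"]
    have "mconst c * f - (mconst (c * a) * \<mu> ^ Suc d + mconst (c * b) * (\<kappa> * \<mu> ^ d)) \<in> ?I"
      by (simp only: mconst_mult distrib_left right_diff_distrib mult.assoc)
    then show ?thesis unfolding R_def by (intro exI)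
  qed
  have R_zero: "R d 0" for d
    unfolding R_def using ideal(5) by (intro exI[of _ 0]) (simp add: mconst_hom.h_zero)
  have var: "mvar i - (mconst (x $ i) * \<mu> + mconst (q $ i) * \<kappa>) \<in> ?I" for i
  proof (rule ideal(2), unfold vanishing_ideal_iff, intro allI impI)
    fix r :: "'k ^ 'i" assume "r \<noteq> 0" "pt r \<in> proj_line (pt q) (pt x)"
    then obtain a b where "r = a *s q + b *s x" using mem_proj_line[OF q x] by auto
    moreover have "meval \<kappa> (a *s q + b *s x) = a" "meval \<mu> (a *s q + b *s x) = b"
      using kl by (simp_all add: linear_form_add meval_scale[where d = 1])
    ultimately show "meval (mvar i - (mconst (x $ i) * \<mu> + mconst (q $ i) * \<kappa>)) r = 0"
      by (simp add: meval_simps)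
  qed
  have R_var: "R (Suc d) (mvar i * f)" if f: "R d f" for d i f
  proof -
    obtain a b where g: "f - (mconst a * \<mu> ^ Suc d + mconst b * (\<kappa> * \<mu> ^ d)) \<in> ?I"
      using f unfolding R_def by blast
    let ?h = "mconst a * \<mu> ^ Suc d + mconst b * (\<kappa> * \<mu> ^ d)"
    let ?y = "mconst (x $ i) * \<mu> + mconst (q $ i) * \<kappa>"
    have expand: "v * (f - (a * (l * p) + b * (k * p))) + (a * (l * p) + b * (k * p)) * (v - (x * l + q * k)) +
        (x * b * p) * (k * l) + (q * a * p) * (k * l) + (q * b * p) * (k * k) =
        v * f - x * a * (l * (l * p))" for a b f k l p q v x :: "('k, 'i) mpoly"
      by (simp add: algebra_simps)
    have "mvar i * (f - ?h) + ?h * (mvar i - ?y) +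
        (mconst (x $ i) * mconst b * \<mu> ^ d) * (\<kappa> * \<mu>) + (mconst (q $ i) * mconst a * \<mu> ^ d) * (\<kappa> * \<mu>) +
        (mconst (q $ i) * mconst b * \<mu> ^ d) * (\<kappa> * \<kappa>) \<in> ?I"
      by (intro ideal(3) ideal(4) g var I)
    then have "mvar i * f - mconst (x $ i) * mconst a * (\<mu> * (\<mu> * \<mu> ^ d)) \<in> ?I"
      unfolding power_Suc expand .
    then have "mvar i * f - (mconst (x $ i * a) * \<mu> ^ Suc (Suc d) + mconst 0 * (\<kappa> * \<mu> ^ Suc d)) \<in> ?I"
      by (simp add: mconst_mult mconst_hom.h_zero)
    then show ?thesis unfolding R_def by (intro exI)
  qed
  have "R d (Poly_Mapping.single m 1)" if "(\<Sum>i\<in>UNIV. Poly_Mapping.lookup m i) = Suc d" for m d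
    using that
  proof (induction d arbitrary: m)
    case (0 m)
    then obtain i where i: "Poly_Mapping.lookup m i = 1" "\<And>j. j \<noteq> i \<Longrightarrow> Poly_Mapping.lookup m j = 0"
      using sum_eq_Suc0_iff[of UNIV "Poly_Mapping.lookup m"] by fastforce
    have "m = Poly_Mapping.single i 1"
      by (rule poly_mapping_eqI) (use i in \<open>auto simp: lookup_single when_def\<close>)
    then have "Poly_Mapping.single m 1 = (mvar i :: ('k, 'i) mpoly)" by (simp add: mvar_def)
    then show ?case using var[of i] unfolding R_def
      by (intro exI[of _ "x $ i"] exI[of _ "q $ i"]) simp
  next
    case (Suc d m)
    then obtain i where i: "Poly_Mapping.lookup m i > 0"
      by (metis Suc_neq_Zero gr_zeroI sum.neutral)
    define m' where "m' = m - Poly_Mapping.single i 1"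
    have m: "m = Poly_Mapping.single i 1 + m'"
      by (rule poly_mapping_eqI)
        (use i in \<open>auto simp: m'_def lookup_add lookup_minus lookup_single when_def\<close>)
    have "(\<Sum>j\<in>UNIV. Poly_Mapping.lookup m j) =
        (\<Sum>j\<in>UNIV. (if i = j then 1 else 0) + Poly_Mapping.lookup m' j)"
      by (subst m) (auto simp: lookup_add lookup_single when_def intro!: sum.cong)
    then have "(\<Sum>j\<in>UNIV. Poly_Mapping.lookup m' j) = Suc d"
      using Suc.prems by (simp add: sum.distrib)
    then have "R (Suc d) (mvar i * Poly_Mapping.single m' 1)"
      by (intro R_var Suc.IH)
    then show ?case by (subst m) (simp add: mvar_def mult_single)
  qed
  then have "R d (mconst (Poly_Mapping.lookup f m) * Poly_Mapping.single m 1)" if "m \<in> Poly_Mapping.keys f" for m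
    using that f by (intro R_scale) (auto simp: forms_def)
  then have "R d (\<Sum>m\<in>M. mconst (Poly_Mapping.lookup f m) * Poly_Mapping.single m 1)"
    if "M \<subseteq> Poly_Mapping.keys f" for M
    using that by (induction M rule: infinite_finite_induct) (auto simp: R_zero intro: R_add)
  then have "R d (\<Sum>m\<in>Poly_Mapping.keys f. mconst (Poly_Mapping.lookup f m) * Poly_Mapping.single m 1)"
    by blast
  then have "R d f"
    by (subst mpoly_sum_single) (simp add: mconst_def mult_single)
  then show ?thesis unfolding R_def .
qed

lemma length_1_if_transversal:
  fixes q x :: "'k::field ^ 'i::finite"
  assumes q: "q \<noteq> 0" and x: "x \<noteq> 0" "pt x \<in> S"
    and kl: "meval \<kappa> q = 1" "meval \<kappa> x = 0" "meval \<mu> q = 0" "meval \<mu> x = 1"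
      "\<kappa> \<in> forms 1" "\<mu> \<in> forms 1"
    and I: "\<kappa> * \<kappa> \<in> line_section_ideal S q x" "\<kappa> * \<mu> \<in> line_section_ideal S q x"
  shows "scheme_length (line_section_ideal S q x) = 1"
proof -
  let ?I = "line_section_ideal S q x"
  note ideal = ideal_sum_ideal[where S = S and T = "proj_line (pt q) (pt x)"]
  have xL: "pt x \<in> proj_line (pt q) (pt x)"
    unfolding mem_proj_line[OF q x(1) x(1)] by (intro exI[of _ 0] exI[of _ 1]) simp
  have "hilbert_function ?I d = 1" if "d \<ge> 2" for d
  proof -
    obtain e where d: "d = Suc (Suc e)"
      using \<open>d \<ge> 2\<close> by (metis Suc_le_D numeral_2_eq_2 le_Suc_ex add_Suc plus_nat.simps)
    let ?V = "?I \<inter> forms d"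
    have power: "\<mu> ^ d \<in> forms d" using forms_power[OF kl(6), of d] by simp
    have "mpoly.dim (forms d :: ('k, 'i) mpoly set) \<le> mpoly.dim ?V + 1"
    proof (rule dim_forms_le_1[OF _ subspace_ideal_sum])
      fix f :: "('k, 'i) mpoly" assume f: "f \<in> forms d"
      then obtain a b where "f - (mconst a * \<mu> ^ d + mconst b * (\<kappa> * \<mu> ^ Suc e)) \<in> ?I"
        using forms_reduce_on_line[OF q x(1) kl I, of f "Suc e"] by (auto simp: d)
      from ideal(3)[OF this ideal(4)[OF I(2), of "mconst b * \<mu> ^ e"]]
      have "f - mconst a * \<mu> ^ d \<in> ?I" by (simp add: algebra_simps)
      then show "\<exists>a. f - mconst a * \<mu> ^ d \<in> ?V"
        using f power by (auto intro: forms_diff forms_scale)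
    qed blast
    moreover have "\<mu> ^ d \<notin> ?V"
    proof
      assume "\<mu> ^ d \<in> ?V"
      then show False using ideal_sum_vanishes[OF _ x xL, of "\<mu> ^ d"] kl by (simp add: meval_simps)
    qed
    then have "mpoly.dim ?V + 1 \<le> mpoly.dim (forms d :: ('k, 'i) mpoly set)"
      by (intro dim_forms_ge_1[OF _ subspace_ideal_sum power]) auto
    ultimately show ?thesis by (simp add: hilbert_function_def)
  qed
  then show ?thesis using scheme_length_eq[of 2 ?I 1] by (simp add: one_enat_def)
qed

text \<open>On the line, \<open>minor2\<close> becomes \<open>\<kappa>\<close> times a linear form \<open>m \<kappa> + B \<mu>\<close>, with \<open>m\<close> its value at
  \<open>q\<close> and \<open>B\<close> its polarization. If these linear forms span, the intersection is reduced to \<open>x\<close>;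
  otherwise they have a common zero, which is a second point or, if it is \<open>x\<close>, a tangency.\<close>

lemma length_1_if_no_secant:
  fixes q :: "'k::field ^ ('m::finite \<times> 'n::finite)"
  assumes q: "q \<noteq> 0" "pt q \<notin> segre_variety" and x: "tensor u w \<noteq> 0"
    and no_secant: "\<And>a u' w'. q \<noteq> a *s tensor u w + tensor u' w'"
    and no_tangent: "\<And>u' w'. q \<noteq> tensor u w' + tensor u' w"
  shows "scheme_length (line_section_ideal segre_variety q (tensor u w)) = 1"
proof -
  let ?x = "tensor u w"
  let ?I = "line_section_ideal segre_variety q ?x"
  note ideal = ideal_sum_ideal[where S = segre_variety and T = "proj_line (pt q) (pt ?x)"]
  have "q \<noteq> c *s ?x" for c using no_secant[of c 0 0] by (simp add: tensor_linear)
  then obtain k l where kl: "meval (linform k) q = 1" "meval (linform k) ?x = 0"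
    "meval (linform l) q = 0" "meval (linform l) ?x = 1"
    using ex_dual_linforms[OF x] by metis
  define \<kappa> where "\<kappa> = linform k"
  define \<mu> where "\<mu> = linform l"
  have kl': "meval \<kappa> q = 1" "meval \<kappa> ?x = 0" "meval \<mu> q = 0" "meval \<mu> ?x = 1"
    "\<kappa> \<in> forms 1" "\<mu> \<in> forms 1"
    using kl by (simp_all only: \<kappa>_def \<mu>_def forms_linform)
  define B where "B i k j l = q $ (i, j) * ?x $ (k, l) + ?x $ (i, j) * q $ (k, l)
      - q $ (i, l) * ?x $ (k, j) - ?x $ (i, l) * q $ (k, j)" for i k j l
  define m where "m i k j l = meval (minor2 i k j l) q" for i k j l
  have on_line: "meval (minor2 i k j l) (s *s q + t *s ?x) = s * (s * m i k j l + t * B i k j l)"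
    for i k j l s t
    by (simp add: meval_minor2 m_def B_def algebra_simps)
  obtain i k j l where m0: "m i k j l \<noteq> 0"
    using q eq_tensor_iff[of q] mem_segre_variety[OF q(1)] unfolding m_def by auto
  have "\<exists>i' k' j' l'. m i k j l * B i' k' j' l' \<noteq> m i' k' j' l' * B i k j l"
  proof (rule ccontr)
    assume "\<not> ?thesis"
    then have proportional: "m i k j l * B i' k' j' l' = m i' k' j' l' * B i k j l" for i' k' j' l' by blast
    show False
    proof (cases "B i k j l = 0")
      case True
      then have "B i' k' j' l' = 0" for i' k' j' l' using proportional m0 by simp
      then have "?x $ (i', j') * q $ (k', l') + q $ (i', j') * ?x $ (k', l') =
          ?x $ (i', l') * q $ (k', j') + q $ (i', l') * ?x $ (k', j')" for i' k' j' l'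
        unfolding B_def by (simp add: diff_diff_eq add.commute)
      then show False using tangent_if_polar_minors[OF x] no_tangent by blast
    next
      case False
      let ?s = "B i k j l" and ?t = "- m i k j l"
      have "meval (minor2 i' k' j' l') (?s *s q + ?t *s ?x) = 0" for i' k' j' l'
        unfolding on_line using proportional[of i' k' j' l'] by (simp add: mult.commute)
      then obtain u' w' where "?s *s q + ?t *s ?x = tensor u' w'"
        using eq_tensor_iff[of "?s *s q + ?t *s ?x"] by auto
      then have "inverse ?s *s (?s *s q + ?t *s ?x) = inverse ?s *s tensor u' w'" by simp
      then have "q = (- inverse ?s * ?t) *s ?x + tensor (inverse ?s *s u') w'"
        using False by (simp add: vec.scale_right_distrib vec.scale_right_diff_distrib tensor_linear algebra_simps)
      then show False using no_secant by blast
    qed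
  qed
  then obtain i' k' j' l' where det: "m i k j l * B i' k' j' l' \<noteq> m i' k' j' l' * B i k j l" by blast
  define D where "D = m i k j l * B i' k' j' l' - m i' k' j' l' * B i k j l"
  have D: "D \<noteq> 0" using det by (simp add: D_def)
  \<comment> \<open>Cramer's rule expresses \<open>\<kappa>\<^sup>2\<close> and \<open>\<kappa>\<mu>\<close> on the line by the two minors.\<close>
  have combination: "f \<in> ?I"
    if f: "\<And>s t. meval f (s *s q + t *s ?x) = s * (b * (s * m i k j l + t * B i k j l) +
      b' * (s * m i' k' j' l' + t * B i' k' j' l'))" for f b b'
  proof -
    let ?g = "mconst b * minor2 i k j l + mconst b' * minor2 i' k' j' l'"
    have "f - ?g \<in> vanishing_ideal (proj_line (pt q) (pt ?x))"
      unfolding vanishing_ideal_iff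
    proof (intro allI impI)
      fix r :: "'k ^ ('m \<times> 'n)" assume "r \<noteq> 0" "pt r \<in> proj_line (pt q) (pt ?x)"
      then obtain s t where "r = s *s q + t *s ?x" using mem_proj_line[OF q(1) x] by auto
      then show "meval (f - ?g) r = 0"
        by (simp only: meval_simps f on_line) (simp add: algebra_simps)
    qed
    then have "(f - ?g) + (mconst b * minor2 i k j l + mconst b' * minor2 i' k' j' l') \<in> ?I"
      by (intro ideal(3) ideal(4) ideal(1)[OF minor2_in_ideal]) (rule ideal(2))
    then show ?thesis by simp
  qed
  have eval: "meval \<kappa> (s *s q + t *s ?x) = s" "meval \<mu> (s *s q + t *s ?x) = t" for s t
    using kl' by (simp_all add: linear_form_add meval_scale[where d = 1])
  have D1: "m i k j l * B i' k' j' l' / D - m i' k' j' l' * B i k j l / D = 1"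
    using D by (simp add: D_def flip: diff_divide_distrib)
  have "\<kappa> * \<kappa> \<in> ?I"
  proof (rule combination)
    fix s t
    have "s * (B i' k' j' l' / D * (s * m i k j l + t * B i k j l) +
        - B i k j l / D * (s * m i' k' j' l' + t * B i' k' j' l')) =
        s * s * (m i k j l * B i' k' j' l' / D - m i' k' j' l' * B i k j l / D)"
      by (simp add: algebra_simps)
    then show "meval (\<kappa> * \<kappa>) (s *s q + t *s ?x) =
        s * (B i' k' j' l' / D * (s * m i k j l + t * B i k j l) +
        - B i k j l / D * (s * m i' k' j' l' + t * B i' k' j' l'))"
      by (simp only: D1 meval_simps eval mult_1_right)
  qed
  moreover have "\<kappa> * \<mu> \<in> ?I"
  proof (rule combination)
    fix s t
    have "s * (- m i' k' j' l' / D * (s * m i k j l + t * B i k j l) +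
        m i k j l / D * (s * m i' k' j' l' + t * B i' k' j' l')) =
        s * t * (m i k j l * B i' k' j' l' / D - m i' k' j' l' * B i k j l / D)"
      by (simp add: algebra_simps)
    then show "meval (\<kappa> * \<mu>) (s *s q + t *s ?x) =
        s * (- m i' k' j' l' / D * (s * m i k j l + t * B i k j l) +
        m i k j l / D * (s * m i' k' j' l' + t * B i' k' j' l'))"
      by (simp only: D1 meval_simps eval mult_1_right)
  qed
  moreover have "pt ?x \<in> segre_variety" using mem_segre_variety[OF x] by blast
  ultimately show ?thesis using length_1_if_transversal[OF q(1) x _ kl'] by blast
qed

text \<open>The two alternatives are the two kinds of lines of length at least two: those with a second
  point \<open>u' \<otimes> w'\<close> on the variety, and those tangent to it at \<open>u \<otimes> w\<close>.\<close>

lemma mem_secant_locus_segre: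
  fixes q :: "'k::field_char_0 ^ ('m::finite \<times> 'n::finite)"
  assumes q: "q \<noteq> 0" "pt q \<notin> segre_variety" and x: "tensor u w \<noteq> 0"
  shows "pt (tensor u w) \<in> secant_locus (pt q) segre_variety \<longleftrightarrow>
    (\<exists>a u' w'. q = a *s tensor u w + tensor u' w') \<or> (\<exists>u' w'. q = tensor u w' + tensor u' w)"
    (is "_ \<longleftrightarrow> ?secant \<or> ?tangent")
proof -
  let ?x = "tensor u w"
  have not_tensor: "q \<noteq> tensor u' w'" for u' w' using q mem_segre_variety[OF q(1)] by blast
  have xX: "pt ?x \<in> segre_variety" using mem_segre_variety[OF x] by blast
  have ne: "q \<noteq> c *s ?x" for c
    using not_tensor[of "c *s u" w] by (simp add: tensor_linear)
  let ?len = "scheme_length (line_section_ideal segre_variety q ?x)"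
  have "?len \<ge> 2" if ?secant
  proof -
    obtain a u' w' where q': "q = a *s ?x + tensor u' w'" using \<open>?secant\<close> by blast
    let ?y = "tensor u' w'"
    have y0: "?y \<noteq> 0" using q' ne[of a] by auto
    have y: "?y = 1 *s q + (- a) *s ?x" by (simp add: q')
    have "?y \<noteq> c *s ?x" for c
    proof
      assume "?y = c *s ?x"
      then have "q = (a + c) *s ?x" using q' by (simp add: vector_sadd_rdistrib)
      then show False using ne by blast
    qed
    moreover have "pt ?y \<in> proj_line (pt q) (pt ?x)"
      unfolding mem_proj_line[OF q(1) x y0] using y by blast
    moreover have "pt ?x \<in> proj_line (pt q) (pt ?x)"
      unfolding mem_proj_line[OF q(1) x x] by (intro exI[of _ 0] exI[of _ 1]) simp
    moreover have "pt ?y \<in> segre_variety" using mem_segre_variety[OF y0] by blast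
    ultimately show ?thesis using x xX y0 by (intro length_ge_2_if_two_points)
  qed
  moreover have "?len \<ge> 2" if ?tangent
    using that length_ge_2_if_tangent[OF x q(1) ne] by blast
  moreover have "?len = 1" if "\<not> (?secant \<or> ?tangent)"
    using that by (intro length_1_if_no_secant[OF q x]) blast+
  moreover have "\<not> (1 :: enat) \<ge> 2" by (simp add: one_enat_def numeral_eq_enat)
  ultimately have "?len \<ge> 2 \<longleftrightarrow> ?secant \<or> ?tangent" by metis
  then show ?thesis using xX by (simp add: secant_locus_def)
qed

section \<open>The quadric of singular \<open>2 \<times> 2\<close> matrices\<close>

definition vec4 :: "'k \<Rightarrow> 'k \<Rightarrow> 'k \<Rightarrow> 'k \<Rightarrow> 'k ^ 4"
  where "vec4 a b c d = (\<chi> i. if i = 1 then a else if i = 2 then b else if i = 3 then c else d)"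

lemma vec4_nth [simp]:
  "vec4 a b c d $ 1 = a" "vec4 a b c d $ 2 = b" "vec4 a b c d $ 3 = c" "vec4 a b c d $ 4 = d"
  by (simp_all add: vec4_def)

lemma vec4_eqI:
  "v $ 1 = w $ 1 \<Longrightarrow> v $ 2 = w $ 2 \<Longrightarrow> v $ 3 = w $ 3 \<Longrightarrow> v $ 4 = w $ 4 \<Longrightarrow> v = (w :: 'k ^ 4)"
  by (simp add: vec_eq_iff forall_4)

lemma prod_4: "prod f (UNIV :: 4 set) = f 1 * f 2 * f 3 * (f 4 :: 'a::comm_monoid_mult)"
  unfolding UNIV_4 by (simp add: mult_ac)

definition quadric :: "('k::comm_ring_1, 4) mpoly"
  where "quadric = mvar 1 * mvar 4 - mvar 2 * mvar 3"

lemma meval_quadric: "meval quadric v = v $ 1 * v $ 4 - v $ 2 * v $ 3"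
  by (simp add: quadric_def meval_simps)

lemma forms_quadric: "quadric \<in> forms 2"
  unfolding quadric_def one_add_one[symmetric] by (intro forms_diff forms_mult forms_mvar)

lemma quadric_point_factors:
  assumes "meval quadric v = (0 :: 'k::field)"
  obtains a b c d where "v = vec4 (a * c) (a * d) (b * c) (b * d)"
proof -
  have eq: "v $ 1 * v $ 4 = v $ 2 * v $ 3" using assms by (simp add: meval_quadric)
  consider "v $ 1 \<noteq> 0" | "v $ 1 = 0" "v $ 2 \<noteq> 0" | "v $ 1 = 0" "v $ 2 = 0" by blast
  then show ?thesis
  proof cases
    case 1
    show ?thesis
      by (rule that[of 1 "v $ 1" "v $ 2" "v $ 3 / v $ 1"], rule vec4_eqI)
        (use 1 eq in \<open>simp_all add: nonzero_eq_divide_eq mult.commute\<close>)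
  next
    case 2
    then have "v $ 3 = 0" using eq by simp
    show ?thesis
      by (rule that[of 1 "v $ 1" "v $ 2" "v $ 4 / v $ 2"], rule vec4_eqI)
        (use 2 \<open>v $ 3 = 0\<close> in simp_all)
  next
    case 3
    show ?thesis
      by (rule that[of 0 "v $ 3" "v $ 4" 1], rule vec4_eqI) (use 3 in simp_all)
  qed
qed

lemma quadric_smooth:
  fixes v :: "'k::comm_ring_1 ^ 4"
  assumes "v \<noteq> 0"
  shows "\<exists>i. meval (mpderiv i quadric) v \<noteq> 0"
proof -
  have deriv: "meval (mpderiv i quadric) v =
      coeff (along (\<lambda>j. [:v $ j, if j = i then 1 else 0:]) quadric) 1" for i
  proof -
    have "(\<Sum>j\<in>UNIV. meval (mpderiv j quadric) v * (if j = i then 1 else 0)) = meval (mpderiv i quadric) v"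
      by (simp add: if_distrib cong: if_cong)
    then show ?thesis
      using chain_rule[of quadric "\<lambda>j. [:v $ j, if j = i then 1 else 0:]"] by simp
  qed
  have "meval (mpderiv 1 quadric) v = v $ 4" "meval (mpderiv 2 quadric) v = - v $ 3"
    "meval (mpderiv 3 quadric) v = - v $ 2" "meval (mpderiv 4 quadric) v = v $ 1"
    unfolding deriv by (simp_all add: quadric_def poly_hom.msubst_simps)
  moreover have "v $ 1 \<noteq> 0 \<or> v $ 2 \<noteq> 0 \<or> v $ 3 \<noteq> 0 \<or> v $ 4 \<noteq> 0"
    using assms by (auto simp: vec_eq_iff forall_4)
  ultimately show ?thesis by (metis neg_equal_0_iff_equal)
qed

text \<open>Modulo the quadric, \<open>x\<^sub>1 x\<^sub>4\<close> may be replaced by \<open>x\<^sub>2 x\<^sub>3\<close> until no monomial contains both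
  \<open>x\<^sub>1\<close> and \<open>x\<^sub>4\<close>.\<close>

lemma monomial_reduces:
  fixes m :: "4 \<Rightarrow>\<^sub>0 nat"
  shows "\<exists>n. (Poly_Mapping.lookup n 1 = 0 \<or> Poly_Mapping.lookup n 4 = 0) \<and>
    quadric dvd Poly_Mapping.single m 1 - (Poly_Mapping.single n 1 :: ('k::comm_ring_1, 4) mpoly)"
proof (induction "Poly_Mapping.lookup m 1" arbitrary: m rule: less_induct)
  case less
  let ?s = "\<lambda>i. Poly_Mapping.single (i :: 4) (1 :: nat)"
  show ?case
  proof (cases "Poly_Mapping.lookup m 1 = 0 \<or> Poly_Mapping.lookup m 4 = 0")
    case True
    then show ?thesis by (intro exI[of _ m]) simp
  next
    case False
    define m' where "m' = m - ?s 1 - ?s 4"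
    have m: "m = ?s 1 + ?s 4 + m'"
      by (rule poly_mapping_eqI)
        (use False in \<open>auto simp: m'_def lookup_add lookup_minus lookup_single when_def\<close>)
    let ?n = "?s 2 + ?s 3 + m'"
    have "Poly_Mapping.single m 1 - Poly_Mapping.single ?n 1 =
        (quadric * Poly_Mapping.single m' 1 :: ('k, 4) mpoly)"
      unfolding m quadric_def mvar_def by (simp add: mult_single left_diff_distrib)
    moreover have "Poly_Mapping.lookup ?n 1 < Poly_Mapping.lookup m 1"
      using m by (subst m) (simp add: lookup_add lookup_single)
    then obtain n where n: "Poly_Mapping.lookup n 1 = 0 \<or> Poly_Mapping.lookup n 4 = 0"
        "quadric dvd Poly_Mapping.single ?n 1 - (Poly_Mapping.single n 1 :: ('k, 4) mpoly)"
      using less by blast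
    ultimately have "quadric dvd (Poly_Mapping.single m 1 - Poly_Mapping.single ?n 1) +
        (Poly_Mapping.single ?n 1 - (Poly_Mapping.single n 1 :: ('k, 4) mpoly))"
      by (intro dvd_add) auto
    then have "quadric dvd Poly_Mapping.single m 1 - (Poly_Mapping.single n 1 :: ('k, 4) mpoly)"
      by simp
    with n(1) show ?thesis by blast
  qed
qed

text \<open>The reduced monomials stay independent on the quadric: under its parametrization by
  \<open>(a, b) \<otimes> (c, d)\<close> distinct reduced monomials become distinct monomials in \<open>a, b, c, d\<close>.\<close>

lemma quadric_dvd_if_vanishes:
  fixes f :: "('k::field_char_0, 4) mpoly"
  assumes "\<And>a b c d. meval f (vec4 (a * c) (a * d) (b * c) (b * d)) = 0"
  shows "quadric dvd f"
proof -
  let ?l = "Poly_Mapping.lookup :: (4 \<Rightarrow>\<^sub>0 nat) \<Rightarrow> _"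
  obtain nf where nf: "\<And>m. ?l (nf m) 1 = 0 \<or> ?l (nf m) 4 = 0"
      "\<And>m. quadric dvd Poly_Mapping.single m 1 - (Poly_Mapping.single (nf m) 1 :: ('k, 4) mpoly)"
    using monomial_reduces by metis
  define r where "r = (\<Sum>m\<in>Poly_Mapping.keys f. mconst (Poly_Mapping.lookup f m) * Poly_Mapping.single (nf m) 1)"
  have "f = (\<Sum>m\<in>Poly_Mapping.keys f. mconst (Poly_Mapping.lookup f m) * Poly_Mapping.single m 1)"
    by (subst mpoly_sum_single) (simp add: mconst_def mult_single)
  then have "f - r = (\<Sum>m\<in>Poly_Mapping.keys f. mconst (Poly_Mapping.lookup f m) *
      (Poly_Mapping.single m 1 - Poly_Mapping.single (nf m) 1))"
    unfolding r_def by (simp add: right_diff_distrib sum_subtractf)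
  then have dvd: "quadric dvd f - r"
    using nf(2) by (simp add: dvd_sum)
  have r_reduced: "?l n 1 = 0 \<or> ?l n 4 = 0" if "n \<in> Poly_Mapping.keys r" for n
  proof (rule ccontr)
    assume n: "\<not> (?l n 1 = 0 \<or> ?l n 4 = 0)"
    then have "nf m \<noteq> n" for m using nf(1)[of m] by auto
    then have "Poly_Mapping.lookup r n = 0"
      by (simp add: r_def lookup_sum mconst_def mult_single lookup_single when_def)
    then show False using that by (simp add: in_keys_iff)
  qed
  have r_vanishes: "meval r (vec4 (a * c) (a * d) (b * c) (b * d)) = 0" for a b c d
  proof -
    obtain g where "f - r = quadric * g" using dvd by blast
    then have "meval (f - r) (vec4 (a * c) (a * d) (b * c) (b * d)) = 0"
      by (simp add: meval_simps meval_quadric)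
    then show ?thesis using assms by (simp add: meval_simps)
  qed
  define e where "e n i = (if i = 1 then ?l n 1 + ?l n 2 else if i = 2 then ?l n 3 + ?l n 4
      else if i = 3 then ?l n 1 + ?l n 3 else ?l n 2 + ?l n 4)" for n and i :: 4
  have e_nth: "e n 1 = ?l n 1 + ?l n 2" "e n 2 = ?l n 3 + ?l n 4" "e n 3 = ?l n 1 + ?l n 3"
      "e n 4 = ?l n 2 + ?l n 4" for n
    by (simp_all add: e_def)
  have inj: "inj_on e (Poly_Mapping.keys r)"
  proof (rule inj_onI)
    fix m n assume mn: "m \<in> Poly_Mapping.keys r" "n \<in> Poly_Mapping.keys r" "e m = e n"
    from fun_cong[OF mn(3)] have "?l m 1 + ?l m 2 = ?l n 1 + ?l n 2" "?l m 3 + ?l m 4 = ?l n 3 + ?l n 4"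
        "?l m 1 + ?l m 3 = ?l n 1 + ?l n 3" "?l m 2 + ?l m 4 = ?l n 2 + ?l n 4"
      by (simp_all only: flip: e_nth)
    then have "?l m 1 = ?l n 1 \<and> ?l m 2 = ?l n 2 \<and> ?l m 3 = ?l n 3 \<and> ?l m 4 = ?l n 4"
      using r_reduced[OF mn(1)] r_reduced[OF mn(2)] by linarith
    then have "\<forall>i. ?l m i = ?l n i" unfolding forall_4 .
    then show "m = n" by (intro poly_mapping_eqI) simp
  qed
  define c where "c l = Poly_Mapping.lookup r (the_inv_into (Poly_Mapping.keys r) e l)" for l
  have c: "c (e n) = Poly_Mapping.lookup r n" if "n \<in> Poly_Mapping.keys r" for n
    using that by (simp add: c_def the_inv_into_f_f inj)
  have "Poly_Mapping.lookup r n = 0" if n: "n \<in> Poly_Mapping.keys r" for n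
  proof -
    have "c (e n) = 0"
    proof (rule monomial_functions_independent[where J = UNIV and M = "e ` Poly_Mapping.keys r" and c = c])
      fix x :: "4 \<Rightarrow> 'k"
      have "(\<Sum>l\<in>e ` Poly_Mapping.keys r. c l * (\<Prod>i\<in>UNIV. x i ^ l i)) =
          (\<Sum>n\<in>Poly_Mapping.keys r. Poly_Mapping.lookup r n * (\<Prod>i\<in>UNIV. x i ^ e n i))"
        by (simp add: sum.reindex[OF inj] c)
      also have "\<dots> = meval r (vec4 (x 1 * x 3) (x 1 * x 4) (x 2 * x 3) (x 2 * x 4))"
        by (simp add: meval_def msubst_def prod_4 e_nth power_add power_mult_distrib mult_ac)
      finally show "(\<Sum>l\<in>e ` Poly_Mapping.keys r. c l * (\<Prod>i\<in>UNIV. x i ^ l i)) = 0"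
        by (simp add: r_vanishes)
    qed (use n in auto)
    then show ?thesis using c n by simp
  qed
  then have "Poly_Mapping.lookup r n = 0" for n
    by (cases "n \<in> Poly_Mapping.keys r") (auto simp: in_keys_iff)
  then have "r = 0" by (intro poly_mapping_eqI) simp
  with dvd show ?thesis by simp
qed

section \<open>The secant locus of a point of rank two\<close>

abbreviation dot :: "'k::comm_ring_1 ^ 'i::finite \<Rightarrow> 'k ^ 'i \<Rightarrow> 'k"
  where "dot p u \<equiv> \<Sum>i\<in>UNIV. p $ i * u $ i"

lemma dot_tensor: "dot (tensor p r) (tensor u w) = dot p u * dot r w"
  by (simp add: UNIV_Times_UNIV[symmetric] sum_product sum.cartesian_product mult_ac
      del: UNIV_Times_UNIV) (simp add: case_prod_unfold mult_ac)

lemma dot_linear: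
  "dot p (u + v) = dot p u + dot p v" "dot p (c *s u) = c * dot p u"
  by (simp_all add: distrib_left sum.distrib sum_distrib_left mult_ac)

text \<open>A left inverse of a \<open>2 \<times> 2\<close> matrix is a right inverse.\<close>

lemma inverse_2x2:
  fixes a b c d :: "'k::field"
  assumes "a * e + b * g = 1" "a * f + b * h = 0" "c * e + d * g = 0" "c * f + d * h = 1"
  shows "e * a + f * c = 1" "e * b + f * d = 0" "g * a + h * c = 0" "g * b + h * d = 1"
proof -
  define D where "D = a * d - b * c"
  have e: "D * e = d" and g: "D * g = - c" and f: "D * f = - b" and h: "D * h = a"
    using assms unfolding D_def by algebra+
  have D: "D \<noteq> 0" using e f g h assms by auto
  have "D * (e * a + f * c) = D * 1" "D * (e * b + f * d) = D * 0"
    "D * (g * a + h * c) = D * 0" "D * (g * b + h * d) = D * 1"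
    using e f g h unfolding distrib_left mult.assoc[symmetric] by (simp_all add: D_def mult.commute)
  then show "e * a + f * c = 1" "e * b + f * d = 0" "g * a + h * c = 0" "g * b + h * d = 1"
    using D by (simp_all only: mult_cancel_left) simp_all
qed

lemma pair_in_span:
  fixes u1 u2 :: "'k::field ^ 'i::finite"
  assumes p: "dot p1 u1 = 1" "dot p1 u2 = 0" "dot p2 u1 = 0" "dot p2 u2 = 1"
    and u: "u1 = a *s u + b *s u'" "u2 = c *s u + d *s u'"
  shows "u = dot p1 u *s u1 + dot p2 u *s u2" "u' = dot p1 u' *s u1 + dot p2 u' *s u2"
proof -
  have eqs: "a * dot p1 u + b * dot p1 u' = 1" "a * dot p2 u + b * dot p2 u' = 0"
    "c * dot p1 u + d * dot p1 u' = 0" "c * dot p2 u + d * dot p2 u' = 1"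
    using p by (simp_all only: u dot_linear)
  note inv = inverse_2x2[OF eqs]
  have "dot p1 u *s u1 + dot p2 u *s u2 =
      (dot p1 u * a + dot p2 u * c) *s u + (dot p1 u * b + dot p2 u * d) *s u'"
    unfolding u by (simp only: vec_eq_iff) (simp add: algebra_simps)
  then show "u = dot p1 u *s u1 + dot p2 u *s u2" by (simp only: inv) simp
  have "dot p1 u' *s u1 + dot p2 u' *s u2 =
      (dot p1 u' * a + dot p2 u' * c) *s u + (dot p1 u' * b + dot p2 u' * d) *s u'"
    unfolding u by (simp only: vec_eq_iff) (simp add: algebra_simps)
  then show "u' = dot p1 u' *s u1 + dot p2 u' *s u2" by (simp only: inv) simp
qed

text \<open>A matrix \<open>u1 \<otimes> w1 + u2 \<otimes> w2\<close> of rank two, with functionals \<open>p1, p2\<close> and \<open>r1, r2\<close> dual to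
  the two bases. Coordinates in these bases identify the matrices with row and column space in
  the given planes with \<open>2 \<times> 2\<close> matrices, \<open>centre\<close> being the identity matrix.\<close>

locale rank_two =
  fixes u1 u2 p1 p2 :: "'k::{alg_closed_field, field_char_0} ^ 'm::finite"
    and w1 w2 r1 r2 :: "'k ^ 'n::finite"
  assumes p: "dot p1 u1 = 1" "dot p1 u2 = 0" "dot p2 u1 = 0" "dot p2 u2 = 1"
    and r: "dot r1 w1 = 1" "dot r1 w2 = 0" "dot r2 w1 = 0" "dot r2 w2 = 1"
begin

abbreviation "X \<equiv> segre_variety :: ('k, 'm \<times> 'n) proj set"

definition centre :: "'k ^ ('m \<times> 'n)"
  where "centre = tensor u1 w1 + tensor u2 w2"

definition emb :: "'k ^ 4 ^ ('m \<times> 'n)"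
  where "emb = (\<chi> ij. vec4 (tensor u1 w1 $ ij) (tensor u1 w2 $ ij) (tensor u2 w1 $ ij) (tensor u2 w2 $ ij))"

definition coords :: "'k ^ ('m \<times> 'n) ^ 4"
  where "coords = vec4 (tensor p1 r1) (tensor p1 r2) (tensor p2 r1) (tensor p2 r2)"

lemma emb_mult: "emb *v v = v $ 1 *s tensor u1 w1 + v $ 2 *s tensor u1 w2 +
    v $ 3 *s tensor u2 w1 + v $ 4 *s tensor u2 w2"
  by (simp add: vec_eq_iff matrix_vector_mult_def emb_def sum_4 mult.commute)

lemma coords_mult: "coords *v x = vec4 (dot (tensor p1 r1) x) (dot (tensor p1 r2) x)
    (dot (tensor p2 r1) x) (dot (tensor p2 r2) x)"
  by (rule vec4_eqI) (simp_all only: matrix_vector_mult_def coords_def vec4_nth vec_lambda_beta)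

lemma coords_emb: "coords *v (emb *v v) = v"
  unfolding coords_mult emb_mult dot_linear dot_tensor p r by (rule vec4_eqI) simp_all

lemma emb_eq_0_iff: "emb *v v = 0 \<longleftrightarrow> v = 0"
  using coords_emb[of v] by (metis matrix_vector_mult_0_right)

lemma inj_emb: "inj ((*v) emb)"
  by (rule inj_on_inverseI[of _ "(*v) coords"]) (rule coords_emb)

lemma emb_factors:
  "emb *v vec4 (a * c) (a * d) (b * c) (b * d) = tensor (a *s u1 + b *s u2) (c *s w1 + d *s w2)"
  by (rule matrix_eqI) (simp add: emb_mult algebra_simps)

lemma centre_eq: "centre = emb *v vec4 1 0 0 1"
  by (simp add: centre_def emb_mult)

lemma centre_nonzero: "centre \<noteq> 0"
  unfolding centre_eq emb_eq_0_iff by (metis vec4_nth(1) zero_index zero_neq_one)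

text \<open>\<open>coords\<close> contracts rows and columns separately, so it preserves rank one.\<close>

lemma quadric_coords_tensor: "meval quadric (coords *v tensor u w) = 0"
  by (simp only: coords_mult meval_quadric vec4_nth dot_tensor) (simp add: mult_ac)

lemma emb_is_tensor_iff: "(\<exists>u w. emb *v v = tensor u w) \<longleftrightarrow> meval quadric v = 0"
proof
  assume "\<exists>u w. emb *v v = tensor u w"
  then show "meval quadric v = 0" using quadric_coords_tensor coords_emb by metis
next
  assume "meval quadric v = 0"
  then obtain a b c d where "v = vec4 (a * c) (a * d) (b * c) (b * d)"
    by (rule quadric_point_factors)
  then show "\<exists>u w. emb *v v = tensor u w" using emb_factors by blast
qed

lemma centre_notin: "pt centre \<notin> X"
  unfolding mem_segre_variety[OF centre_nonzero]
  unfolding centre_eq emb_is_tensor_iff by (simp add: meval_quadric)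

subsection \<open>Points of the secant locus\<close>

text \<open>Contracting an equation \<open>u1 \<otimes> w1 + u2 \<otimes> w2 = u \<otimes> y + u' \<otimes> z\<close> with \<open>r1, r2\<close> expresses
  \<open>u1, u2\<close> by \<open>u, u'\<close>; this can be inverted. The same holds for the second factors.\<close>

lemma in_planes:
  assumes "centre = tensor u y + tensor u' z"
  shows "u = dot p1 u *s u1 + dot p2 u *s u2"
    and "y = dot r1 y *s w1 + dot r2 y *s w2" and "z = dot r1 z *s w1 + dot r2 z *s w2"
proof -
  have eq: "u1 $ i * w1 $ j + u2 $ i * w2 $ j = u $ i * y $ j + u' $ i * z $ j" for i j
    using arg_cong[OF assms, of "\<lambda>x. x $ (i, j)"] by (simp add: centre_def)
  have rows: "dot s w1 *s u1 + dot s w2 *s u2 = dot s y *s u + dot s z *s u'" for s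
  proof -
    have "dot s w1 * u1 $ i + dot s w2 * u2 $ i = dot s y * u $ i + dot s z * u' $ i" for i
    proof -
      have "(\<Sum>j\<in>UNIV. s $ j * (u1 $ i * w1 $ j + u2 $ i * w2 $ j)) =
          (\<Sum>j\<in>UNIV. s $ j * (u $ i * y $ j + u' $ i * z $ j))"
        by (simp only: eq)
      then show ?thesis
        by (simp add: distrib_left sum.distrib sum_distrib_left sum_distrib_right mult_ac)
    qed
    then show ?thesis by (simp add: vec_eq_iff)
  qed
  have cols: "dot s u1 *s w1 + dot s u2 *s w2 = dot s u *s y + dot s u' *s z" for s
  proof -
    have "dot s u1 * w1 $ j + dot s u2 * w2 $ j = dot s u * y $ j + dot s u' * z $ j" for j
    proof -
      have "(\<Sum>i\<in>UNIV. s $ i * (u1 $ i * w1 $ j + u2 $ i * w2 $ j)) =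
          (\<Sum>i\<in>UNIV. s $ i * (u $ i * y $ j + u' $ i * z $ j))"
        by (simp only: eq)
      then show ?thesis
        by (simp add: distrib_left sum.distrib sum_distrib_left sum_distrib_right mult_ac)
    qed
    then show ?thesis by (simp add: vec_eq_iff)
  qed
  have "u1 = dot r1 y *s u + dot r1 z *s u'" "u2 = dot r2 y *s u + dot r2 z *s u'"
    using rows[of r1] rows[of r2] unfolding r by simp_all
  then show "u = dot p1 u *s u1 + dot p2 u *s u2" by (rule pair_in_span(1)[OF p])
  have "w1 = dot p1 u *s y + dot p1 u' *s z" "w2 = dot p2 u *s y + dot p2 u' *s z"
    using cols[of p1] cols[of p2] unfolding p by simp_all
  from pair_in_span[OF r this]
  show "y = dot r1 y *s w1 + dot r2 y *s w2" "z = dot r1 z *s w1 + dot r2 z *s w2" .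
qed

lemma tensor_in_range_emb:
  assumes "u = a *s u1 + b *s u2" "w = c *s w1 + d *s w2"
  shows "\<exists>v. tensor u w = emb *v v"
  unfolding assms using emb_factors by metis

text \<open>In coordinates, \<open>x = (a, b) \<otimes> (c, d)\<close> has trace \<open>ac + bd\<close>. If the trace is nonzero, the
  identity matrix minus a multiple of \<open>x\<close> has rank one; otherwise \<open>x\<close> is nilpotent and the
  identity matrix is tangent at \<open>x\<close>.\<close>

lemma centre_on_secant_or_tangent:
  fixes a b c d
  defines "u \<equiv> a *s u1 + b *s u2" and "w \<equiv> c *s w1 + d *s w2"
  assumes x: "tensor u w \<noteq> 0"
  shows "(\<exists>e u' w'. centre = e *s tensor u w + tensor u' w') \<or>
    (\<exists>u' w'. centre = tensor u w' + tensor u' w)"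
proof (cases "a * c + b * d = 0")
  case False
  define t where "t = inverse (a * c + b * d)"
  have "(a * c + b * d) *s centre = tensor u w + tensor (d *s u1 - c *s u2) (b *s w1 - a *s w2)"
    by (rule matrix_eqI) (simp add: centre_def u_def w_def algebra_simps)
  then have "t *s ((a * c + b * d) *s centre) =
      t *s (tensor u w + tensor (d *s u1 - c *s u2) (b *s w1 - a *s w2))"
    by simp
  moreover have "t * (a * c + b * d) = 1" using False by (simp add: t_def)
  ultimately have "centre = t *s tensor u w + tensor (t *s (d *s u1 - c *s u2)) (b *s w1 - a *s w2)"
    by (simp only: vector_smult_assoc vector_smult_lid vector_add_ldistrib tensor_linear(5))
  then show ?thesis by blast
next
  case True
  have "u \<noteq> 0" "w \<noteq> 0" using x by (auto simp: tensor_eq_0_iff)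
  obtain g h where gh: "a * h - b * g = 1"
  proof (cases "a = 0")
    case True
    then have "b \<noteq> 0" using \<open>u \<noteq> 0\<close> by (auto simp: u_def)
    then show ?thesis using that[of 0 "- 1 / b"] True by simp
  next
    case False
    then show ?thesis using that[of "1 / a" 0] by simp
  qed
  define t where "t = d * h + c * g"
  have c: "c = - t * b" and d: "d = t * a" using gh True unfolding t_def by algebra+
  have t: "t \<noteq> 0" using \<open>w \<noteq> 0\<close> by (auto simp: w_def c d)
  have entry: "A * C + B * D = (a * A + b * B) * (h * C - g * D) + (g * A + h * B) * (- b * C + a * D)"
    for A B C D :: 'k
  proof -
    have "(a * A + b * B) * (h * C - g * D) + (g * A + h * B) * (- b * C + a * D) =
        (a * h - b * g) * (A * C + B * D)"
      by (simp add: algebra_simps)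
    then show ?thesis by (simp add: gh)
  qed
  have "centre = tensor u (h *s w1 - g *s w2) + tensor (g *s u1 + h *s u2) (- b *s w1 + a *s w2)"
    by (rule matrix_eqI, simp only: centre_def u_def tensor_nth vector_add_component
        vector_minus_component vector_smult_component fst_conv snd_conv) (rule entry)
  also have "- b *s w1 + a *s w2 = inverse t *s w"
  proof -
    have "w = t *s (- b *s w1 + a *s w2)" by (simp add: w_def c d vec_eq_iff algebra_simps)
    then show ?thesis by (simp only: vector_smult_assoc left_inverse[OF t] vector_smult_lid)
  qed
  finally have "centre = tensor u (h *s w1 - g *s w2) + tensor (inverse t *s (g *s u1 + h *s u2)) w"
    by (simp only: tensor_linear)
  then show ?thesis by blast
qed

lemma mem_secant_locus:
  assumes x: "x \<noteq> 0"
  shows "pt x \<in> secant_locus (pt centre) X \<longleftrightarrow> (\<exists>v. x = emb *v v \<and> meval quadric v = 0)"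
proof
  assume sec: "pt x \<in> secant_locus (pt centre) X"
  then have "pt x \<in> X" by (simp add: secant_locus_def)
  then obtain u w where uw: "x = tensor u w" using mem_segre_variety[OF x] by auto
  have "\<exists>v. tensor u w = emb *v v"
    using sec[unfolded uw mem_secant_locus_segre[OF centre_nonzero centre_notin x[unfolded uw]]]
  proof (elim disjE exE)
    fix a u' w' assume eq: "centre = a *s tensor u w + tensor u' w'"
    then have eq': "centre = tensor u (a *s w) + tensor u' w'" by (simp only: tensor_linear)
    have "a \<noteq> 0"
    proof
      assume "a = 0"
      then have "centre = tensor u' w'" using eq by simp
      then show False using centre_notin mem_segre_variety[OF centre_nonzero] by auto
    qed
    have "w = inverse a *s (a *s w)" using \<open>a \<noteq> 0\<close> by simp
    also have "a *s w = dot r1 (a *s w) *s w1 + dot r2 (a *s w) *s w2" by (rule in_planes(2)[OF eq'])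
    finally have "w = (inverse a * dot r1 (a *s w)) *s w1 + (inverse a * dot r2 (a *s w)) *s w2"
      by (simp only: vector_add_ldistrib vector_smult_assoc)
    then show ?thesis using in_planes(1)[OF eq'] by (rule tensor_in_range_emb[rotated])
  next
    fix u' w' assume eq: "centre = tensor u w' + tensor u' w"
    show ?thesis using in_planes(1,3)[OF eq] by (rule tensor_in_range_emb)
  qed
  then obtain v where v: "x = emb *v v" using uw by auto
  then have "meval quadric v = 0" using uw emb_is_tensor_iff by metis
  with v show "\<exists>v. x = emb *v v \<and> meval quadric v = 0" by blast
next
  assume "\<exists>v. x = emb *v v \<and> meval quadric v = 0"
  then obtain v where v: "x = emb *v v" "meval quadric v = 0" by blast
  obtain a b c d where "v = vec4 (a * c) (a * d) (b * c) (b * d)"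
    using v(2) by (rule quadric_point_factors)
  then have x': "x = tensor (a *s u1 + b *s u2) (c *s w1 + d *s w2)"
    using v(1) emb_factors by simp
  show "pt x \<in> secant_locus (pt centre) X"
    unfolding x' mem_secant_locus_segre[OF centre_nonzero centre_notin x[unfolded x']]
    by (rule centre_on_secant_or_tangent[OF x[unfolded x']])
qed

text \<open>A \<open>2 \<times> 2\<close> matrix differs from a singular one by an eigenvalue times the identity, so that
  the cone is the whole space of \<open>2 \<times> 2\<close> matrices.\<close>

lemma mem_cone:
  assumes y: "y \<noteq> 0"
  shows "pt y \<in> cone_over_projection (pt centre) (secant_locus (pt centre) X) \<longleftrightarrow>
    (\<exists>v. y = emb *v v)"
proof
  assume "pt y \<in> cone_over_projection (pt centre) (secant_locus (pt centre) X)"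
  then consider "pt centre = pt y"
    | P where "P \<in> secant_locus (pt centre) X" "pt y \<in> proj_line (pt centre) P"
    by (auto simp: cone_over_projection_def)
  then show "\<exists>v. y = emb *v v"
  proof cases
    case 1
    then obtain c where "y = c *s centre" using pt_eq_iff[OF centre_nonzero y] by auto
    then have "y = emb *v (c *s vec4 1 0 0 1)" by (simp add: centre_eq vec.scale)
    then show ?thesis by blast
  next
    case (2 P)
    obtain x where x: "x \<noteq> 0" "P = pt x" by (rule pt_cases)
    then obtain v where v: "x = emb *v v" using 2(1) mem_secant_locus[OF x(1)] by auto
    obtain a b where "y = a *s centre + b *s x"
      using 2(2) mem_proj_line[OF centre_nonzero x(1) y] x(2) by auto
    then have "y = emb *v (a *s vec4 1 0 0 1 + b *s v)"
      by (simp add: centre_eq v vec.scale vec.add)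
    then show ?thesis by blast
  qed
next
  assume "\<exists>v. y = emb *v v"
  then obtain v where v: "y = emb *v v" by blast
  let ?e = "vec4 1 0 0 1 :: 'k ^ 4"
  obtain t where t: "poly [:v $ 1 * v $ 4 - v $ 2 * v $ 3, - (v $ 1 + v $ 4), 1:] t = 0"
    using alg_closed_imp_poly_has_root[of "[:v $ 1 * v $ 4 - v $ 2 * v $ 3, - (v $ 1 + v $ 4), 1:]"]
    by auto
  define v' where "v' = v - t *s ?e"
  have "meval quadric v' = 0"
    using t by (simp add: v'_def meval_quadric algebra_simps)
  have y': "y = t *s centre + 1 *s (emb *v v')"
    by (simp add: v v'_def centre_eq vec.diff vec.scale)
  show "pt y \<in> cone_over_projection (pt centre) (secant_locus (pt centre) X)"
  proof (cases "v' = 0")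
    case True
    then have "y = t *s centre" using y' by (simp add: matrix_vector_mult_0_right)
    then have "pt y = pt centre" using pt_eq_iff[OF centre_nonzero y] by auto
    then show ?thesis by (simp add: cone_over_projection_def)
  next
    case False
    then have ne: "emb *v v' \<noteq> 0" by (simp add: emb_eq_0_iff)
    have "pt (emb *v v') \<in> secant_locus (pt centre) X"
      using mem_secant_locus[OF ne] \<open>meval quadric v' = 0\<close> by blast
    moreover have "pt y \<in> proj_line (pt centre) (pt (emb *v v'))"
      unfolding mem_proj_line[OF centre_nonzero ne y] using y' by blast
    ultimately show ?thesis by (auto simp: cone_over_projection_def)
  qed
qed

subsection \<open>The scheme structure of the secant locus\<close>

lemma mem_cone_ideal:
  "f \<in> vanishing_ideal (cone_over_projection (pt centre) (secant_locus (pt centre) X)) \<longleftrightarrow>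
    mpullback emb f = 0"
proof
  assume f: "f \<in> vanishing_ideal (cone_over_projection (pt centre) (secant_locus (pt centre) X))"
  have product: "meval (mpullback emb f * mvar 1) v = 0" for v
  proof (cases "v = 0")
    case False
    then have "emb *v v \<noteq> 0" by (simp add: emb_eq_0_iff)
    then have "meval f (emb *v v) = 0" using f mem_cone unfolding vanishing_ideal_iff by blast
    then show ?thesis by (simp add: meval_simps meval_mpullback)
  qed (simp add: meval_simps)
  have *: "meval (mpullback emb f) v = 0" if "v $ 1 \<noteq> 0" for v
    using that product[of v] by (simp add: meval_simps)
  show "mpullback emb f = 0"
  proof (rule mpoly_eq_0I)
    fix v :: "'k ^ 4"
    \<comment> \<open>A line through \<open>v\<close> that meets the hyperplane \<open>x\<^sub>1 = 0\<close> in one point.\<close>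
    define \<gamma> where "\<gamma> i = [:v $ i, if i = 1 then 1 else 0:]" for i :: 4
    have "along \<gamma> (mpullback emb f) = 0"
    proof (rule poly_eq_0_of_cofinite[of "{- v $ 1}"])
      fix s assume "s \<notin> {- v $ 1}"
      then have "v $ 1 + s \<noteq> 0" by (auto simp: add_eq_0_iff)
      then show "poly (along \<gamma> (mpullback emb f)) s = 0"
        unfolding poly_along by (intro *) (simp add: \<gamma>_def)
    qed simp
    moreover have "(\<chi> i. poly (\<gamma> i) 0) = v" by (simp add: \<gamma>_def vec_eq_iff)
    ultimately show "meval (mpullback emb f) v = 0" using poly_along[of \<gamma> "mpullback emb f" 0] by simp
  qed
next
  assume f: "mpullback emb f = 0"
  show "f \<in> vanishing_ideal (cone_over_projection (pt centre) (secant_locus (pt centre) X))"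
    unfolding vanishing_ideal_iff
  proof (intro allI impI)
    fix y assume "y \<noteq> 0" "pt y \<in> cone_over_projection (pt centre) (secant_locus (pt centre) X)"
    then obtain v where "y = emb *v v" using mem_cone by blast
    then show "meval f y = 0" using f meval_mpullback[of emb f v] by (simp add: meval_zero)
  qed
qed

text \<open>Polynomials in the ideal vanish on the quadric. Conversely the pullback of \<open>quadric\<close> along
  \<open>coords\<close> lies in the ideal of the Segre variety and restricts to \<open>quadric\<close>, which realizes any
  multiple of \<open>quadric\<close> as the restriction of a polynomial vanishing on the Segre variety.\<close>

lemma quadric_dvd_imp_mem:
  assumes "quadric dvd mpullback emb f"
  shows "f \<in> secant_scheme_ideal (pt centre) X"
proof -
  obtain h where h: "mpullback emb f = quadric * h" using assms by blast
  let ?g = "mpullback coords quadric * mpullback coords h"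
  have inverse: "mpullback emb (mpullback coords g) = g" for g :: "('k, 4) mpoly"
  proof -
    have "meval (mpullback emb (mpullback coords g) - g) v = 0" for v
      by (simp add: meval_simps meval_mpullback coords_emb)
    then show ?thesis using mpoly_eq_0I by (metis eq_iff_diff_eq_0)
  qed
  have "?g \<in> vanishing_ideal X"
    unfolding vanishing_ideal_iff
  proof (intro allI impI)
    fix y assume "y \<noteq> 0" "pt y \<in> X"
    then obtain u w where "y = tensor u w" using mem_segre_variety by blast
    then show "meval ?g y = 0"
      by (simp only: meval_simps meval_mpullback quadric_coords_tensor) simp
  qed
  moreover have "mpullback emb (f - ?g) = 0"
    by (simp only: mpullback_simps inverse h) simp
  then have "f - ?g \<in> vanishing_ideal (cone_over_projection (pt centre) (secant_locus (pt centre) X))"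
    by (simp only: mem_cone_ideal)
  moreover have "f = ?g + (f - ?g)" by simp
  ultimately show ?thesis
    unfolding secant_scheme_ideal_def ideal_sum_def by blast
qed

lemma secant_scheme_ideal_vanishes:
  assumes "f \<in> secant_scheme_ideal (pt centre) X" "meval quadric v = 0" "v \<noteq> 0"
  shows "meval f (emb *v v) = 0"
proof -
  have ne: "emb *v v \<noteq> 0" using assms(3) by (simp add: emb_eq_0_iff)
  have "pt (emb *v v) \<in> X"
    using mem_segre_variety[OF ne] emb_is_tensor_iff assms(2) by blast
  moreover have "pt (emb *v v) \<in> cone_over_projection (pt centre) (secant_locus (pt centre) X)"
    using mem_cone[OF ne] by blast
  ultimately show ?thesis
    using assms(1) ne unfolding secant_scheme_ideal_def by (intro ideal_sum_vanishes)
qed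

lemma saturation_secant_scheme_ideal:
  "saturation (secant_scheme_ideal (pt centre) X) = {f. quadric dvd mpullback emb f}"
proof (intro equalityI subsetI; unfold mem_Collect_eq)
  fix f assume "f \<in> saturation (secant_scheme_ideal (pt centre) X)"
  then obtain k where k: "\<And>g. g \<in> forms k \<Longrightarrow> f * g \<in> secant_scheme_ideal (pt centre) X"
    unfolding saturation_def by blast
  have *: "meval f (emb *v v) = 0" if v: "meval quadric v = 0" "v \<noteq> 0" for v
  proof -
    have "emb *v v \<noteq> 0" using v by (simp add: emb_eq_0_iff)
    then obtain a where a: "(emb *v v) $ a \<noteq> 0" unfolding vec_eq_iff zero_index by blast
    have "mvar a ^ k \<in> forms k" using forms_power[OF forms_mvar, of a k] by simp
    then have "meval (f * mvar a ^ k) (emb *v v) = 0"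
      using secant_scheme_ideal_vanishes[OF k v] by blast
    then show ?thesis using a by (simp add: meval_simps)
  qed
  show "quadric dvd mpullback emb f"
  proof (rule quadric_dvd_if_vanishes)
    fix a b c d :: 'k
    let ?v = "vec4 (a * c) (a * d) (b * c) (b * d)"
    show "meval (mpullback emb f) ?v = 0"
    proof (cases "?v = 0")
      case False
      then show ?thesis by (simp add: meval_mpullback * meval_quadric)
    next
      case True
      \<comment> \<open>The vertex of the affine cone is approached along a line in the cone.\<close>
      define \<delta> :: "4 \<Rightarrow> 'k poly" where "\<delta> i = [:0, if i = 1 then 1 else 0:]" for i
      have "along \<delta> (mpullback emb f) = 0"
      proof (rule poly_eq_0_of_cofinite[of "{0}"])
        fix s :: 'k assume s: "s \<notin> {0}"
        have "(\<chi> i. poly (\<delta> i) s) = vec4 s 0 0 0" by (rule vec4_eqI) (simp_all add: \<delta>_def)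
        moreover have "vec4 s 0 0 0 \<noteq> 0" using s vec4_nth(1)[of s 0 0 0] by (metis singletonI zero_index)
        ultimately show "poly (along \<delta> (mpullback emb f)) s = 0"
          by (simp add: poly_along meval_mpullback * meval_quadric)
      qed simp
      moreover have "(\<chi> i. poly (\<delta> i) 0) = 0" by (simp add: \<delta>_def vec_eq_iff)
      ultimately show ?thesis using poly_along[of \<delta> "mpullback emb f" 0] True by simp
    qed
  qed
next
  fix f assume f: "quadric dvd mpullback emb f"
  have "f * g \<in> secant_scheme_ideal (pt centre) X" for g
    using f by (intro quadric_dvd_imp_mem) (simp add: mpullback_simps)
  then show "f \<in> saturation (secant_scheme_ideal (pt centre) X)"
    unfolding saturation_def by blast
qed

theorem smooth_quadric_secant_locus:
  "smooth_quadric_surface (secant_scheme_ideal (pt centre) X)"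
  unfolding smooth_quadric_surface_def
proof (rule exI[of _ emb], rule exI[of _ quadric], intro conjI)
  show "inj ((*v) emb)" "quadric \<in> forms 2"
    "saturation (secant_scheme_ideal (pt centre) X) = {f. quadric dvd mpullback emb f}"
    by (rule inj_emb forms_quadric saturation_secant_scheme_ideal)+
qed (auto intro: quadric_smooth)

end

lemma ex_rank_two:
  fixes q :: "'k::{alg_closed_field, field_char_0} ^ ('m::finite \<times> 'n::finite)"
  assumes "q \<noteq> 0" "pt q \<notin> segre_variety" "rank_le_2 q"
  obtains u1 u2 p1 p2 w1 w2 r1 r2 where "rank_two u1 u2 p1 p2 w1 w2 r1 r2" "q = rank_two.centre u1 u2 w1 w2"
proof -
  have not_tensor: "q \<noteq> tensor u w" for u w
    using assms(2) mem_segre_variety[OF assms(1)] by auto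
  obtain u1 w1 u2 w2 where q: "q = tensor u1 w1 + tensor u2 w2"
    using assms(3) unfolding rank_le_2_def by blast
  have "u2 \<noteq> 0" "w2 \<noteq> 0" using not_tensor[of u1 w1] by (auto simp: q tensor_linear)
  have u_ne: "u1 \<noteq> c *s u2" for c
  proof
    assume "u1 = c *s u2"
    then have "q = tensor u2 (c *s w1 + w2)" by (simp add: q tensor_linear)
    then show False using not_tensor by blast
  qed
  obtain p1 p2 where p: "dot p1 u1 = 1" "dot p1 u2 = 0" "dot p2 u1 = 0" "dot p2 u2 = 1"
    using ex_dual_linforms[OF \<open>u2 \<noteq> 0\<close> u_ne] unfolding meval_linform .
  have w_ne: "w1 \<noteq> c *s w2" for c
  proof
    assume "w1 = c *s w2"
    then have "q = tensor (c *s u1 + u2) w2" by (simp add: q tensor_linear)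
    then show False using not_tensor by blast
  qed
  obtain r1 r2 where r: "dot r1 w1 = 1" "dot r1 w2 = 0" "dot r2 w1 = 0" "dot r2 w2 = 1"
    using ex_dual_linforms[OF \<open>w2 \<noteq> 0\<close> w_ne] unfolding meval_linform .
  have rank_two: "rank_two u1 u2 p1 p2 w1 w2 r1 r2"
    by (rule rank_two.intro) (fact p r)+
  then have "q = rank_two.centre u1 u2 w1 w2" using q by (simp add: rank_two.centre_def)
  with rank_two show ?thesis by (rule that)
qed

section \<open>Dimensions\<close>

subsection \<open>Matrices of rank at most two with prescribed supports\<close>

definition supported :: "'i set \<Rightarrow> ('k::field ^ 'i::finite) set"
  where "supported A = {u. \<forall>i. i \<notin> A \<longrightarrow> u $ i = 0}"

definition support_locus ::
    "'m::finite set \<Rightarrow> 'n::finite set \<Rightarrow> 'm set \<Rightarrow> 'n set \<Rightarrow> ('k::field, 'm \<times> 'n) proj set"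
  where "support_locus A B C D = {pt v | v. v \<noteq> 0 \<and>
    (\<exists>u\<in>supported A. \<exists>w\<in>supported B. \<exists>u'\<in>supported C. \<exists>w'\<in>supported D.
      v = tensor u w + tensor u' w')}"

lemma supported_scale: "u \<in> supported A \<Longrightarrow> c *s u \<in> supported A"
  by (auto simp: supported_def)

lemma supported_UNIV [simp]: "supported UNIV = UNIV"
  by (simp add: supported_def)

lemma supported_zero [simp]: "0 \<in> supported A"
  by (simp add: supported_def)

lemma supported_empty [simp]: "supported {} = {0}"
  by (auto simp: supported_def vec_eq_iff)

lemma axis_supported: "i \<in> A \<Longrightarrow> axis i c \<in> supported A"
  by (auto simp: supported_def axis_def)

lemma supported_mono: "A \<subseteq> B \<Longrightarrow> supported A \<subseteq> supported B"
  by (auto simp: supported_def)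

lemma mem_support_locus:
  assumes "v \<noteq> 0"
  shows "pt v \<in> support_locus A B C D \<longleftrightarrow>
    (\<exists>u\<in>supported A. \<exists>w\<in>supported B. \<exists>u'\<in>supported C. \<exists>w'\<in>supported D.
      v = tensor u w + tensor u' w')" (is "_ \<longleftrightarrow> ?rhs")
proof
  assume "pt v \<in> support_locus A B C D"
  then obtain y u w u' w' where y: "pt v = pt y" "y \<noteq> 0"
    and uw: "u \<in> supported A" "w \<in> supported B" "u' \<in> supported C" "w' \<in> supported D"
      "y = tensor u w + tensor u' w'"
    unfolding support_locus_def mem_Collect_eq by (elim exE conjE bexE)
  obtain c where "v = c *s y" using pt_eq_iff[OF y(2) assms] y(1) by auto
  then have v: "v = tensor (c *s u) w + tensor (c *s u') w'"
    unfolding uw(5) by (simp only: tensor_linear(5) vector_add_ldistrib)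
  show ?rhs
    by (rule bexI[of _ "c *s u"], rule bexI[of _ w], rule bexI[of _ "c *s u'"], rule bexI[of _ w'])
      (simp_all add: v uw supported_scale)
next
  assume ?rhs
  with assms show "pt v \<in> support_locus A B C D"
    unfolding support_locus_def mem_Collect_eq by (intro exI[of _ v] conjI refl)
qed

lemma support_locus_mono:
  assumes "A \<subseteq> A'" "B \<subseteq> B'" "C \<subseteq> C'" "D \<subseteq> D'"
  shows "support_locus A B C D \<subseteq> support_locus A' B' C' D'"
proof
  fix P assume P: "P \<in> support_locus A B C D"
  obtain v where v: "v \<noteq> 0" "P = pt v" by (rule pt_cases)
  show "P \<in> support_locus A' B' C' D'"
    using P unfolding v(2) mem_support_locus[OF v(1)]
    by (meson assms[THEN supported_mono, THEN subsetD])
qed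

lemma prime_on_support_locus:
  fixes A C :: "'m::finite set" and B D :: "'n::finite set"
  assumes "i \<in> A" "j \<in> B"
  shows "prime_on (support_locus A B C D :: ('k::field_char_0, 'm \<times> 'n) proj set)"
proof (rule prime_on_if_curves)
  have ne: "tensor (axis i 1) (axis j 1) \<noteq> (0 :: 'k ^ ('m \<times> 'n))"
    by (simp add: tensor_eq_0_iff axis_eq_0_iff)
  have "pt (tensor (axis i 1) (axis j 1)) \<in> (support_locus A B C D :: ('k, 'm \<times> 'n) proj set)"
    unfolding mem_support_locus[OF ne]
    by (rule bexI[OF _ axis_supported[OF assms(1)]], rule bexI[OF _ axis_supported[OF assms(2)]],
        rule bexI[of _ 0], rule bexI[of _ 0]) (simp_all add: tensor_linear)
  then show "support_locus A B C D \<noteq> ({} :: ('k, 'm \<times> 'n) proj set)" by blast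
  fix v y :: "'k ^ ('m \<times> 'n)"
  assume v: "v \<noteq> 0" "pt v \<in> support_locus A B C D" and y: "y \<noteq> 0" "pt y \<in> support_locus A B C D"
  obtain u w u' w' where uw: "u \<in> supported A" "w \<in> supported B" "u' \<in> supported C" "w' \<in> supported D"
    and v': "v = tensor u w + tensor u' w'"
    using v(2) unfolding mem_support_locus[OF v(1)] by (elim bexE)
  obtain a b a' b' where ab: "a \<in> supported A" "b \<in> supported B" "a' \<in> supported C" "b' \<in> supported D"
    and y': "y = tensor a b + tensor a' b'"
    using y(2) unfolding mem_support_locus[OF y(1)] by (elim bexE)
  define \<gamma> where "\<gamma> ij = [:u $ fst ij, a $ fst ij - u $ fst ij:] * [:w $ snd ij, b $ snd ij - w $ snd ij:] +
      [:u' $ fst ij, a' $ fst ij - u' $ fst ij:] * [:w' $ snd ij, b' $ snd ij - w' $ snd ij:]" for ij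
  have \<gamma>: "(\<chi> ij. poly (\<gamma> ij) s) = tensor (u + s *s (a - u)) (w + s *s (b - w)) +
      tensor (u' + s *s (a' - u')) (w' + s *s (b' - w'))" for s
    by (simp add: \<gamma>_def vec_eq_iff algebra_simps)
  have segment: "x + s *s (z - x) \<in> supported E" if "x \<in> supported E" "z \<in> supported E"
    for x z :: "'k ^ 'i::finite" and E s
    using that by (simp add: supported_def)
  have "pt (\<chi> ij. poly (\<gamma> ij) s) \<in> support_locus A B C D" if "(\<chi> ij. poly (\<gamma> ij) s) \<noteq> 0" for s
    unfolding mem_support_locus[OF that] unfolding \<gamma>
    by (rule bexI[OF _ segment[OF uw(1) ab(1)]], rule bexI[OF _ segment[OF uw(2) ab(2)]],
        rule bexI[OF _ segment[OF uw(3) ab(3)]], rule bexI[OF _ segment[OF uw(4) ab(4)]]) (rule refl)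
  moreover have "poly (\<gamma> ij) 0 = v $ ij" "poly (\<gamma> ij) 1 = y $ ij" for ij
    by (simp_all add: \<gamma>_def v' y' algebra_simps)
  ultimately show "\<exists>\<gamma> :: 'm \<times> 'n \<Rightarrow> 'k poly. (\<forall>i. poly (\<gamma> i) 0 = v $ i \<and> poly (\<gamma> i) 1 = y $ i) \<and>
      (\<forall>s. (\<chi> i. poly (\<gamma> i) s) \<noteq> 0 \<longrightarrow> pt (\<chi> i. poly (\<gamma> i) s) \<in> support_locus A B C D)"
    by blast
qed

lemma eq_set_of_points:
  assumes "\<And>v. v \<noteq> 0 \<Longrightarrow> pt v \<in> S \<longleftrightarrow> pt v \<in> T"
  shows "S = T"
proof (rule set_eqI)
  fix P
  show "P \<in> S \<longleftrightarrow> P \<in> T" using assms by (cases P rule: pt_cases) simp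
qed

lemma segre_variety_eq:
  "(segre_variety :: ('a::field, 'b::finite \<times> 'c::finite) proj set) =
    support_locus UNIV UNIV {} D"
proof (rule eq_set_of_points)
  fix v :: "'a ^ ('b \<times> 'c)" assume v: "v \<noteq> 0"
  have "(\<exists>u w. v = tensor u w) \<longleftrightarrow> (\<exists>u\<in>supported UNIV. \<exists>w\<in>supported UNIV.
      \<exists>u'\<in>supported {}. \<exists>w'\<in>supported D. v = tensor u w + tensor u' w')"
  proof -
    have "\<exists>w' :: 'a ^ 'c. w' \<in> supported D" using supported_zero by blast
    then show ?thesis by (simp add: tensor_linear)
  qed
  then show "pt v \<in> segre_variety \<longleftrightarrow> pt v \<in> support_locus UNIV UNIV {} D"
    by (simp only: mem_segre_variety[OF v] mem_support_locus[OF v])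
qed

lemma secant_variety_eq:
  assumes "CARD('n::finite) \<ge> 2"
  shows "secant_variety segre_variety =
    (support_locus UNIV UNIV UNIV UNIV :: ('k::field, 'm::finite \<times> 'n) proj set)"
  by (rule eq_set_of_points) (simp add: mem_secant_variety[OF assms] mem_support_locus rank_le_2_def)

subsection \<open>Parametrizations\<close>

lemma keys_mult_disjoint_box:
  assumes "Poly_Mapping.keys p \<subseteq> box P 1" "Poly_Mapping.keys q \<subseteq> box P' 1" "P \<inter> P' = {}"
  shows "Poly_Mapping.keys (p * q) \<subseteq> box (P \<union> P') 1"
proof
  fix m assume "m \<in> Poly_Mapping.keys (p * q)"
  then obtain k l where m: "m = k + l" "k \<in> Poly_Mapping.keys p" "l \<in> Poly_Mapping.keys q"
    using Poly_Mapping.keys_mult[of p q] by blast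
  then have "k \<in> box P 1" "l \<in> box P' 1" using assms by auto
  then have kl: "Poly_Mapping.lookup k i \<le> (if i \<in> P then 1 else 0)"
    "Poly_Mapping.lookup l i \<le> (if i \<in> P' then 1 else 0)" for i
    by (simp_all only: box_def mem_Collect_eq)
  show "m \<in> box (P \<union> P') 1"
    unfolding box_def mem_Collect_eq
  proof
    fix i
    show "Poly_Mapping.lookup m i \<le> (if i \<in> P \<union> P' then 1 else 0)"
      using kl[of i] assms(3) by (auto simp: m lookup_add split: if_splits)
  qed
qed

lemma axis_nth_if: "axis i c $ j = (if j = i then c else 0)"
  by (simp add: axis_def)

text \<open>On the chart \<open>u $ i0 = w $ j0 = 1\<close> of the Segre variety the other entries of \<open>u\<close> and \<open>w\<close>
  are free parameters.\<close>

lemma segre_parametrization: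
  fixes i0 :: "'m::finite" and j0 :: "'n::finite"
  obtains \<Phi> :: "'m \<times> 'n \<Rightarrow> ('k::field_char_0, 'm + 'n) mpoly" and P :: "('m + 'n) set"
  where "card P = card (UNIV - {i0}) + card (UNIV - {j0})"
    and "\<And>i. Poly_Mapping.keys (\<Phi> i) \<subseteq> box P 1"
    and "\<And>d f. f \<in> forms d \<Longrightarrow> (\<And>t. meval f (\<chi> i. meval (\<Phi> i) t) = 0) \<Longrightarrow> f \<in> vanishing_ideal segre_variety"
proof -
  define P1 P2 where "P1 = (Inl ` (UNIV - {i0}) :: ('m + 'n) set)" and "P2 = (Inr ` (UNIV - {j0}) :: ('m + 'n) set)"
  define \<alpha> where "\<alpha> i = (if i = i0 then 1 else mvar (Inl i) :: ('k, 'm + 'n) mpoly)" for i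
  define \<beta> where "\<beta> j = (if j = j0 then 1 else mvar (Inr j) :: ('k, 'm + 'n) mpoly)" for j
  define \<Phi> where "\<Phi> ij = \<alpha> (fst ij) * \<beta> (snd ij)" for ij
  have disjoint: "P1 \<inter> P2 = {}" by (auto simp: P1_def P2_def)
  have "card (P1 \<union> P2) = card (UNIV - {i0}) + card (UNIV - {j0})"
    using disjoint by (simp add: card_Un_disjoint P1_def P2_def card_image)
  moreover have "Poly_Mapping.keys (\<Phi> i) \<subseteq> box (P1 \<union> P2) 1" for i
  proof -
    have "Poly_Mapping.keys (\<alpha> k) \<subseteq> box P1 1" for k
      unfolding \<alpha>_def by (simp add: P1_def keys_mvar_box[unfolded One_nat_def] keys_one_box del: keys_one)
    moreover have "Poly_Mapping.keys (\<beta> k) \<subseteq> box P2 1" for k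
      unfolding \<beta>_def by (simp add: P2_def keys_mvar_box[unfolded One_nat_def] keys_one_box del: keys_one)
    ultimately show ?thesis unfolding \<Phi>_def using disjoint by (intro keys_mult_disjoint_box)
  qed
  moreover have "f \<in> vanishing_ideal segre_variety"
    if f: "f \<in> forms d" "\<And>t. meval f (\<chi> i. meval (\<Phi> i) t) = 0" for d f
  proof -
    let ?X = "segre_variety :: ('k, 'm \<times> 'n) proj set"
    have chart: "meval f (tensor u w) = 0" if "u $ i0 \<noteq> 0" "w $ j0 \<noteq> 0" for u w
    proof -
      define t where "t = (\<chi> s. case s of Inl i \<Rightarrow> u $ i / u $ i0 | Inr j \<Rightarrow> w $ j / w $ j0)"
      have "meval (\<alpha> i) t = u $ i / u $ i0" "meval (\<beta> j) t = w $ j / w $ j0" for i j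
        using that by (simp_all add: \<alpha>_def \<beta>_def meval_simps t_def)
      then have "(\<chi> i. meval (\<Phi> i) t) = inverse (u $ i0 * w $ j0) *s tensor u w"
        by (simp add: vec_eq_iff \<Phi>_def meval_simps divide_inverse mult_ac)
      with f(2)[of t] have "inverse (u $ i0 * w $ j0) ^ d * meval f (tensor u w) = 0"
        by (simp add: meval_scale[OF f(1)])
      then show ?thesis using that by simp
    qed
    have "f * mvar (i0, j0) \<in> vanishing_ideal ?X"
      unfolding vanishing_ideal_iff
    proof (intro allI impI)
      fix v :: "'k ^ ('m \<times> 'n)" assume v: "v \<noteq> 0" "pt v \<in> ?X"
      then obtain u w where "v = tensor u w" using mem_segre_variety[OF v(1)] by auto
      then show "meval (f * mvar (i0, j0)) v = 0"
        using chart[of u w] by (auto simp: meval_simps)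
    qed
    moreover have "mvar (i0, j0) \<notin> vanishing_ideal ?X"
    proof
      assume *: "mvar (i0, j0) \<in> vanishing_ideal ?X"
      let ?v = "tensor (axis i0 1) (axis j0 1) :: 'k ^ ('m \<times> 'n)"
      have v: "?v \<noteq> 0" by (simp add: tensor_eq_0_iff axis_eq_0_iff)
      then have "pt ?v \<in> ?X" using mem_segre_variety[OF v] by blast
      then have "meval (mvar (i0, j0)) ?v = 0" using * v unfolding vanishing_ideal_iff by blast
      then show False by (simp add: meval_simps axis_nth_if)
    qed
    moreover have "prime_on ?X"
      unfolding segre_variety_eq[where D = "{}"] by (rule prime_on_support_locus) auto
    ultimately show ?thesis using prime_onD[OF _ f(1) forms_mvar] by blast
  qed
  ultimately show ?thesis by (rule that)
qed

text \<open>Where rows \<open>i0\<close> and \<open>i1\<close> are independent, a matrix of rank two is given by these two rows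
  and the coefficients of the other rows with respect to them; scaling normalizes one entry.\<close>

lemma secant_parametrization:
  fixes i0 i1 :: "'m::finite" and j0 j1 :: "'n::finite"
  assumes i: "i0 \<noteq> i1" and j: "j0 \<noteq> j1"
  obtains \<Phi> :: "'m \<times> 'n \<Rightarrow> ('k::field_char_0, ('m + 'n) \<times> bool) mpoly" and P :: "(('m + 'n) \<times> bool) set"
  where "card P = 2 * (CARD('m) - 2) + (CARD('n) - 1) + CARD('n)"
    and "\<And>i. Poly_Mapping.keys (\<Phi> i) \<subseteq> box P 1"
    and "\<And>d f. f \<in> forms d \<Longrightarrow> (\<And>t. meval f (\<chi> i. meval (\<Phi> i) t) = 0) \<Longrightarrow>
      f \<in> vanishing_ideal (support_locus UNIV UNIV UNIV UNIV)"
proof -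
  define P1 where "P1 = (Inl ` (UNIV - {i0, i1}) \<times> UNIV :: (('m + 'n) \<times> bool) set)"
  define P2 where "P2 = (Inr ` (UNIV - {j0}) \<times> {False} :: (('m + 'n) \<times> bool) set)"
  define P3 where "P3 = (Inr ` UNIV \<times> {True} :: (('m + 'n) \<times> bool) set)"
  define P where "P = P1 \<union> (P2 \<union> P3)"
  define \<alpha> where "\<alpha> i = (if i = i0 then 1 else if i = i1 then 0 else mvar (Inl i, False)
      :: ('k, ('m + 'n) \<times> bool) mpoly)" for i
  define \<beta> where "\<beta> i = (if i = i0 then 0 else if i = i1 then 1 else mvar (Inl i, True)
      :: ('k, ('m + 'n) \<times> bool) mpoly)" for i
  define \<rho> where "\<rho> j = (if j = j0 then 1 else mvar (Inr j, False) :: ('k, ('m + 'n) \<times> bool) mpoly)" for j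
  define \<sigma> where "\<sigma> j = (mvar (Inr j, True) :: ('k, ('m + 'n) \<times> bool) mpoly)" for j
  define \<Phi> where "\<Phi> ij = \<alpha> (fst ij) * \<rho> (snd ij) + \<beta> (fst ij) * \<sigma> (snd ij)" for ij
  have disjoint: "P1 \<inter> (P2 \<union> P3) = {}" "P2 \<inter> P3 = {}" by (auto simp: P1_def P2_def P3_def)
  have "card P1 = 2 * (CARD('m) - 2)" "card P2 = CARD('n) - 1" "card P3 = CARD('n)"
    using i by (simp_all add: P1_def P2_def P3_def card_cartesian_product card_image card_Diff_subset)
  then have "card P = 2 * (CARD('m) - 2) + (CARD('n) - 1) + CARD('n)"
    unfolding P_def using card_Un_disjoint[OF finite finite disjoint(1)]
      card_Un_disjoint[OF finite finite disjoint(2)] by (simp only: add.assoc)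
  moreover have "Poly_Mapping.keys (\<Phi> ij) \<subseteq> box P 1" for ij
  proof -
    have "Poly_Mapping.keys (\<alpha> i) \<subseteq> box P1 1" "Poly_Mapping.keys (\<beta> i) \<subseteq> box P1 1" for i
      unfolding \<alpha>_def \<beta>_def
      by (simp_all add: P1_def keys_mvar_box[unfolded One_nat_def] keys_one_box del: keys_one)
    moreover have "Poly_Mapping.keys (\<rho> j) \<subseteq> box (P2 \<union> P3) 1" "Poly_Mapping.keys (\<sigma> j) \<subseteq> box (P2 \<union> P3) 1" for j
      unfolding \<rho>_def \<sigma>_def
      by (simp_all add: P2_def P3_def keys_mvar_box[unfolded One_nat_def] keys_one_box del: keys_one)
    ultimately show ?thesis
      unfolding \<Phi>_def P_def using disjoint(1) by (intro keys_add_box keys_mult_disjoint_box)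
  qed
  moreover have "f \<in> vanishing_ideal (support_locus UNIV UNIV UNIV UNIV)"
    if f: "f \<in> forms d" "\<And>t. meval f (\<chi> i. meval (\<Phi> i) t) = 0" for d f
  proof -
    let ?Z = "support_locus UNIV UNIV UNIV UNIV :: ('k, 'm \<times> 'n) proj set"
    let ?\<delta> = "mvar (i0, j0) * minor2 i0 i1 j0 j1 :: ('k, 'm \<times> 'n) mpoly"
    have chart: "meval f v = 0"
      if v: "v $ (i0, j0) \<noteq> 0" "meval (minor2 i0 i1 j0 j1) v \<noteq> 0" "rank_le_2 v" for v
    proof -
      let ?D = "meval (minor2 i0 i1 j0 j1) v"
      let ?a = "\<lambda>p. (v $ (p, j0) * v $ (i1, j1) - v $ (p, j1) * v $ (i1, j0)) / ?D"
      let ?b = "\<lambda>p. (v $ (p, j1) * v $ (i0, j0) - v $ (p, j0) * v $ (i0, j1)) / ?D"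
      define t :: "'k ^ (('m + 'n) \<times> bool)" where "t = (\<chi> s. case s of
          (Inl p, False) \<Rightarrow> ?a p | (Inl p, True) \<Rightarrow> ?b p
        | (Inr q, False) \<Rightarrow> v $ (i0, q) / v $ (i0, j0) | (Inr q, True) \<Rightarrow> v $ (i1, q) / v $ (i0, j0))"
      have D: "v $ (i0, j0) * v $ (i1, j1) - v $ (i0, j1) * v $ (i1, j0) = ?D"
        "v $ (i1, j1) * v $ (i0, j0) - v $ (i1, j0) * v $ (i0, j1) = ?D"
        by (simp_all add: meval_minor2 mult.commute)
      have "?a i0 = 1" "?a i1 = 0" "?b i0 = 0" "?b i1 = 1"
        unfolding D using v(2) by (simp_all add: mult.commute)
      then have \<alpha>\<beta>: "meval (\<alpha> p) t = ?a p" "meval (\<beta> p) t = ?b p" for p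
        by (simp_all add: \<alpha>_def \<beta>_def meval_simps t_def)
      have \<rho>\<sigma>: "meval (\<rho> q) t = v $ (i0, q) / v $ (i0, j0)" "meval (\<sigma> q) t = v $ (i1, q) / v $ (i0, j0)" for q
        using v(1) by (simp_all add: \<rho>_def \<sigma>_def meval_simps t_def)
      have rows: "v = tensor (\<chi> p. ?a p) (\<chi> q. v $ (i0, q)) + tensor (\<chi> p. ?b p) (\<chi> q. v $ (i1, q))"
        using v(3) unfolding rank_le_2_iff by (intro rows_of_minor2[OF v(2)]) blast
      have entries: "v $ (p, q) = ?a p * v $ (i0, q) + ?b p * v $ (i1, q)" for p q
        using arg_cong[OF rows, of "\<lambda>x. x $ (p, q)"] by simp
      have "(\<chi> i. meval (\<Phi> i) t) = inverse (v $ (i0, j0)) *s v"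
      proof (rule matrix_eqI)
        fix p q
        have "(\<chi> i. meval (\<Phi> i) t) $ (p, q) =
            inverse (v $ (i0, j0)) * (?a p * v $ (i0, q) + ?b p * v $ (i1, q))"
          by (simp only: \<Phi>_def vec_lambda_beta meval_simps \<alpha>\<beta> \<rho>\<sigma> fst_conv snd_conv) (simp add: divide_inverse algebra_simps)
        then show "(\<chi> i. meval (\<Phi> i) t) $ (p, q) = (inverse (v $ (i0, j0)) *s v) $ (p, q)"
          by (simp only: vector_smult_component flip: entries)
      qed
      with f(2)[of t] have "inverse (v $ (i0, j0)) ^ d * meval f v = 0"
        by (simp add: meval_scale[OF f(1)])
      then show ?thesis using v(1) by simp
    qed
    have "f * ?\<delta> \<in> vanishing_ideal ?Z"
      unfolding vanishing_ideal_iff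
    proof (intro allI impI)
      fix v :: "'k ^ ('m \<times> 'n)" assume v: "v \<noteq> 0" "pt v \<in> ?Z"
      then have "rank_le_2 v" by (simp add: mem_support_locus rank_le_2_def)
      then show "meval (f * ?\<delta>) v = 0" using chart[of v] by (auto simp: meval_simps)
    qed
    moreover have "?\<delta> \<notin> vanishing_ideal ?Z"
    proof
      assume *: "?\<delta> \<in> vanishing_ideal ?Z"
      let ?v = "tensor (axis i0 1) (axis j0 1) + tensor (axis i1 1) (axis j1 1) :: 'k ^ ('m \<times> 'n)"
      have \<delta>: "meval ?\<delta> ?v = 1"
        using i j by (simp add: meval_simps meval_minor2 axis_nth_if)
      have v: "?v \<noteq> 0"
      proof
        assume "?v = 0"
        then have "?v $ (i0, j0) = 0" by (simp only: zero_index)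
        then show False using i by (simp add: axis_nth_if)
      qed
      then have "pt ?v \<in> ?Z" unfolding mem_support_locus[OF v] by auto
      then show False using * v \<delta> unfolding vanishing_ideal_iff by (metis zero_neq_one)
    qed
    moreover have "prime_on ?Z" by (rule prime_on_support_locus) auto
    ultimately show ?thesis
      using prime_onD[OF _ f(1) forms_mult[OF forms_mvar forms_minor2]] by blast
  qed
  ultimately show ?thesis by (rule that)
qed

subsection \<open>A chain through the Segre variety to its secant variety\<close>

lemma vanishes_on_support_locusI:
  fixes f :: "('k::field, 'm::finite \<times> 'n::finite) mpoly"
  assumes "\<And>u w u' w'. u \<in> supported A \<Longrightarrow> w \<in> supported B \<Longrightarrow> u' \<in> supported C \<Longrightarrow> w' \<in> supported D \<Longrightarrow>
    meval f (tensor u w + tensor u' w') = 0"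
  shows "f \<in> vanishing_ideal (support_locus A B C D)"
  unfolding vanishing_ideal_iff
proof (intro allI impI)
  fix v :: "'k ^ ('m \<times> 'n)" assume v: "v \<noteq> 0" "pt v \<in> support_locus A B C D"
  show "meval f v = 0"
    using v(2) unfolding mem_support_locus[OF v(1)] by (elim bexE) (simp add: assms)
qed

lemma not_vanishes_on_support_locusI:
  assumes "u \<in> supported A" "w \<in> supported B" "u' \<in> supported C" "w' \<in> supported D"
    and "meval f (tensor u w + tensor u' w') \<noteq> 0" "tensor u w + tensor u' w' \<noteq> 0"
  shows "f \<notin> vanishing_ideal (support_locus A B C D)"
proof
  assume "f \<in> vanishing_ideal (support_locus A B C D)"
  moreover have "pt (tensor u w + tensor u' w') \<in> support_locus A B C D"
    unfolding mem_support_locus[OF assms(6)]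
    by (rule bexI[OF _ assms(1)], rule bexI[OF _ assms(2)], rule bexI[OF _ assms(3)],
        rule bexI[OF _ assms(4)]) (rule refl)
  ultimately show False using assms(5,6) by (simp add: vanishing_ideal_iff)
qed

text \<open>The supports grow by one index at a time: first those of \<open>u\<close> and \<open>w\<close>, which exhausts the
  Segre variety after \<open>a + b\<close> steps, then those of the second summand. There the last row and
  column stay out of the supports, as otherwise the second summand could be absorbed in the
  first one.\<close>

locale segre_chain =
  fixes a b :: nat and row :: "nat \<Rightarrow> 'm::finite" and col :: "nat \<Rightarrow> 'n::finite"
  assumes row: "bij_betw row {..a} UNIV" and col: "bij_betw col {..b} UNIV"
    and a: "a \<ge> 1" and b: "b \<ge> 1"
begin

definition chain :: "nat \<Rightarrow> ('k::field_char_0, 'm \<times> 'n) proj set"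
  where "chain k = support_locus (row ` {..min k a}) (col ` {..min b (k - a)})
    (row ` {..<min a (k - (a + b))}) (col ` {..<Suc (k - (2 * a + b))})"

lemma row_eq_iff: "i \<le> a \<Longrightarrow> j \<le> a \<Longrightarrow> row i = row j \<longleftrightarrow> i = j"
  using row by (auto simp: bij_betw_def inj_on_def)

lemma col_eq_iff: "i \<le> b \<Longrightarrow> j \<le> b \<Longrightarrow> col i = col j \<longleftrightarrow> i = j"
  using col by (auto simp: bij_betw_def inj_on_def)

lemma prime_on_chain: "prime_on (chain k)"
  unfolding chain_def by (rule prime_on_support_locus[of "row 0" _ "col 0"]) auto

lemma chain_mono: "chain k \<subseteq> chain (Suc k)"
  unfolding chain_def by (intro support_locus_mono image_mono) auto

lemma chain_segre: "chain (a + b) = segre_variety"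
  using row col unfolding chain_def segre_variety_eq[of "col ` {..<Suc 0}"]
  by (simp add: bij_betw_def)

lemma chain_le: "chain k \<subseteq> support_locus UNIV UNIV UNIV UNIV"
  unfolding chain_def by (intro support_locus_mono) auto

lemma chain_step_rank_one:
  assumes "k < a + b"
  shows "\<exists>d. \<exists>f\<in>forms d. f \<in> vanishing_ideal (chain k :: ('k::field_char_0, 'm \<times> 'n) proj set) \<and>
    f \<notin> vanishing_ideal (chain (Suc k) :: ('k, 'm \<times> 'n) proj set)"
proof -
  define i where "i = min (Suc k) a"
  define j where "j = Suc k - a"
  have ij: "i \<le> a" "j \<le> b" using assms by (auto simp: i_def j_def)
  let ?f = "mvar (row i, col j) :: ('k, 'm \<times> 'n) mpoly"
  have new: "row i \<notin> row ` {..min k a} \<or> col j \<notin> col ` {..min b (k - a)}"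
  proof (cases "k < a")
    case True
    then show ?thesis using row_eq_iff by (auto simp: i_def)
  next
    case False
    then have "j = Suc (k - a)" by (auto simp: j_def)
    then have "col j \<noteq> col l" if "l \<le> min b (k - a)" for l
      using col_eq_iff[of j l] that ij(2) by auto
    then show ?thesis by (metis atMost_iff imageE)
  qed
  have "?f \<in> vanishing_ideal (chain k)"
    unfolding chain_def
  proof (rule vanishes_on_support_locusI)
    fix u u' :: "'k ^ 'm" and w w' :: "'k ^ 'n"
    assume "u \<in> supported (row ` {..min k a})" "w \<in> supported (col ` {..min b (k - a)})"
      and "u' \<in> supported (row ` {..<min a (k - (a + b))})"
    moreover from this(3) have "u' = 0" using assms by simp
    ultimately show "meval ?f (tensor u w + tensor u' w') = 0"
      using new by (auto simp: meval_simps tensor_linear supported_def)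
  qed
  moreover have "?f \<notin> vanishing_ideal (chain (Suc k))"
    unfolding chain_def
  proof (rule not_vanishes_on_support_locusI[where u' = 0 and w' = 0])
    show "axis (row i) 1 \<in> supported (row ` {..min (Suc k) a})"
      by (rule axis_supported) (auto simp: i_def)
    show "axis (col j) 1 \<in> supported (col ` {..min b (Suc k - a)})"
      by (rule axis_supported) (use ij in \<open>auto simp: j_def\<close>)
  qed (auto simp: meval_simps tensor_linear axis_nth_if tensor_eq_0_iff axis_eq_0_iff)
  ultimately show ?thesis using forms_mvar by blast
qed

lemma chain_step_rank_two:
  assumes "a + b \<le> k" "Suc k < 2 * (a + b)"
  shows "\<exists>d. \<exists>f\<in>forms d. f \<in> vanishing_ideal (chain k :: ('k::field_char_0, 'm \<times> 'n) proj set) \<and>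
    f \<notin> vanishing_ideal (chain (Suc k) :: ('k, 'm \<times> 'n) proj set)"
proof -
  define i where "i = (if k < 2 * a + b then k - (a + b) else 0)"
  define j where "j = Suc k - (2 * a + b)"
  have ij: "i < a" "j < b" using assms a b by (auto simp: i_def j_def)
  let ?f = "minor2 (row i) (row a) (col j) (col b) :: ('k, 'm \<times> 'n) mpoly"
  let ?C = "row ` {..<min a (k - (a + b))}" and ?D = "col ` {..<Suc (k - (2 * a + b))}"
  have new: "row i \<notin> ?C \<or> col j \<notin> ?D"
  proof (cases "k < 2 * a + b")
    case True
    then have "row i \<noteq> row l" if "l < min a (k - (a + b))" for l
      using row_eq_iff[of i l] that ij(1) by (auto simp: i_def)
    then show ?thesis by (metis lessThan_iff imageE)
  next
    case False
    then have "j = Suc (k - (2 * a + b))" by (auto simp: j_def)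
    then have "col j \<noteq> col l" if "l < Suc (k - (2 * a + b))" for l
      using col_eq_iff[of j l] that ij(2) by auto
    then show ?thesis by (metis lessThan_iff imageE)
  qed
  have last: "row a \<notin> ?C" "col b \<notin> ?D"
  proof -
    have "row a \<noteq> row l" if "l < min a (k - (a + b))" for l
      using row_eq_iff[of a l] that by auto
    then show "row a \<notin> ?C" by (metis lessThan_iff imageE)
    have "col b \<noteq> col l" if "l < Suc (k - (2 * a + b))" for l
      using col_eq_iff[of b l] that assms b by auto
    then show "col b \<notin> ?D" by (metis lessThan_iff imageE)
  qed
  have "?f \<in> vanishing_ideal (chain k)"
    unfolding chain_def
  proof (rule vanishes_on_support_locusI)
    fix u u' :: "'k ^ 'm" and w w' :: "'k ^ 'n"
    assume "u' \<in> supported ?C" "w' \<in> supported ?D"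
    then have "u' $ row a = 0" "w' $ col b = 0" "u' $ row i = 0 \<or> w' $ col j = 0"
      using new last by (auto simp: supported_def)
    then show "meval ?f (tensor u w + tensor u' w') = 0"
      by (auto simp: meval_minor2 mult_ac)
  qed
  moreover have "?f \<notin> vanishing_ideal (chain (Suc k))"
    unfolding chain_def
  proof (rule not_vanishes_on_support_locusI)
    let ?u = "axis (row a) 1 :: 'k ^ 'm" and ?w = "axis (col b) 1 :: 'k ^ 'n"
    let ?u' = "axis (row i) 1 :: 'k ^ 'm" and ?w' = "axis (col j) 1 :: 'k ^ 'n"
    show "?u \<in> supported (row ` {..min (Suc k) a})"
      by (rule axis_supported) (use assms in auto)
    show "?w \<in> supported (col ` {..min b (Suc k - a)})"
      by (rule axis_supported) (use assms in auto)
    show "?u' \<in> supported (row ` {..<min a (Suc k - (a + b))})"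
      by (rule axis_supported) (use assms ij a in \<open>auto simp: i_def\<close>)
    show "?w' \<in> supported (col ` {..<Suc (Suc k - (2 * a + b))})"
      by (rule axis_supported) (auto simp: j_def)
    have ne: "row i \<noteq> row a" "col j \<noteq> col b"
      using ij row_eq_iff[of i a] col_eq_iff[of j b] by auto
    then show minor: "meval ?f (tensor ?u ?w + tensor ?u' ?w') \<noteq> 0"
      by (simp add: meval_minor2 axis_nth_if)
    show "tensor ?u ?w + tensor ?u' ?w' \<noteq> 0"
    proof
      assume "tensor ?u ?w + tensor ?u' ?w' = 0"
      then have "meval ?f (tensor ?u ?w + tensor ?u' ?w') = 0" by (simp add: meval_minor2)
      then show False using minor by contradiction
    qed
  qed
  ultimately show ?thesis using forms_minor2 by blast
qed

end

lemma ex_segre_chain: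
  assumes "CARD('m::finite) = a + 1" "CARD('n::finite) = b + 1" "a \<ge> 1" "b \<ge> 1"
  obtains row :: "nat \<Rightarrow> 'm::finite" and col :: "nat \<Rightarrow> 'n::finite" where "segre_chain a b row col"
proof -
  have eq: "{0..<n + 1} = {..n}" for n :: nat by auto
  obtain row :: "nat \<Rightarrow> 'm" where "bij_betw row {..a} UNIV"
    using ex_bij_betw_nat_finite[of "UNIV :: 'm set", OF finite] unfolding assms(1) eq by (elim exE)
  moreover obtain col :: "nat \<Rightarrow> 'n" where "bij_betw col {..b} UNIV"
    using ex_bij_betw_nat_finite[of "UNIV :: 'n set", OF finite] unfolding assms(2) eq by (elim exE)
  ultimately have "segre_chain a b row col" using assms(3,4) by (intro segre_chain.intro)
  then show ?thesis by (rule that)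
qed

theorem proj_dim_segre_variety:
  assumes "CARD('m) = a + 1" "CARD('n) = b + 1" "a \<ge> 1" "b \<ge> 1"
  shows "proj_dim (segre_variety :: ('k::field_char_0, 'm::finite \<times> 'n::finite) proj set) = int (a + b)"
proof -
  obtain row :: "nat \<Rightarrow> 'm" and col :: "nat \<Rightarrow> 'n" where "segre_chain a b row col"
    by (rule ex_segre_chain[OF assms])
  then interpret segre_chain a b row col .
  show ?thesis
  proof (rule segre_parametrization[where 'k = 'k, of "row 0" "col 0"])
    fix \<Phi> :: "'m \<times> 'n \<Rightarrow> ('k, 'm + 'n) mpoly" and P :: "('m + 'n) set"
    assume P: "card P = card (UNIV - {row 0}) + card (UNIV - {col 0})"
      and \<Phi>: "\<And>i. Poly_Mapping.keys (\<Phi> i) \<subseteq> box P 1"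
      "\<And>d f. f \<in> forms d \<Longrightarrow> (\<And>t. meval f (\<chi> i. meval (\<Phi> i) t) = 0) \<Longrightarrow> f \<in> vanishing_ideal segre_variety"
    have card: "card P = a + b" using P assms by (simp add: card_Diff_singleton)
    have "proj_dim (segre_variety :: ('k, 'm \<times> 'n) proj set) = int (card P)"
      using \<Phi>
    proof (rule proj_dim_eqI[where \<Phi> = \<Phi> and S = chain])
      show "chain (card P) \<subseteq> segre_variety" unfolding card chain_segre by (rule subset_refl)
      show "\<exists>d. \<exists>f\<in>forms d. f \<in> vanishing_ideal (chain k :: ('k, 'm \<times> 'n) proj set) \<and>
          f \<notin> vanishing_ideal (chain (Suc k) :: ('k, 'm \<times> 'n) proj set)" if "k < card P" for k
        using that unfolding card by (rule chain_step_rank_one)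
    qed (assumption | rule prime_on_chain chain_mono)+
    then show ?thesis by (simp only: card)
  qed
qed

theorem proj_dim_secant_variety_segre:
  assumes "CARD('m) = a + 1" "CARD('n) = b + 1" "a \<ge> 1" "b \<ge> 1"
  shows "proj_dim (secant_variety (segre_variety :: ('k::field_char_0, 'm::finite \<times> 'n::finite) proj set)) =
    2 * (int a + int b) - 1"
proof -
  obtain row :: "nat \<Rightarrow> 'm" and col :: "nat \<Rightarrow> 'n" where "segre_chain a b row col"
    by (rule ex_segre_chain[OF assms])
  then interpret segre_chain a b row col .
  let ?Z = "support_locus UNIV UNIV UNIV UNIV :: ('k, 'm \<times> 'n) proj set"
  have "row 0 \<noteq> row 1" "col 0 \<noteq> col 1" using row_eq_iff[of 0 1] col_eq_iff[of 0 1] a b by auto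
  then show ?thesis
  proof (rule secant_parametrization[where 'k = 'k])
    fix \<Phi> :: "'m \<times> 'n \<Rightarrow> ('k, ('m + 'n) \<times> bool) mpoly" and P :: "(('m + 'n) \<times> bool) set"
    assume P: "card P = 2 * (CARD('m) - 2) + (CARD('n) - 1) + CARD('n)"
      and \<Phi>: "\<And>i. Poly_Mapping.keys (\<Phi> i) \<subseteq> box P 1"
      "\<And>d f. f \<in> forms d \<Longrightarrow> (\<And>t. meval f (\<chi> i. meval (\<Phi> i) t) = 0) \<Longrightarrow> f \<in> vanishing_ideal ?Z"
    have card: "Suc (card P) = 2 * (a + b)" using P assms by simp
    have "proj_dim ?Z = int (card P)"
      using \<Phi>
    proof (rule proj_dim_eqI[where \<Phi> = \<Phi> and S = chain])
      show "\<exists>d. \<exists>f\<in>forms d. f \<in> vanishing_ideal (chain k :: ('k, 'm \<times> 'n) proj set) \<and>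
          f \<notin> vanishing_ideal (chain (Suc k) :: ('k, 'm \<times> 'n) proj set)" if "k < card P" for k
      proof (cases "k < a + b")
        case True
        then show ?thesis by (rule chain_step_rank_one)
      next
        case False
        then show ?thesis using that card by (intro chain_step_rank_two) linarith+
      qed
    qed (assumption | rule prime_on_chain chain_mono chain_le)+
    moreover have "int (Suc (card P)) = int (2 * (a + b))" by (simp only: card)
    then have "int (card P) = 2 * (int a + int b) - 1" by simp
    moreover have "CARD('n) \<ge> 2" using assms by simp
    ultimately show ?thesis by (simp add: secant_variety_eq)
  qed
qed

subsection \<open>The secant locus\<close>

lemma exI4: "P a b c d \<Longrightarrow> \<exists>a b c d. P a b c d"
  by (intro exI)

lemma vec4_eq_0_iff: "vec4 a b c d = (0 :: 'k::zero ^ 4) \<longleftrightarrow> a = 0 \<and> b = 0 \<and> c = 0 \<and> d = 0"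
  by (simp add: vec_eq_iff forall_4)

context rank_two
begin

text \<open>A point, a line through it and the whole quadric surface, forming a chain of irreducible sets
  of the length of the dimension.\<close>

definition flag :: "bool \<Rightarrow> bool \<Rightarrow> ('k, 'm \<times> 'n) proj set"
  where "flag \<beta> \<delta> = {pt (emb *v vec4 (a * c) (a * d) (b * c) (b * d)) | a b c d.
    vec4 (a * c) (a * d) (b * c) (b * d) \<noteq> 0 \<and> (\<beta> \<or> b = 0) \<and> (\<delta> \<or> d = 0)}"

lemma mem_flag:
  assumes "v \<noteq> 0"
  shows "pt (emb *v v) \<in> flag \<beta> \<delta> \<longleftrightarrow>
    (\<exists>a b c d. v = vec4 (a * c) (a * d) (b * c) (b * d) \<and> (\<beta> \<or> b = 0) \<and> (\<delta> \<or> d = 0))"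
proof
  assume "pt (emb *v v) \<in> flag \<beta> \<delta>"
  then obtain a b c d where eq: "pt (emb *v v) = pt (emb *v vec4 (a * c) (a * d) (b * c) (b * d))"
    and ne: "vec4 (a * c) (a * d) (b * c) (b * d) \<noteq> 0" and "(\<beta> \<or> b = 0) \<and> (\<delta> \<or> d = 0)"
    unfolding flag_def mem_Collect_eq by (elim exE conjE) simp
  moreover obtain e where "emb *v v = e *s (emb *v vec4 (a * c) (a * d) (b * c) (b * d))"
    using eq pt_eq_iff[of "emb *v vec4 (a * c) (a * d) (b * c) (b * d)" "emb *v v"] assms ne
    by (auto simp: emb_eq_0_iff)
  then have "coords *v (emb *v v) = coords *v (emb *v (e *s vec4 (a * c) (a * d) (b * c) (b * d)))"
    by (simp add: vec.scale)
  then have "v = e *s vec4 (a * c) (a * d) (b * c) (b * d)" by (simp only: coords_emb)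
  then have "v = vec4 ((e * a) * c) ((e * a) * d) ((e * b) * c) ((e * b) * d)"
    by (intro vec4_eqI) (simp_all add: mult_ac)
  ultimately show "\<exists>a b c d. v = vec4 (a * c) (a * d) (b * c) (b * d) \<and> (\<beta> \<or> b = 0) \<and> (\<delta> \<or> d = 0)"
    by (intro exI4[of _ "e * a" "e * b" c d]) (simp, blast)
next
  assume "\<exists>a b c d. v = vec4 (a * c) (a * d) (b * c) (b * d) \<and> (\<beta> \<or> b = 0) \<and> (\<delta> \<or> d = 0)"
  then obtain a b c d where v: "v = vec4 (a * c) (a * d) (b * c) (b * d)"
      and "(\<beta> \<or> b = 0) \<and> (\<delta> \<or> d = 0)" by (elim exE conjE) simp
  then show "pt (emb *v v) \<in> flag \<beta> \<delta>"
    using assms unfolding flag_def mem_Collect_eq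
    by (intro exI4[of _ a b c d]) simp
qed

lemma flag_point:
  assumes "P \<in> flag \<beta> \<delta>"
  obtains v where "v \<noteq> 0" "P = pt (emb *v v)"
  using assms unfolding flag_def by blast

lemma secant_locus_eq: "secant_locus (pt centre) X = flag True True"
proof (rule eq_set_of_points)
  fix x :: "'k ^ ('m \<times> 'n)" assume x: "x \<noteq> 0"
  show "pt x \<in> secant_locus (pt centre) X \<longleftrightarrow> pt x \<in> flag True True"
  proof
    assume "pt x \<in> secant_locus (pt centre) X"
    then obtain v where v: "x = emb *v v" "meval quadric v = 0" using mem_secant_locus[OF x] by auto
    then have ne: "v \<noteq> 0" using x by (auto simp: emb_eq_0_iff)
    obtain a b c d where "v = vec4 (a * c) (a * d) (b * c) (b * d)"
      using v(2) by (rule quadric_point_factors)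
    then show "pt x \<in> flag True True" unfolding v(1) mem_flag[OF ne] by auto
  next
    assume "pt x \<in> flag True True"
    then obtain v where v: "v \<noteq> 0" "pt x = pt (emb *v v)" by (rule flag_point)
    have "\<exists>a b c d. v = vec4 (a * c) (a * d) (b * c) (b * d)"
      using \<open>pt x \<in> flag True True\<close> unfolding v(2) mem_flag[OF v(1)] by auto
    then have "meval quadric v = 0" by (auto simp: meval_quadric)
    then show "pt x \<in> secant_locus (pt centre) X"
      unfolding v(2) using mem_secant_locus[of "emb *v v"] v(1) by (auto simp: emb_eq_0_iff)
  qed
qed

lemma flag_mono: "flag False False \<subseteq> flag True False" "flag True False \<subseteq> flag True True"
  unfolding flag_def by blast+

lemma prime_on_flag: "prime_on (flag \<beta> \<delta>)"
proof (rule prime_on_if_curves)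
  let ?e = "vec4 1 0 0 0 :: 'k ^ 4"
  have e: "?e \<noteq> 0" by (simp add: vec4_eq_0_iff)
  have "pt (emb *v ?e) \<in> flag \<beta> \<delta>"
    unfolding mem_flag[OF e] by (rule exI[of _ 1], rule exI[of _ 0], rule exI[of _ 1], rule exI[of _ 0]) simp
  then show "flag \<beta> \<delta> \<noteq> {}" by blast
  fix x y :: "'k ^ ('m \<times> 'n)"
  assume x: "x \<noteq> 0" "pt x \<in> flag \<beta> \<delta>" and y: "y \<noteq> 0" "pt y \<in> flag \<beta> \<delta>"
  have coordinates: "\<exists>a b c d. z = emb *v vec4 (a * c) (a * d) (b * c) (b * d) \<and> (\<beta> \<or> b = 0) \<and> (\<delta> \<or> d = 0)"
    if z: "z \<noteq> 0" "pt z \<in> flag \<beta> \<delta>" for z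
  proof -
    obtain v where v: "v \<noteq> 0" "pt z = pt (emb *v v)" using z(2) by (rule flag_point)
    then have "emb *v v \<noteq> 0" by (simp add: emb_eq_0_iff)
    then obtain e where "z = e *s (emb *v v)" using pt_eq_iff[of "emb *v v" z] v z(1) by auto
    then have z': "z = emb *v (e *s v)" by (simp add: vec.scale)
    then have "e *s v \<noteq> 0" using z(1) by (auto simp: emb_eq_0_iff)
    then obtain a b c d where "e *s v = vec4 (a * c) (a * d) (b * c) (b * d)"
        "(\<beta> \<or> b = 0) \<and> (\<delta> \<or> d = 0)"
      using z(2) unfolding z' by (subst (asm) mem_flag) (assumption, elim exE conjE, simp)
    then show ?thesis unfolding z'
      by (intro exI4[of _ a b c d]) simp
  qed
  obtain a b c d where x': "x = emb *v vec4 (a * c) (a * d) (b * c) (b * d)"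
      and xf: "\<beta> \<or> b = 0" "\<delta> \<or> d = 0" using coordinates[OF x] by (elim exE conjE)
  obtain a' b' c' d' where y': "y = emb *v vec4 (a' * c') (a' * d') (b' * c') (b' * d')"
      and yf: "\<beta> \<or> b' = 0" "\<delta> \<or> d' = 0" using coordinates[OF y] by (elim exE conjE)
  define l where "l z z' = [:z, z' - z:]" for z z' :: 'k
  define \<gamma> where "\<gamma> ij = smult (emb $ ij $ 1) (l a a' * l c c') + smult (emb $ ij $ 2) (l a a' * l d d') +
      smult (emb $ ij $ 3) (l b b' * l c c') + smult (emb $ ij $ 4) (l b b' * l d d')" for ij
  have \<gamma>: "(\<chi> ij. poly (\<gamma> ij) s) = emb *v vec4 (poly (l a a') s * poly (l c c') s)
      (poly (l a a') s * poly (l d d') s) (poly (l b b') s * poly (l c c') s) (poly (l b b') s * poly (l d d') s)" for s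
    by (simp add: vec_eq_iff \<gamma>_def matrix_vector_mult_def sum_4)
  have l: "poly (l z z') 0 = z" "poly (l z z') 1 = z'" "z = 0 \<Longrightarrow> z' = 0 \<Longrightarrow> poly (l z z') s = 0" for z z' s
    by (simp_all add: l_def)
  have "pt (\<chi> ij. poly (\<gamma> ij) s) \<in> flag \<beta> \<delta>" if "(\<chi> ij. poly (\<gamma> ij) s) \<noteq> 0" for s
  proof -
    let ?v = "vec4 (poly (l a a') s * poly (l c c') s) (poly (l a a') s * poly (l d d') s)
      (poly (l b b') s * poly (l c c') s) (poly (l b b') s * poly (l d d') s)"
    have ne: "?v \<noteq> 0" using that unfolding \<gamma> by (simp add: emb_eq_0_iff)
    have "(\<beta> \<or> poly (l b b') s = 0) \<and> (\<delta> \<or> poly (l d d') s = 0)" 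
      using xf yf by (auto intro: l(3))
    then show ?thesis unfolding \<gamma> mem_flag[OF ne]
      by (intro exI4[of _ "poly (l a a') s" "poly (l b b') s" "poly (l c c') s" "poly (l d d') s"]) simp
  qed
  moreover have "poly (\<gamma> ij) 0 = x $ ij" "poly (\<gamma> ij) 1 = y $ ij" for ij
    using arg_cong[OF \<gamma>[of 0], of "\<lambda>z. z $ ij"] arg_cong[OF \<gamma>[of 1], of "\<lambda>z. z $ ij"]
    by (simp_all add: l x' y')
  ultimately show "\<exists>\<gamma> :: 'm \<times> 'n \<Rightarrow> 'k poly. (\<forall>i. poly (\<gamma> i) 0 = x $ i \<and> poly (\<gamma> i) 1 = y $ i) \<and>
      (\<forall>s. (\<chi> i. poly (\<gamma> i) s) \<noteq> 0 \<longrightarrow> pt (\<chi> i. poly (\<gamma> i) s) \<in> flag \<beta> \<delta>)"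
    by (intro exI[of _ \<gamma>] conjI allI impI) simp_all
qed

lemma vanishes_on_flag:
  assumes f: "f \<in> forms e"
  shows "f \<in> vanishing_ideal (flag \<beta> \<delta>) \<longleftrightarrow> (\<forall>a b c d. vec4 (a * c) (a * d) (b * c) (b * d) \<noteq> 0 \<longrightarrow>
    (\<beta> \<or> b = 0) \<longrightarrow> (\<delta> \<or> d = 0) \<longrightarrow> meval f (emb *v vec4 (a * c) (a * d) (b * c) (b * d)) = 0)"
    (is "_ \<longleftrightarrow> ?rhs")
proof
  assume I: "f \<in> vanishing_ideal (flag \<beta> \<delta>)"
  show ?rhs
  proof (intro allI impI)
    fix a b c d :: 'k
    let ?v = "vec4 (a * c) (a * d) (b * c) (b * d)"
    assume v: "?v \<noteq> 0" and bd: "\<beta> \<or> b = 0" "\<delta> \<or> d = 0"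
    have "pt (emb *v ?v) \<in> flag \<beta> \<delta>"
      unfolding mem_flag[OF v] using bd by (intro exI4[of _ a b c d]) simp
    moreover have "emb *v ?v \<noteq> 0" using v by (simp add: emb_eq_0_iff)
    ultimately show "meval f (emb *v ?v) = 0" using I unfolding vanishing_ideal_iff by simp
  qed
next
  assume rhs: ?rhs
  show "f \<in> vanishing_ideal (flag \<beta> \<delta>)"
    unfolding vanishing_ideal_def mem_Collect_eq
  proof
    fix P assume "P \<in> flag \<beta> \<delta>"
    then obtain a b c d where P: "P = pt (emb *v vec4 (a * c) (a * d) (b * c) (b * d))"
      and v: "vec4 (a * c) (a * d) (b * c) (b * d) \<noteq> 0" and bd: "\<beta> \<or> b = 0" "\<delta> \<or> d = 0"
      unfolding flag_def mem_Collect_eq by (elim exE conjE)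
    have "meval f (emb *v vec4 (a * c) (a * d) (b * c) (b * d)) = 0"
      by (rule rhs[rule_format, OF v bd])
    then show "vanishes_at f P"
      unfolding P using vanishes_at_pt[OF f, of "emb *v vec4 (a * c) (a * d) (b * c) (b * d)"] v
      by (simp add: emb_eq_0_iff)
  qed
qed

text \<open>The rows of \<open>coords\<close> serve as the separating forms of the chain.\<close>

lemma meval_coordinate_forms:
  "meval (linform (tensor p1 r1)) (emb *v v) = v $ 1" "meval (linform (tensor p1 r2)) (emb *v v) = v $ 2"
  "meval (linform (tensor p2 r1)) (emb *v v) = v $ 3" "meval (linform (tensor p2 r2)) (emb *v v) = v $ 4"
proof -
  have eq: "vec4 (dot (tensor p1 r1) (emb *v v)) (dot (tensor p1 r2) (emb *v v))
      (dot (tensor p2 r1) (emb *v v)) (dot (tensor p2 r2) (emb *v v)) = v"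
    using coords_emb[of v] unfolding coords_mult .
  show "meval (linform (tensor p1 r1)) (emb *v v) = v $ 1" "meval (linform (tensor p1 r2)) (emb *v v) = v $ 2"
    "meval (linform (tensor p2 r1)) (emb *v v) = v $ 3" "meval (linform (tensor p2 r2)) (emb *v v) = v $ 4"
    unfolding meval_linform
    using arg_cong[OF eq, of "\<lambda>z. z $ 1"] arg_cong[OF eq, of "\<lambda>z. z $ 2"]
      arg_cong[OF eq, of "\<lambda>z. z $ 3"] arg_cong[OF eq, of "\<lambda>z. z $ 4"]
    by (simp_all only: vec4_nth)
qed

text \<open>On the chart \<open>a = c = 1\<close> the quadric is parametrized by \<open>b\<close> and \<open>d\<close>.\<close>

theorem proj_dim_secant_locus: "proj_dim (secant_locus (pt centre) X) = 2"
proof -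
  define \<Phi> :: "'m \<times> 'n \<Rightarrow> ('k, bool) mpoly" where
    "\<Phi> ij = mconst (emb $ ij $ 1) + mconst (emb $ ij $ 2) * mvar True +
      mconst (emb $ ij $ 3) * mvar False + mconst (emb $ ij $ 4) * (mvar False * mvar True)" for ij
  have \<Phi>: "(\<chi> i. meval (\<Phi> i) t) = emb *v vec4 1 (t $ True) (t $ False) (t $ False * t $ True)" for t
    by (simp add: vec_eq_iff \<Phi>_def meval_simps matrix_vector_mult_def sum_4)
  have keys: "Poly_Mapping.keys (\<Phi> ij) \<subseteq> box UNIV 1" for ij
  proof -
    have "Poly_Mapping.keys (mvar False * mvar True :: ('k, bool) mpoly) \<subseteq> box ({False} \<union> {True}) 1"
      by (intro keys_mult_disjoint_box keys_mvar_box) auto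
    moreover have "{False} \<union> {True} = UNIV" by auto
    ultimately have "Poly_Mapping.keys (mvar False * mvar True :: ('k, bool) mpoly) \<subseteq> box UNIV 1" by simp
    then have "Poly_Mapping.keys (mconst c * (mvar False * mvar True) :: ('k, bool) mpoly) \<subseteq> box UNIV 1" for c
      using keys_mult_box[OF keys_mconst_box[of c UNIV 0], of "mvar False * mvar True" 1] by (simp only: add_0)
    moreover have "Poly_Mapping.keys (mconst c * mvar z :: ('k, bool) mpoly) \<subseteq> box UNIV 1" for c z
      using keys_mult_box[OF keys_mconst_box[of c UNIV 0] keys_mvar_box[of z UNIV]] by simp
    ultimately show ?thesis unfolding \<Phi>_def by (intro keys_add_box keys_mconst_box)
  qed
  have dense: "f \<in> vanishing_ideal (flag True True)"
    if f: "f \<in> forms e" "\<And>t. meval f (\<chi> i. meval (\<Phi> i) t) = 0" for e f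
  proof -
    let ?\<delta> = "linform (tensor p1 r1)"
    have "meval f (emb *v vec4 (a * c) (a * d) (b * c) (b * d)) = 0" if "a * c \<noteq> 0" for a b c d
    proof -
      have "vec4 (a * c) (a * d) (b * c) (b * d) =
          (a * c) *s vec4 1 (d / c) (b / a) (b / a * (d / c))"
        using that by (intro vec4_eqI) simp_all
      moreover have "meval f (emb *v vec4 1 (d / c) (b / a) (b / a * (d / c))) = 0"
        using f(2)[of "\<chi> z. if z then d / c else b / a"] unfolding \<Phi> by simp
      ultimately show ?thesis using meval_scale[OF f(1)] by (simp add: vec.scale)
    qed
    then have "f * ?\<delta> \<in> vanishing_ideal (flag True True)"
      unfolding vanishes_on_flag[OF forms_mult[OF f(1) forms_linform]]
      by (simp only: meval_simps meval_coordinate_forms vec4_nth mult_eq_0_iff) blast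
    moreover have "?\<delta> \<notin> vanishing_ideal (flag True True)"
    proof
      assume *: "?\<delta> \<in> vanishing_ideal (flag True True)"
      show False
        using *[unfolded vanishes_on_flag[OF forms_linform] meval_coordinate_forms vec4_nth,
          THEN spec[of _ 1], THEN spec[of _ 0], THEN spec[of _ 1], THEN spec[of _ 0]]
        by (simp add: vec4_eq_0_iff)
    qed
    ultimately show ?thesis using prime_onD[OF prime_on_flag f(1) forms_linform] by blast
  qed
  define S where "S k = (if k = 0 then flag False False else if k = 1 then flag True False else flag True True)" for k :: nat
  have sep0: "linform (tensor p2 r1) \<in> vanishing_ideal (flag False False)"
      "linform (tensor p2 r1) \<notin> vanishing_ideal (flag True False)"
  proof -
    show "linform (tensor p2 r1) \<in> vanishing_ideal (flag False False)"
      unfolding vanishes_on_flag[OF forms_linform] meval_coordinate_forms vec4_nth by simp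
    show "linform (tensor p2 r1) \<notin> vanishing_ideal (flag True False)"
    proof
      assume *: "linform (tensor p2 r1) \<in> vanishing_ideal (flag True False)"
      show False
        using *[unfolded vanishes_on_flag[OF forms_linform] meval_coordinate_forms vec4_nth,
          THEN spec[of _ 0], THEN spec[of _ 1], THEN spec[of _ 1], THEN spec[of _ 0]]
        by (simp add: vec4_eq_0_iff)
    qed
  qed
  have sep1: "linform (tensor p1 r2) \<in> vanishing_ideal (flag True False)"
      "linform (tensor p1 r2) \<notin> vanishing_ideal (flag True True)"
  proof -
    show "linform (tensor p1 r2) \<in> vanishing_ideal (flag True False)"
      unfolding vanishes_on_flag[OF forms_linform] meval_coordinate_forms vec4_nth by simp
    show "linform (tensor p1 r2) \<notin> vanishing_ideal (flag True True)"
    proof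
      assume *: "linform (tensor p1 r2) \<in> vanishing_ideal (flag True True)"
      show False
        using *[unfolded vanishes_on_flag[OF forms_linform] meval_coordinate_forms vec4_nth,
          THEN spec[of _ 1], THEN spec[of _ 0], THEN spec[of _ 0], THEN spec[of _ 1]]
        by (simp add: vec4_eq_0_iff)
    qed
  qed
  have "proj_dim (flag True True) = int (card (UNIV :: bool set))"
    using keys dense
  proof (rule proj_dim_eqI[where \<Phi> = \<Phi> and S = S])
    fix i assume "i < card (UNIV :: bool set)"
    then have i: "i = 0 \<or> i = 1" by (auto simp: card_UNIV_bool)
    then show "S i \<subseteq> S (Suc i)" using flag_mono by (auto simp: S_def)
    show "\<exists>d. \<exists>f\<in>forms d. f \<in> vanishing_ideal (S i) \<and> f \<notin> vanishing_ideal (S (Suc i))"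
    proof (cases "i = 0")
      case True
      then show ?thesis
        using sep0 by (intro exI[of _ 1] bexI[OF _ forms_linform[of "tensor p2 r1"]]) (simp add: S_def)
    next
      case False
      then show ?thesis
        using i sep1 by (intro exI[of _ 1] bexI[OF _ forms_linform[of "tensor p1 r2"]]) (simp add: S_def)
    qed
  qed (auto simp: S_def prime_on_flag)
  then show ?thesis by (simp add: secant_locus_eq)
qed

end

text \<open>Every secant or tangent line of the Segre variety consists of matrices of rank at most two.\<close>

lemma secant_locus_empty:
  fixes q :: "'k::field_char_0 ^ ('m::finite \<times> 'n::finite)"
  assumes q: "q \<noteq> 0" "pt q \<notin> segre_variety" "\<not> rank_le_2 q"
  shows "secant_locus (pt q) segre_variety = {}"
proof (rule ccontr)
  assume "secant_locus (pt q) segre_variety \<noteq> {}"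
  then obtain x where x: "x \<noteq> 0" "pt x \<in> secant_locus (pt q) segre_variety" by (rule nonempty_pt)
  then have "pt x \<in> segre_variety" by (simp add: secant_locus_def)
  then obtain u w where uw: "x = tensor u w" using mem_segre_variety[OF x(1)] by auto
  have "rank_le_2 q"
    using x(2) unfolding uw mem_secant_locus_segre[OF q(1,2) x(1)[unfolded uw]]
  proof (elim disjE exE)
    fix a u' w' assume "q = a *s tensor u w + tensor u' w'"
    then have "q = tensor (a *s u) w + tensor u' w'" by (simp only: tensor_linear)
    then show ?thesis unfolding rank_le_2_def by (intro exI)
  next
    fix u' w' assume "q = tensor u w' + tensor u' w"
    then show ?thesis unfolding rank_le_2_def by (intro exI)
  qed
  then show False using q(3) by contradiction
qed

section \<open>The secant stratification\<close>

theorem theorem4p4: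
  fixes X :: "('k::{alg_closed_field, field_char_0}, 'm::finite \<times> 'n::finite) proj set"
    and a b :: nat
  assumes "CARD('m) = a + 1" and "CARD('n) = b + 1"
    and "a \<ge> 1" and "b \<ge> 2"
    and "X = segre_variety"
  shows "(\<forall>q \<in> secant_variety X - X. smooth_quadric_surface (secant_scheme_ideal q X)) \<and>
    secant_variety X = tangent_variety X \<and>
    proj_dim (tangent_variety X) = 2 * (int a + int b) - 1 \<and>
    UNIV = SL (-1) X \<union> SL 2 X \<union> SL (int (a + b)) X \<and>
    (\<forall>s \<in> {-1..int (a + b)} - {-1, 2, int (a + b)}. SL s X = {}) \<and>
    SL 2 X = secant_variety X - X \<and>
    SL (int (a + b)) X = X"
proof -
  have n: "CARD('n) \<ge> 2" and b: "b \<ge> 1" using assms by auto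
  have sec_tan: "secant_variety X = tangent_variety X"
    by (rule eq_set_of_points) (simp add: assms(5) mem_secant_variety[OF n] mem_tangent_variety)
  have dim_sec: "proj_dim (secant_variety X) = 2 * (int a + int b) - 1"
    unfolding assms(5) by (rule proj_dim_secant_variety_segre[OF assms(1,2,3) b])
  have dim_X: "proj_dim X = int (a + b)"
    unfolding assms(5) by (rule proj_dim_segre_variety[OF assms(1,2,3) b])
  have X_sec: "X \<subseteq> secant_variety X"
    unfolding assms(5) secant_variety_eq[OF n]
    by (subst segre_variety_eq[where D = UNIV], rule support_locus_mono) auto
  have rank2: "smooth_quadric_surface (secant_scheme_ideal Q X) \<and> proj_dim (secant_locus Q X) = 2"
    if Q: "Q \<in> secant_variety X - X" for Q
  proof -
    obtain q where q: "q \<noteq> 0" "Q = pt q" by (rule pt_cases)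
    then have "pt q \<notin> segre_variety" "rank_le_2 q"
      using Q mem_secant_variety[OF n q(1)] by (simp_all add: assms(5))
    then obtain u1 u2 p1 p2 w1 w2 r1 r2 where r: "rank_two u1 u2 p1 p2 w1 w2 r1 r2"
      and c: "q = rank_two.centre u1 u2 w1 w2"
      by (rule ex_rank_two[OF q(1)])
    show ?thesis
      unfolding q(2) c assms(5)
      using rank_two.smooth_quadric_secant_locus[OF r] rank_two.proj_dim_secant_locus[OF r] by simp
  qed
  have rank3: "secant_locus Q X = {}" if Q: "Q \<notin> secant_variety X" for Q
  proof -
    obtain q where q: "q \<noteq> 0" "Q = pt q" by (rule pt_cases)
    have "Q \<notin> X" using Q X_sec by blast
    then show ?thesis
      using Q mem_secant_variety[OF n q(1)] secant_locus_empty[OF q(1)] by (simp add: assms(5) q(2))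
  qed
  have dim: "secant_locus_dim Q X =
      (if Q \<in> X then int (a + b) else if Q \<in> secant_variety X then 2 else - 1)" for Q
    using dim_X rank2[of Q] rank3[of Q] by (simp add: secant_locus_dim_def proj_dim_empty)
  have "int (a + b) \<noteq> 2" "int (a + b) \<noteq> - 1" using assms(3,4) by auto
  then have SL: "SL s X = (if s = int (a + b) then X else if s = 2 then secant_variety X - X
      else if s = - 1 then - secant_variety X else {})" for s
    using X_sec unfolding SL_def dim by auto
  show ?thesis
  proof (intro conjI)
    show "\<forall>q \<in> secant_variety X - X. smooth_quadric_surface (secant_scheme_ideal q X)"
      using rank2 by blast
    show "secant_variety X = tangent_variety X" by (rule sec_tan)
    show "proj_dim (tangent_variety X) = 2 * (int a + int b) - 1"
      using dim_sec by (simp only: sec_tan)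
    show "UNIV = SL (-1) X \<union> SL 2 X \<union> SL (int (a + b)) X"
      using \<open>int (a + b) \<noteq> 2\<close> \<open>int (a + b) \<noteq> - 1\<close> unfolding SL by auto
    show "\<forall>s \<in> {-1..int (a + b)} - {-1, 2, int (a + b)}. SL s X = {}"
      unfolding SL by simp
    show "SL 2 X = secant_variety X - X" "SL (int (a + b)) X = X"
      using \<open>int (a + b) \<noteq> 2\<close> unfolding SL by auto
  qed
qed

end
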